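(* Let $X$ be a compact complex manifold of dimension $n\ge 2$ with a Kähler metric $\omega$, and let $E\to X$ be a holomorphic vector bundle of rank $r$. If $E$ admits a Hermite--Einstein metric $h$ with respect to $\omega$, with Hermite--Einstein constant $\lambda_E$, then $$ s_2(E,h)\wedge\omega^{n-2}\le\lambda_E\,\frac{r+1}{2n}\,c_1(E,h)\wedge\omega^{n-1} $$ at every point of $X$. Moreover, the equality holds if and only if $$ \frac i{2\pi}\,\Theta(E,h)=\frac{\lambda_E}{n}\,\omega\otimes\operatorname{Id}_E, $$ so that in particular (in the case of equality) $E$ is projectively flat, i.e. $\frac i{2\pi}\Theta(E,h)=\frac 1r\,c_1(E,h)\otimes\operatorname{Id}_E$, and $$ c_1(E,h)=\lambda_E\,\frac rn\,\omega. $$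
   Context: $\Theta(E,h)=D_{E,h}^2$ denotes the $\operatorname{End}(E)$-valued $(1,1)$-form which is the curvature of the Chern connection $D_{E,h}$ of $(E,h)$. Chern forms: $c_k(E,h)$ are defined by $\det\bigl(\operatorname{Id}+\frac{it}{2\pi}\Theta(E,h)\bigr)=\sum_{k=0}^r c_k(E,h)\,t^k$. Second Segre form: $s_2(E,h)=c_1(E,h)\wedge c_1(E,h)-c_2(E,h)$ (with $c_2(E,h)=0$ if $r=1$). Hermite--Einstein: $h$ is a Hermite--Einstein metric with respect to $\omega$ if there exists a real number $\lambda_E$ such that the following identity of $\operatorname{End}(E)$-valued $(n,n)$-forms holds everywhere on $X$: $$ \frac i{2\pi}\,\Theta(E,h)\wedge\frac{\omega^{n-1}}{(n-1)!}=\lambda_{E}\,\frac{\omega^n}{n!}\operatorname{Id}_E . $$ Inequality between real $(n,n)$-forms: $\alpha\le\beta$ at a point means $\beta-\alpha=f\,\omega^n$ with $f\ge 0$ at that point. "The equality holds" means equality at every point of $X$, and the stated characterization is an identity of forms on all of $X$. *)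

theory Defs
  imports "HOL-Analysis.Analysis" "HOL-Computational_Algebra.Polynomial"
begin

section \<open>The ring of complex-valued alternating forms of even degree\<close>

text \<open>
  An inhomogeneous form on a real vector space is a function on lists of vectors; its
  restriction to the lists of length \<open>k\<close> is its component of degree \<open>k\<close>.
  The recursion for the wedge product says that contraction with a vector is an antiderivation.
  It yields the normalization
  \<open>(\<alpha> \<and> \<beta>)(v\<^sub>1, \<dots>, v\<^sub>m) = 1/(p! q!) \<Sum>\<^sub>\<sigma> sign(\<sigma>) \<alpha>(v\<^bsub>\<sigma>(1)\<^esub>, \<dots>, v\<^bsub>\<sigma>(p)\<^esub>) \<beta>(v\<^bsub>\<sigma>(p+1)\<^esub>, \<dots>, v\<^bsub>\<sigma>(m)\<^esub>)\<close>, \<open>m = p + q\<close>,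
  for alternating \<open>\<alpha>\<close>, \<open>\<beta>\<close> of degrees \<open>p\<close>, \<open>q\<close>; in particular
  \<open>(\<alpha> \<and> \<beta>)(u, v) = \<alpha>(u) \<beta>(v) - \<alpha>(v) \<beta>(u)\<close> in degree one.
\<close>

definition grade_sign :: "('v list \<Rightarrow> complex) \<Rightarrow> 'v list \<Rightarrow> complex" where
  "grade_sign f = (\<lambda>vs. (-1) ^ length vs * f vs)"

fun wedge :: "('v list \<Rightarrow> complex) \<Rightarrow> ('v list \<Rightarrow> complex) \<Rightarrow> 'v list \<Rightarrow> complex" where
  "wedge f g [] = f [] * g []"
| "wedge f g (v # vs) =
     wedge (\<lambda>xs. f (v # xs)) g vs + wedge (grade_sign f) (\<lambda>xs. g (v # xs)) vs"

definition even_alternating_form :: "('v::real_vector list \<Rightarrow> complex) \<Rightarrow> bool" where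
  "even_alternating_form f \<longleftrightarrow>
     (\<forall>vs. odd (length vs) \<longrightarrow> f vs = 0) \<and>
     (\<forall>xs ys. linear (\<lambda>v. f (xs @ v # ys))) \<and>
     (\<forall>vs. \<not> distinct vs \<longrightarrow> f vs = 0)"

lemma grade_sign_Cons [simp]: "(\<lambda>xs. grade_sign f (v # xs)) = (\<lambda>xs. - grade_sign (\<lambda>xs. f (v # xs)) xs)"
  by (simp add: grade_sign_def fun_eq_iff)

lemma grade_sign_grade_sign [simp]: "grade_sign (grade_sign f) = f"
  by (simp add: grade_sign_def fun_eq_iff flip: mult.assoc power_add)

lemma grade_sign_add: "grade_sign (\<lambda>xs. f xs + g xs) = (\<lambda>xs. grade_sign f xs + grade_sign g xs)"
  by (simp add: grade_sign_def fun_eq_iff algebra_simps)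

lemma grade_sign_scale: "grade_sign (\<lambda>xs. c * f xs) = (\<lambda>xs. c * grade_sign f xs)"
  by (simp add: grade_sign_def fun_eq_iff)

lemma wedge_add_left: "wedge (\<lambda>xs. f xs + f' xs) g vs = wedge f g vs + wedge f' g vs"
  by (induction vs arbitrary: f f' g) (simp_all add: algebra_simps grade_sign_add)

lemma wedge_add_right: "wedge f (\<lambda>xs. g xs + g' xs) vs = wedge f g vs + wedge f g' vs"
  by (induction vs arbitrary: f g g') (simp_all add: algebra_simps)

lemma wedge_scale_left: "wedge (\<lambda>xs. c * f xs) g vs = c * wedge f g vs"
  by (induction vs arbitrary: f g) (simp_all add: algebra_simps grade_sign_scale)

lemma wedge_scale_right: "wedge f (\<lambda>xs. c * g xs) vs = c * wedge f g vs"
  by (induction vs arbitrary: f g) (simp_all add: algebra_simps)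

lemma wedge_minus_left: "wedge (\<lambda>xs. - f xs) g vs = - wedge f g vs"
  using wedge_scale_left[of "-1" f g vs] by simp

lemma wedge_minus_right: "wedge f (\<lambda>xs. - g xs) vs = - wedge f g vs"
  using wedge_scale_right[of f "-1" g vs] by simp

lemma wedge_zero_left [simp]: "wedge (\<lambda>xs. 0) g vs = 0"
  using wedge_scale_left[of 0 "\<lambda>_. 0" g vs] by simp

lemma wedge_zero_right [simp]: "wedge f (\<lambda>xs. 0) vs = 0"
  using wedge_scale_right[of f 0 "\<lambda>_. 0" vs] by simp

lemma grade_sign_wedge: "grade_sign (wedge f g) vs = wedge (grade_sign f) (grade_sign g) vs"
proof (induction vs arbitrary: f g)
  case Nil
  show ?case by (simp add: grade_sign_def)
next
  case (Cons v vs)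
  have "grade_sign (wedge f g) (v # vs) =
      - (grade_sign (wedge (\<lambda>xs. f (v # xs)) g) vs +
         grade_sign (wedge (grade_sign f) (\<lambda>xs. g (v # xs))) vs)"
    by (simp add: grade_sign_def algebra_simps)
  then show ?case
    by (simp add: Cons.IH wedge_minus_left wedge_minus_right)
qed

lemma wedge_assoc: "wedge (wedge f g) k vs = wedge f (wedge g k) vs"
proof (induction vs arbitrary: f g k)
  case Nil
  show ?case by simp
next
  case (Cons v vs)
  have 1: "grade_sign (wedge f g) = wedge (grade_sign f) (grade_sign g)"
    by (rule ext) (rule grade_sign_wedge)
  show ?case
    by (simp add: 1 wedge_add_left wedge_add_right Cons.IH)
qed

lemma wedge_commute_aux:
  fixes a b :: complex
  assumes "\<And>xs. grade_sign f xs = a * f xs" "\<And>xs. grade_sign g xs = b * g xs"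
    and "a \<in> {1, -1}" "b \<in> {1, -1}"
  shows "wedge f g vs = (if a = -1 \<and> b = -1 then -1 else 1) * wedge g f vs"
  using assms
proof (induction vs arbitrary: f g a b)
  case Nil
  from Nil(1)[of "[]"] Nil(2)[of "[]"] Nil(3,4) show ?case
    by (auto simp: grade_sign_def)
next
  case (Cons v vs)
  have f: "grade_sign f = (\<lambda>xs. a * f xs)" and g: "grade_sign g = (\<lambda>xs. b * g xs)"
    using Cons.prems by auto
  have fv: "grade_sign (\<lambda>xs. f (v # xs)) xs = (- a) * f (v # xs)" for xs
    using fun_cong[OF f, of "v # xs"] by (simp add: grade_sign_def) (metis minus_equation_iff)
  have gv: "grade_sign (\<lambda>xs. g (v # xs)) xs = (- b) * g (v # xs)" for xs
    using fun_cong[OF g, of "v # xs"] by (simp add: grade_sign_def) (metis minus_equation_iff)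
  have 1: "wedge (\<lambda>xs. f (v # xs)) g vs =
      (if -a = -1 \<and> b = -1 then -1 else 1) * wedge g (\<lambda>xs. f (v # xs)) vs"
    by (rule Cons.IH) (use fv Cons.prems in auto)
  have 2: "wedge f (\<lambda>xs. g (v # xs)) vs =
      (if a = -1 \<and> -b = -1 then -1 else 1) * wedge (\<lambda>xs. g (v # xs)) f vs"
    by (rule Cons.IH) (use gv Cons.prems in auto)
  show ?case
    using Cons.prems(3,4) by (auto simp: f g 1 2 wedge_scale_left)
qed

lemma wedge_commute_even:
  assumes "\<And>xs. odd (length xs) \<Longrightarrow> f xs = 0" "\<And>xs. odd (length xs) \<Longrightarrow> g xs = 0"
  shows "wedge f g vs = wedge g f vs"
proof -
  have "grade_sign f xs = 1 * f xs" "grade_sign g xs = 1 * g xs" for xs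
    using assms by (cases "even (length xs)"; simp add: grade_sign_def)+
  from wedge_commute_aux[OF this, of vs] show ?thesis by simp
qed

lemma wedge_parity:
  assumes "\<And>xs. odd (length xs) \<Longrightarrow> f xs = 0" "\<And>xs. odd (length xs) \<Longrightarrow> g xs = 0"
    and "odd (length vs)"
  shows "wedge f g vs = 0"
proof -
  have "grade_sign f = f" "grade_sign g = g"
    by (rule ext, rename_tac xs, use assms in \<open>case_tac "even (length xs)"\<close>,
        auto simp: grade_sign_def)+
  with grade_sign_wedge[of f g vs] have "grade_sign (wedge f g) vs = wedge f g vs" by simp
  with assms(3) show ?thesis by (simp add: grade_sign_def)
qed

lemma linear_complex_iff:
  "linear (f :: 'v::real_vector \<Rightarrow> complex) \<longleftrightarrow>
     (\<forall>u v. f (u + v) = f u + f v) \<and> (\<forall>r v. f (r *\<^sub>R v) = of_real r * f v)"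
  by (simp add: linear_iff scaleR_conv_of_real)

lemma wedge_family_linear_left:
  fixes F :: "'v::real_vector \<Rightarrow> 'w list \<Rightarrow> complex"
  assumes "\<And>xs. linear (\<lambda>v. F v xs)"
  shows "linear (\<lambda>v. wedge (F v) g vs)"
proof -
  have a: "F (u + v) = (\<lambda>xs. F u xs + F v xs)" and b: "F (r *\<^sub>R v) = (\<lambda>xs. of_real r * F v xs)" for u v r
    using assms by (auto simp: linear_complex_iff)
  show ?thesis
    by (simp add: linear_complex_iff a b wedge_add_left wedge_scale_left)
qed

lemma wedge_family_linear_right:
  fixes F :: "'v::real_vector \<Rightarrow> 'w list \<Rightarrow> complex"
  assumes "\<And>xs. linear (\<lambda>v. F v xs)"
  shows "linear (\<lambda>v. wedge g (F v) vs)"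
proof -
  have a: "F (u + v) = (\<lambda>xs. F u xs + F v xs)" and b: "F (r *\<^sub>R v) = (\<lambda>xs. of_real r * F v xs)" for u v r
    using assms by (auto simp: linear_complex_iff)
  show ?thesis
    by (simp add: linear_complex_iff a b wedge_add_right wedge_scale_right)
qed

lemma grade_sign_multilinear:
  assumes "\<And>xs ys. linear (\<lambda>v. f (xs @ v # ys))"
  shows "linear (\<lambda>v. grade_sign f (xs @ v # ys))"
  using assms[of xs ys] unfolding linear_complex_iff grade_sign_def by (simp add: algebra_simps)

lemma wedge_multilinear:
  fixes f g :: "'v::real_vector list \<Rightarrow> complex"
  assumes "\<And>xs ys. linear (\<lambda>v. f (xs @ v # ys))" "\<And>xs ys. linear (\<lambda>v. g (xs @ v # ys))"
  shows "linear (\<lambda>v. wedge f g (xs @ v # ys))"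
  using assms
proof (induction xs arbitrary: f g)
  case Nil
  have "linear (\<lambda>v. wedge (\<lambda>xs. f (v # xs)) g ys)"
    by (rule wedge_family_linear_left) (use Nil(1)[of "[]"] in simp)
  moreover have "linear (\<lambda>v. wedge (grade_sign f) (\<lambda>xs. g (v # xs)) ys)"
    by (rule wedge_family_linear_right) (use Nil(2)[of "[]"] in simp)
  ultimately show ?case by (simp add: linear_compose_add)
next
  case (Cons x xs)
  have "linear (\<lambda>v. wedge (\<lambda>xs. f (x # xs)) g (xs @ v # ys))"
    by (rule Cons.IH) (use Cons.prems(1)[of "x # _"] Cons.prems(2) in auto)
  moreover have "linear (\<lambda>v. wedge (grade_sign f) (\<lambda>xs. g (x # xs)) (xs @ v # ys))"
    by (rule Cons.IH) (use Cons.prems(2)[of "x # _"] grade_sign_multilinear[OF Cons.prems(1)] in auto)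
  ultimately show ?case by (simp add: linear_compose_add)
qed

lemma wedge_adjacent:
  assumes "\<And>xs v ys. f (xs @ v # v # ys) = 0" "\<And>xs v ys. g (xs @ v # v # ys) = 0"
  shows "wedge f g (xs @ v # v # ys) = 0"
  using assms
proof (induction xs arbitrary: f g)
  case Nil
  have "(\<lambda>xs. f (v # v # xs)) = (\<lambda>_. 0)" "(\<lambda>xs. g (v # v # xs)) = (\<lambda>_. 0)"
    using Nil(1)[of "[]" v] Nil(2)[of "[]" v] by auto
  then show ?case by (simp add: wedge_minus_left)
next
  case (Cons x xs)
  have "wedge (\<lambda>xs. f (x # xs)) g (xs @ v # v # ys) = 0"
    by (rule Cons.IH) (use Cons.prems(1)[of "x # _"] Cons.prems(2) in auto)
  moreover have "wedge (grade_sign f) (\<lambda>xs. g (x # xs)) (xs @ v # v # ys) = 0"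
    by (rule Cons.IH) (use Cons.prems(2)[of "x # _"] Cons.prems(1) in \<open>auto simp: grade_sign_def\<close>)
  ultimately show ?case by simp
qed

lemma adjacent_imp_alternating:
  fixes f :: "'v::real_vector list \<Rightarrow> complex"
  assumes lin: "\<And>xs ys. linear (\<lambda>v. f (xs @ v # ys))"
    and adj: "\<And>xs v ys. f (xs @ v # v # ys) = 0"
    and "\<not> distinct vs"
  shows "f vs = 0"
proof -
  have swap: "f (xs @ u # v # ys) = - f (xs @ v # u # ys)" for xs u v ys
  proof -
    have l1: "f (xs @ (u + v) # zs) = f (xs @ u # zs) + f (xs @ v # zs)" for zs
      using lin[of xs zs] by (simp add: linear_complex_iff)
    have l2: "f (xs @ w # (u + v) # ys) = f (xs @ w # u # ys) + f (xs @ w # v # ys)" for w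
      using lin[of "xs @ [w]" ys] by (simp add: linear_complex_iff)
    have "f (xs @ (u + v) # (u + v) # ys) = 0" by (rule adj)
    then have "f (xs @ u # v # ys) + f (xs @ v # u # ys) = 0"
      unfolding l1 l2 by (simp add: adj add.commute)
    then show ?thesis by (simp add: eq_neg_iff_add_eq_0)
  qed
  have rep: "f (xs @ v # ys @ v # zs) = 0" for xs v ys zs
  proof (induction ys arbitrary: xs)
    case Nil
    show ?case by (simp add: adj)
  next
    case (Cons y ys)
    show ?case using Cons.IH[of "xs @ [y]"] swap[of xs v y] by simp
  qed
  from not_distinct_decomp[OF assms(3)] show ?thesis using rep by auto
qed

lemma even_alternating_form_wedge:
  assumes "even_alternating_form f" "even_alternating_form g"
  shows "even_alternating_form (wedge f g)"
proof -
  have lin: "linear (\<lambda>v. wedge f g (xs @ v # ys))" for xs ys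
    by (rule wedge_multilinear) (use assms in \<open>auto simp: even_alternating_form_def\<close>)
  have adj: "wedge f g (xs @ v # v # ys) = 0" for xs v ys
    by (rule wedge_adjacent) (use assms in \<open>auto simp: even_alternating_form_def\<close>)
  show ?thesis
    unfolding even_alternating_form_def
    using lin adjacent_imp_alternating[OF lin adj] wedge_parity[of f g] assms
    by (auto simp: even_alternating_form_def)
qed

definition const_form :: "complex \<Rightarrow> 'v list \<Rightarrow> complex" where
  "const_form c vs = (if vs = [] then c else 0)"

lemma wedge_const_form:
  fixes g :: "'v list \<Rightarrow> complex"
  shows "wedge (const_form c) g vs = c * g vs"
proof (induction vs arbitrary: g)
  case Nil
  show ?case by (simp add: const_form_def)
next
  case (Cons v vs)
  have "(\<lambda>xs. const_form c (v # xs)) = (\<lambda>_. 0)" "grade_sign (const_form c :: 'v list \<Rightarrow> complex) = const_form c"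
    by (auto simp: const_form_def grade_sign_def)
  then show ?case by (simp add: Cons.IH)
qed

typedef (overloaded) 'v::real_vector even_form = "{f :: 'v list \<Rightarrow> complex. even_alternating_form f}"
  by (rule exI[of _ "\<lambda>_. 0"]) (simp add: even_alternating_form_def linear_complex_iff)

setup_lifting type_definition_even_form

instantiation even_form :: (real_vector) comm_ring_1
begin

lift_definition zero_even_form :: "'a even_form" is "\<lambda>_. 0"
  by (simp add: even_alternating_form_def linear_complex_iff)

lift_definition one_even_form :: "'a even_form" is "const_form 1"
  by (auto simp: even_alternating_form_def linear_complex_iff const_form_def)

lift_definition plus_even_form :: "'a even_form \<Rightarrow> 'a even_form \<Rightarrow> 'a even_form"
  is "\<lambda>f g vs. f vs + g vs"
  by (auto simp: even_alternating_form_def linear_complex_iff algebra_simps)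

lift_definition uminus_even_form :: "'a even_form \<Rightarrow> 'a even_form" is "\<lambda>f vs. - f vs"
  by (auto simp: even_alternating_form_def linear_complex_iff)

lift_definition minus_even_form :: "'a even_form \<Rightarrow> 'a even_form \<Rightarrow> 'a even_form"
  is "\<lambda>f g vs. f vs - g vs"
  by (auto simp: even_alternating_form_def linear_complex_iff algebra_simps)

lift_definition times_even_form :: "'a even_form \<Rightarrow> 'a even_form \<Rightarrow> 'a even_form" is wedge
  by (rule even_alternating_form_wedge)

instance
proof
  fix a b c :: "'a even_form"
  show "a * b * c = a * (b * c)"
    by transfer (auto simp: wedge_assoc)
  show "a * b = b * a"
    by transfer (rule ext, rule wedge_commute_even, auto simp: even_alternating_form_def)
  show "1 * a = a"
    by transfer (auto simp: wedge_const_form)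
  show "(a + b) * c = a * c + b * c"
    by transfer (auto simp: wedge_add_left)
  show "a + b + c = a + (b + c)" by transfer (simp add: add.assoc)
  show "a + b = b + a" by transfer (simp add: add.commute)
  show "0 + a = a" by transfer simp
  show "- a + a = 0" by transfer simp
  show "a - b = a + - b" by transfer simp
  show "(0 :: 'a even_form) \<noteq> 1"
    by transfer (auto simp: const_form_def fun_eq_iff)
qed

end

lift_definition scale_form :: "complex \<Rightarrow> 'v::real_vector even_form \<Rightarrow> 'v even_form" (infixr "*\<^sub>C" 75)
  is "\<lambda>c f vs. c * f vs"
  by (auto simp: even_alternating_form_def linear_complex_iff algebra_simps)

definition alternating2 :: "('v::real_vector \<Rightarrow> 'v \<Rightarrow> complex) \<Rightarrow> bool" where
  "alternating2 B \<longleftrightarrow> bilinear B \<and> (\<forall>v. B v v = 0)"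

text \<open>The guard only serves totality: for smooth metrics, every \<open>B\<close> used below is bilinear and alternating.\<close>

lift_definition form2 :: "('v::real_vector \<Rightarrow> 'v \<Rightarrow> complex) \<Rightarrow> 'v even_form" is
  "\<lambda>B vs. if alternating2 B \<and> length vs = 2 then B (vs ! 0) (vs ! 1) else 0"
proof -
  fix B :: "'v \<Rightarrow> 'v \<Rightarrow> complex"
  show "even_alternating_form (\<lambda>vs. if alternating2 B \<and> length vs = 2 then B (vs ! 0) (vs ! 1) else 0)"
  proof (cases "alternating2 B")
    case True
    then have l: "linear (B u)" "linear (\<lambda>x. B x u)" and z: "B u u = 0" for u
      by (auto simp: alternating2_def bilinear_def)
    have "linear (\<lambda>v. if alternating2 B \<and> length (xs @ v # ys) = 2
              then B ((xs @ v # ys) ! 0) ((xs @ v # ys) ! 1) else 0)" for xs ys :: "'v list"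
    proof (cases xs)
      case Nil
      then show ?thesis using l True by (cases ys) (auto simp: linear_complex_iff)
    next
      case (Cons x xs')
      then show ?thesis using l True by (cases xs') (auto simp: linear_complex_iff)
    qed
    moreover have "B (vs ! 0) (vs ! 1) = 0" if "length vs = 2" "\<not> distinct vs" for vs
      using that z by (auto simp: numeral_2_eq_2 length_Suc_conv)
    ultimately show ?thesis
      by (auto simp: even_alternating_form_def)
  next
    case False
    then show ?thesis by (simp add: even_alternating_form_def linear_complex_iff)
  qed
qed

text \<open>\<open>form_le vol \<alpha> \<beta>\<close> is \<open>\<alpha> \<le> \<beta>\<close> for top-degree forms, with respect to the volume form \<open>vol\<close>.\<close>

definition form_le :: "'v::real_vector even_form \<Rightarrow> 'v even_form \<Rightarrow> 'v even_form \<Rightarrow> bool" where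
  "form_le vol \<alpha> \<beta> \<longleftrightarrow> (\<exists>f::real. 0 \<le> f \<and> \<beta> - \<alpha> = complex_of_real f *\<^sub>C vol)"


section \<open>Compact complex manifolds\<close>

definition holomorphic_fun_on :: "(complex^'n \<Rightarrow> complex) \<Rightarrow> (complex^'n) set \<Rightarrow> bool" where
  "holomorphic_fun_on f S \<longleftrightarrow>
     (\<forall>z\<in>S. \<exists>D. (f has_derivative D) (at z) \<and> (\<forall>c v. D (c *s v) = c * D v))"

fun Ck_on :: "nat \<Rightarrow> ('v::real_normed_vector \<Rightarrow> 'w::real_normed_vector) \<Rightarrow> 'v set \<Rightarrow> bool" where
  "Ck_on 0 f S \<longleftrightarrow> continuous_on S f"
| "Ck_on (Suc k) f S \<longleftrightarrow>
     (\<forall>x\<in>S. f differentiable (at x)) \<and> (\<forall>v. Ck_on k (\<lambda>x. frechet_derivative f (at x) v) S)"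

text \<open>Used on open sets only.\<close>

definition smooth_fun_on :: "('v::real_normed_vector \<Rightarrow> 'w::real_normed_vector) \<Rightarrow> 'v set \<Rightarrow> bool" where
  "smooth_fun_on f S \<longleftrightarrow> (\<forall>k. Ck_on k f S)"

text \<open>A chart consists of its domain and its coordinate map.\<close>

type_synonym ('m, 'n) chart = "'m set \<times> ('m \<Rightarrow> complex^'n)"

definition in_chart :: "('m, 'n::finite) chart \<Rightarrow> ('m \<Rightarrow> 'b) \<Rightarrow> complex^'n \<Rightarrow> 'b" where
  "in_chart c f z = f (the_inv_into (fst c) (snd c) z)"

text \<open>
  The complex dimension is \<open>CARD('n)\<close>. Second countability is not listed, since it follows from
  compactness.
\<close>

definition compact_complex_manifold :: "'m topology \<Rightarrow> ('m, 'n::finite) chart set \<Rightarrow> bool" where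
  "compact_complex_manifold X \<A> \<longleftrightarrow>
     Hausdorff_space X \<and> compact_space X \<and>
     topspace X = (\<Union>c\<in>\<A>. fst c) \<and>
     (\<forall>c\<in>\<A>. openin X (fst c) \<and> open (snd c ` fst c) \<and>
        homeomorphic_map (subtopology X (fst c)) (top_of_set (snd c ` fst c)) (snd c)) \<and>
     (\<forall>c\<in>\<A>. \<forall>d\<in>\<A>. \<forall>i.
        holomorphic_fun_on (in_chart c (\<lambda>p. snd d p $ i)) (snd c ` (fst c \<inter> fst d)))"

text \<open>
  \<open>\<omega> c p u v\<close> is the value at the point \<open>p\<close> of the \<open>(1,1)\<close>-form \<open>\<omega>\<close> on the two real tangent vectors
  whose components in the chart \<open>c\<close> are \<open>u\<close> and \<open>v\<close>. The conditions are, in this order: \<open>\<omega>\<close> is a real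
  2-form, of type \<open>(1,1)\<close>, positive, independent of the chart, smooth, and closed.
\<close>

definition kaehler_metric ::
  "('m, 'n::finite) chart set \<Rightarrow>
   (('m, 'n) chart \<Rightarrow> 'm \<Rightarrow> complex^'n \<Rightarrow> complex^'n \<Rightarrow> real) \<Rightarrow> bool" where
  "kaehler_metric \<A> \<omega> \<longleftrightarrow>
     (\<forall>c\<in>\<A>. \<forall>p\<in>fst c. bilinear (\<omega> c p) \<and> (\<forall>u. \<omega> c p u u = 0)) \<and>
     (\<forall>c\<in>\<A>. \<forall>p\<in>fst c. \<forall>u v. \<omega> c p (\<i> *s u) (\<i> *s v) = \<omega> c p u v) \<and>
     (\<forall>c\<in>\<A>. \<forall>p\<in>fst c. \<forall>u. u \<noteq> 0 \<longrightarrow> 0 < \<omega> c p u (\<i> *s u)) \<and>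
     (\<forall>c\<in>\<A>. \<forall>d\<in>\<A>. \<forall>p\<in>fst c \<inter> fst d. \<forall>u v.
        let J = frechet_derivative (in_chart c (snd d)) (at (snd c p))
        in \<omega> c p u v = \<omega> d p (J u) (J v)) \<and>
     (\<forall>c\<in>\<A>. \<forall>u v. smooth_fun_on (in_chart c (\<lambda>p. \<omega> c p u v)) (snd c ` fst c)) \<and>
     (\<forall>c\<in>\<A>. \<forall>z\<in>snd c ` fst c. \<forall>u v w.
        let dw = (\<lambda>a b. frechet_derivative (in_chart c (\<lambda>p. \<omega> c p a b)) (at z))
        in dw v w u + dw w u v + dw u v w = 0)"

definition kaehler_form ::
  "(('m, 'n::finite) chart \<Rightarrow> 'm \<Rightarrow> complex^'n \<Rightarrow> complex^'n \<Rightarrow> real) \<Rightarrow>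
   ('m, 'n) chart \<Rightarrow> 'm \<Rightarrow> (complex^'n) even_form" where
  "kaehler_form \<omega> c p = form2 (\<lambda>u v. complex_of_real (\<omega> c p u v))"


section \<open>Hermitian holomorphic vector bundles\<close>

text \<open>
  A trivialization over \<open>V\<close> is the pair of \<open>V\<close> and the fibre coordinates
  \<open>\<psi> : \<pi>\<^sup>-\<^sup>1(V) \<rightarrow> \<complex>\<^sup>r\<close>, so that \<open>(\<pi>, \<psi>)\<close> identifies \<open>\<pi>\<^sup>-\<^sup>1(V)\<close> with \<open>V \<times> \<complex>\<^sup>r\<close>.
  The trivializations induce the vector space structure of the fibres and the holomorphic structure
  of the total space; both are well defined because the transition functions are linear and
  holomorphic. The rank is \<open>CARD('r)\<close>.
\<close>

record ('e, 'm, 'r) vbundle =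
  total :: "'e topology"
  proj :: "'e \<Rightarrow> 'm"
  trivs :: "('m set \<times> ('e \<Rightarrow> complex^'r)) set"

definition part_over :: "('e, 'm, 'r::finite) vbundle \<Rightarrow> 'm set \<Rightarrow> 'e set" where
  "part_over E V = {e \<in> topspace (total E). proj E e \<in> V}"

definition holomorphic_vector_bundle ::
  "'m topology \<Rightarrow> ('m, 'n::finite) chart set \<Rightarrow> ('e, 'm, 'r::finite) vbundle \<Rightarrow> bool" where
  "holomorphic_vector_bundle X \<A> E \<longleftrightarrow>
     continuous_map (total E) X (proj E) \<and>
     topspace X = (\<Union>a\<in>trivs E. fst a) \<and>
     (\<forall>a\<in>trivs E. openin X (fst a) \<and>
        homeomorphic_map (subtopology (total E) (part_over E (fst a)))
          (prod_topology (subtopology X (fst a)) euclidean) (\<lambda>e. (proj E e, snd a e))) \<and>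
     (\<forall>a\<in>trivs E. \<forall>b\<in>trivs E. \<exists>g :: 'm \<Rightarrow> complex^'r^'r.
        (\<forall>e\<in>part_over E (fst a \<inter> fst b). snd b e = g (proj E e) *v snd a e) \<and>
        (\<forall>c\<in>\<A>. \<forall>i j. holomorphic_fun_on (in_chart c (\<lambda>p. g p $ i $ j))
                        (snd c ` (fst c \<inter> fst a \<inter> fst b))))"

definition frame_vector ::
  "('e, 'm, 'r::finite) vbundle \<Rightarrow> 'm set \<times> ('e \<Rightarrow> complex^'r) \<Rightarrow> 'r \<Rightarrow> 'm \<Rightarrow> 'e" where
  "frame_vector E a j p = (THE e. e \<in> topspace (total E) \<and> proj E e = p \<and> snd a e = axis j 1)"

definition gram_matrix ::
  "('e, 'm, 'r::finite) vbundle \<Rightarrow> ('e \<Rightarrow> 'e \<Rightarrow> complex) \<Rightarrow>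
   'm set \<times> ('e \<Rightarrow> complex^'r) \<Rightarrow> 'm \<Rightarrow> complex^'r^'r" where
  "gram_matrix E h a p = (\<chi> j k. h (frame_vector E a j p) (frame_vector E a k p))"

text \<open>
  \<open>h e e'\<close> is only relevant for \<open>e\<close>, \<open>e'\<close> in the same fibre. The first condition expresses that it is
  linear in \<open>e\<close> and conjugate-linear in \<open>e'\<close>.
\<close>

definition hermitian_metric ::
  "('m, 'n::finite) chart set \<Rightarrow> ('e, 'm, 'r::finite) vbundle \<Rightarrow> ('e \<Rightarrow> 'e \<Rightarrow> complex) \<Rightarrow> bool" where
  "hermitian_metric \<A> E h \<longleftrightarrow>
     (\<forall>a\<in>trivs E. \<forall>e\<in>part_over E (fst a). \<forall>e'\<in>part_over E (fst a). proj E e = proj E e' \<longrightarrow>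
        h e e' = (\<Sum>j\<in>UNIV. \<Sum>k\<in>UNIV.
                    gram_matrix E h a (proj E e) $ j $ k * snd a e $ j * cnj (snd a e' $ k))) \<and>
     (\<forall>e\<in>topspace (total E). \<forall>e'\<in>topspace (total E). proj E e = proj E e' \<longrightarrow>
        h e' e = cnj (h e e')) \<and>
     (\<forall>a\<in>trivs E. \<forall>e\<in>part_over E (fst a). snd a e \<noteq> 0 \<longrightarrow> 0 < Re (h e e)) \<and>
     (\<forall>a\<in>trivs E. \<forall>c\<in>\<A>. \<forall>j k.
        smooth_fun_on (in_chart c (\<lambda>p. gram_matrix E h a p $ j $ k)) (snd c ` (fst c \<inter> fst a)))"

text \<open>
  The Chern connection \<open>D = d + A\<close>, i.e. \<open>D e\<^sub>j = \<Sum>\<^sub>i A\<^sub>i\<^sub>j e\<^sub>i\<close>, in a holomorphic frame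
  \<open>(e\<^sub>j)\<close> with Gram matrix \<open>H\<^sub>j\<^sub>k = h(e\<^sub>j, e\<^sub>k)\<close> over an open subset of \<open>\<complex>\<^sup>n\<close>. It is the unique
  connection whose \<open>(0,1)\<close>-part is \<open>\<partial>\<close>-bar (that is, \<open>A\<close> has type \<open>(1,0)\<close>: the matrix \<open>A(v)\<close> is
  complex linear in \<open>v\<close>) and which is compatible with the metric,
  \<open>d h(e\<^sub>j, e\<^sub>k) = h(D e\<^sub>j, e\<^sub>k) + h(e\<^sub>j, D e\<^sub>k)\<close>.
\<close>

definition chern_connection ::
  "(complex^'n \<Rightarrow> complex^'r^'r) \<Rightarrow> complex^'n \<Rightarrow> complex^'n \<Rightarrow> complex^'r^'r" where
  "chern_connection H z = (THE A.
     (\<forall>u v. A (u + v) = A u + A v) \<and> (\<forall>c v. A (c *s v) = map_matrix ((*) c) (A v)) \<and>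
     (\<forall>v. frechet_derivative H (at z) v = transpose (A v) ** H z + H z ** map_matrix cnj (A v)))"

text \<open>\<open>D\<^sup>2 = dA + A \<and> A\<close>, a matrix of 2-forms.\<close>

definition connection_curvature ::
  "(complex^'n \<Rightarrow> complex^'n \<Rightarrow> complex^'r^'r) \<Rightarrow> complex^'n \<Rightarrow> (complex^'n) even_form^'r^'r" where
  "connection_curvature A z =
     (let dA = (\<lambda>u v. frechet_derivative (\<lambda>y. A y v) (at z) u - frechet_derivative (\<lambda>y. A y u) (at z) v);
          AA = (\<lambda>u v. A z u ** A z v - A z v ** A z u)
      in (\<chi> i j. form2 (\<lambda>u v. (dA u v + AA u v) $ i $ j)))"

text \<open>
  \<open>\<Theta>(E,h)\<close> at the point \<open>p\<close>, expressed in the chart \<open>c\<close> and in the frame of the trivialization \<open>a\<close>.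
\<close>

definition curvature ::
  "('e, 'm, 'r::finite) vbundle \<Rightarrow> ('e \<Rightarrow> 'e \<Rightarrow> complex) \<Rightarrow> ('m, 'n::finite) chart \<Rightarrow>
   'm set \<times> ('e \<Rightarrow> complex^'r) \<Rightarrow> 'm \<Rightarrow> (complex^'n) even_form^'r^'r" where
  "curvature E h c a p =
     connection_curvature (chern_connection (in_chart c (gram_matrix E h a))) (snd c p)"

text \<open>
  The coefficient of \<open>t\<^sup>k\<close> in \<open>det(Id + it/(2\<pi>) \<Theta>)\<close>; the determinant is taken over the polynomial
  ring in \<open>t\<close> over the commutative ring of even forms. The result does not depend on \<open>a\<close>.
\<close>

definition chern_form ::
  "('e, 'm, 'r::finite) vbundle \<Rightarrow> ('e \<Rightarrow> 'e \<Rightarrow> complex) \<Rightarrow> ('m, 'n::finite) chart \<Rightarrow>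
   'm set \<times> ('e \<Rightarrow> complex^'r) \<Rightarrow> nat \<Rightarrow> 'm \<Rightarrow> (complex^'n) even_form" where
  "chern_form E h c a k p =
     coeff (det (mat 1 + map_matrix (\<lambda>\<theta>. monom ((\<i> / (2 * pi)) *\<^sub>C \<theta>) 1) (curvature E h c a p))) k"

definition segre_form2 ::
  "('e, 'm, 'r::finite) vbundle \<Rightarrow> ('e \<Rightarrow> 'e \<Rightarrow> complex) \<Rightarrow> ('m, 'n::finite) chart \<Rightarrow>
   'm set \<times> ('e \<Rightarrow> complex^'r) \<Rightarrow> 'm \<Rightarrow> (complex^'n) even_form" where
  "segre_form2 E h c a p =
     chern_form E h c a 1 p * chern_form E h c a 1 p - chern_form E h c a 2 p"

text \<open>\<open>\<alpha> \<otimes> Id\<^sub>E\<close> is \<open>mat \<alpha>\<close>.\<close>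

definition hermite_einstein ::
  "('m, 'n::finite) chart set \<Rightarrow>
   (('m, 'n) chart \<Rightarrow> 'm \<Rightarrow> complex^'n \<Rightarrow> complex^'n \<Rightarrow> real) \<Rightarrow>
   ('e, 'm, 'r::finite) vbundle \<Rightarrow> ('e \<Rightarrow> 'e \<Rightarrow> complex) \<Rightarrow> real \<Rightarrow> bool" where
  "hermite_einstein \<A> \<omega> E h lam \<longleftrightarrow>
     (\<forall>c\<in>\<A>. \<forall>a\<in>trivs E. \<forall>p\<in>fst c \<inter> fst a.
        map_matrix (\<lambda>\<theta>. ((\<i> / (2 * pi)) *\<^sub>C \<theta>) *
                         ((1 / fact (CARD('n) - 1)) *\<^sub>C kaehler_form \<omega> c p ^ (CARD('n) - 1)))
                   (curvature E h c a p)
        = mat (complex_of_real lam *\<^sub>C (1 / fact CARD('n)) *\<^sub>C kaehler_form \<omega> c p ^ CARD('n)))"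

end

theory Submission
  imports Defs
begin

text \<open>
  Everything happens at one point \<open>p\<close>. Put \<open>F = i/(2\<pi>) \<Theta>\<close> and \<open>G = F - \<lambda>/n \<omega> Id\<close>. Since
  \<open>2 c\<^sub>2 = (tr F)\<^sup>2 - tr F\<^sup>2\<close>, one has \<open>2 s\<^sub>2 = (tr F)\<^sup>2 + tr F\<^sup>2\<close>, and the Hermite-Einstein equation
  says that the entries of \<open>G\<close> are primitive, \<open>G\<^sub>i\<^sub>j \<omega>\<^sup>n\<^sup>-\<^sup>1 = 0\<close>. Expanding \<open>F = G + \<lambda>/n \<omega> Id\<close>, the
  difference of the two sides of the inequality becomes
  \<open>- 1/2 ((tr G)\<^sup>2 + \<Sum>\<^sub>i\<^sub>j G\<^sub>i\<^sub>j G\<^sub>j\<^sub>i) \<omega>\<^sup>n\<^sup>-\<^sup>2\<close>. In an \<open>\<omega>\<close>-orthonormal coframe the coefficient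
  matrices of primitive (1,1)-forms \<open>\<alpha>\<close>, \<open>\<beta>\<close> have trace 0 and
  \<open>\<alpha> \<beta> \<omega>\<^sup>n\<^sup>-\<^sup>2 = - (n-2)! tr(a b) vol\<close>, while compatibility of the Chern connection with \<open>h\<close> makes
  \<open>G\<close> self-adjoint. So the difference is a sum of squares, which vanishes only for \<open>G = 0\<close>.
\<close>

section \<open>Hermitian forms and matrices\<close>

text \<open>The constant (r+1)/(2n) is forced by the scalar part c Id of F, c = \<lambda>/n
  \<omega>: it contributes (r^2 + r) c^2 to 2 s_2 and r c to c_1, so that the two sides agree on it.
  Terms linear in G contain a factor c, hence one more \<omega>, and die by primitivity. Two
  obstacles shape the proof. The formula dA + A \<and> A does not show that the curvature has type
  (1,1), without which no sign is available. The (0,2)-part vanishes because A is complex linear;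
  skew-adjointness, which comes from the symmetry of the second derivatives of the Gram matrix,
  carries this over to the (2,0)-part. Moreover the frame has to stay holomorphic, so
  self-adjointness is twisted by the Gram matrix H; a unitary frame is introduced only inside traces
  at one point, where conjugation does no harm. The identities for c_2 and s_2 are kept in doubled
  form, valid over any commutative ring; the halving happens at the end, by a complex
  scalar.\<close>

lemma imaginary_scale_twice: "\<i> *s (\<i> *s u) = - u" for u :: "complex^'n"
  by (simp add: vec_eq_iff flip: mult.assoc)

lemma complex_scale_split: "c *s u = Re c *\<^sub>R u + Im c *\<^sub>R (\<i> *s u)" for u :: "complex^'n"
  by (simp add: vec_eq_iff complex_eq_iff)

text \<open>Serves both inner products of the proof: the metric of \<omega> on the tangent space and
  \<open>h\<close> on a fibre.\<close>

locale hermitian_form =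
  fixes S :: "complex^'n \<Rightarrow> complex^'n \<Rightarrow> complex"
  assumes add_left: "S (x + y) z = S x z + S y z"
    and scale_left: "S (c *s x) z = c * S x z"
    and conj_sym: "S y x = cnj (S x y)"
    and pos: "x \<noteq> 0 \<Longrightarrow> 0 < Re (S x x)"
begin

lemma scale_right: "S x (c *s y) = cnj c * S x y"
  by (metis conj_sym scale_left complex_cnj_mult)

lemma zero_left: "S 0 z = 0"
  using scale_left[of 0 0 z] by simp

lemma sum_left: "S (\<Sum>i\<in>A. f i) z = (\<Sum>i\<in>A. S (f i) z)"
  by (induction A rule: infinite_finite_induct) (auto simp: zero_left add_left)

lemma expand_axis: "S x z = (\<Sum>k\<in>UNIV. S (axis k 1) z * x $ k)"
  by (subst basis_expansion[of x, symmetric]) (simp add: sum_left scale_left mult.commute)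

text \<open>A determinant replaces the count of dimensions: orthogonality to the \<open>e k\<close>
  is a square linear system whose row \<open>j\<close> is zero, so it has a nonzero solution, which
  is then normalized.\<close>

lemma orthonormal_extend:
  fixes e :: "'n \<Rightarrow> complex^'n" and T :: "'n set"
  assumes "j \<notin> T"
  obtains x where "S x x = 1" "\<And>k. k \<in> T \<Longrightarrow> S x (e k) = 0"
proof -
  define M :: "complex^'n^'n" where "M = (\<chi> i k. if i \<in> T then S (axis k 1) (e i) else 0)"
  have "row j M = 0"
    using assms by (simp add: M_def row_def vec_eq_iff)
  then have "det M = 0" by (rule det_zero_row)
  then have "\<not> invertible M" by (simp add: invertible_det_nz)
  then obtain x where x: "M *v x = 0" "x \<noteq> 0"
    using matrix_left_invertible_ker[of M] invertible_left_inverse[of M] by auto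
  have xe: "S x (e k) = 0" if "k \<in> T" for k
    using x(1) that by (auto simp: vec_eq_iff matrix_vector_mult_def M_def expand_axis[of x]
        dest!: spec[of _ k])
  have im: "S x x = of_real (Re (S x x))"
    using conj_sym[of x x] by (auto simp: complex_eq_iff)
  define r where "r = sqrt (Re (S x x))"
  have r: "r > 0" "r * r = Re (S x x)"
    using pos[OF x(2)] by (auto simp: r_def)
  define y where "y = complex_of_real (1 / r) *s x"
  have "S y y = complex_of_real (1 / r) * complex_of_real (1 / r) * of_real (Re (S x x))"
    by (simp add: y_def scale_left scale_right flip: im)
  also have "\<dots> = 1"
    using r(1) unfolding r(2)[symmetric] by (simp flip: of_real_mult)
  finally have "S y y = 1" .
  moreover have "S y (e k) = 0" if "k \<in> T" for k
    using xe[OF that] by (simp add: y_def scale_left)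
  ultimately show ?thesis by (rule that)
qed

lemma orthonormal_family_exists:
  fixes T :: "'n set"
  shows "finite T \<Longrightarrow> \<exists>e. \<forall>j\<in>T. \<forall>k\<in>T. S (e j) (e k) = (if j = k then 1 else 0)"
proof (induction T rule: finite_induct)
  case (insert j T)
  then obtain e where e: "\<forall>j\<in>T. \<forall>k\<in>T. S (e j) (e k) = (if j = k then 1 else 0)" by auto
  obtain x where x: "S x x = 1" "\<And>k. k \<in> T \<Longrightarrow> S x (e k) = 0"
    using orthonormal_extend[OF insert(2)] by metis
  have x': "S (e k) x = 0" if "k \<in> T" for k
    using x(2)[OF that] conj_sym[of "e k" x] by simp
  show ?case
    by (rule exI[of _ "e(j := x)"]) (use e x x' insert(2) in auto)
qed auto

lemma orthonormal_basis_exists: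
  obtains e :: "'n \<Rightarrow> complex^'n" where "\<And>j k. S (e j) (e k) = (if j = k then 1 else 0)"
    "\<And>u. u = (\<Sum>j\<in>UNIV. S u (e j) *s e j)"
proof -
  obtain e :: "'n \<Rightarrow> complex^'n" where e: "S (e j) (e k) = (if j = k then 1 else 0)" for j k
    using orthonormal_family_exists[of UNIV] by auto
  define M :: "complex^'n^'n" where "M = (\<chi> i k. S (axis k 1) (e i))"
  define P :: "complex^'n^'n" where "P = (\<chi> k j. e j $ k)"
  have M: "M *v u = (\<chi> i. S u (e i))" for u
    by (simp add: M_def matrix_vector_mult_def vec_eq_iff expand_axis[of u])
  have P: "P *v x = (\<Sum>j\<in>UNIV. x $ j *s e j)" for x
    by (simp add: P_def matrix_vector_mult_def vec_eq_iff mult.commute)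
  have "M ** P = mat 1"
    by (simp add: matrix_matrix_mult_def vec_eq_iff M_def P_def mat_def flip: expand_axis)
       (simp add: e eq_commute)
  \<comment> \<open>A one-sided inverse of a square matrix is two-sided; this turns orthonormality
    into the expansion of every vector.\<close>
  then have "P ** M = mat 1"
    using matrix_left_right_inverse by blast
  then have "u = P *v (M *v u)" for u
    by (simp add: matrix_vector_mul_assoc)
  then have "u = (\<Sum>j\<in>UNIV. S u (e j) *s e j)" for u
    by (simp add: M P)
  with e show ?thesis by (rule that)
qed

end

definition sesquilinear_of :: "complex^'n^'n \<Rightarrow> complex^'n \<Rightarrow> complex^'n \<Rightarrow> complex" where
  "sesquilinear_of H x y = (\<Sum>j\<in>UNIV. \<Sum>k\<in>UNIV. H $ j $ k * x $ j * cnj (y $ k))"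

definition positive_hermitian :: "complex^'n^'n \<Rightarrow> bool" where
  "positive_hermitian H \<longleftrightarrow>
     transpose H = map_matrix cnj H \<and> (\<forall>x. x \<noteq> 0 \<longrightarrow> 0 < Re (sesquilinear_of H x x))"

lemma hermitian_form_sesquilinear_of:
  fixes H :: "complex^'n^'n"
  assumes "positive_hermitian H"
  shows "hermitian_form (sesquilinear_of H)"
proof
  have H: "H $ k $ j = cnj (H $ j $ k)" for j k
  proof -
    have "transpose H $ j $ k = map_matrix cnj H $ j $ k"
      using assms by (simp only: positive_hermitian_def)
    then show ?thesis by (simp only: transpose_def vec_lambda_beta nth_map_matrix)
  qed
  fix x y z :: "complex^'n" and c :: complex
  show "sesquilinear_of H (x + y) z = sesquilinear_of H x z + sesquilinear_of H y z"
    by (simp add: sesquilinear_of_def algebra_simps sum.distrib)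
  show "sesquilinear_of H (c *s x) z = c * sesquilinear_of H x z"
    by (simp add: sesquilinear_of_def algebra_simps sum_distrib_left)
  show "sesquilinear_of H y x = cnj (sesquilinear_of H x y)"
  proof -
    have "cnj (sesquilinear_of H x y) = (\<Sum>j\<in>UNIV. \<Sum>k\<in>UNIV. cnj (H $ j $ k) * (cnj (x $ j) * y $ k))"
      by (simp add: sesquilinear_of_def mult.assoc)
    also have "\<dots> = (\<Sum>j\<in>UNIV. \<Sum>k\<in>UNIV. H $ k $ j * (cnj (x $ j) * y $ k))"
      by (simp only: H[symmetric])
    also have "\<dots> = sesquilinear_of H y x"
      by (subst sum.swap) (simp add: sesquilinear_of_def mult_ac)
    finally show ?thesis ..
  qed
  show "0 < Re (sesquilinear_of H x x)" if "x \<noteq> 0"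
    using assms that by (simp add: positive_hermitian_def)
qed

lemma map_matrix_cnj_mult: "map_matrix cnj (A ** B) = map_matrix cnj A ** map_matrix cnj B"
  by (simp add: vec_eq_iff matrix_matrix_mult_def)

text \<open>The columns of \<open>P\<close> are an orthonormal basis for the form with matrix
  \<open>H\<close>.\<close>

lemma positive_hermitian_unitary_frame:
  fixes H :: "complex^'n^'n"
  assumes "positive_hermitian H"
  obtains P :: "complex^'n^'n" where "transpose P ** H ** map_matrix cnj P = mat 1"
proof -
  interpret hermitian_form "sesquilinear_of H"
    by (rule hermitian_form_sesquilinear_of[OF assms])
  obtain e :: "'n \<Rightarrow> complex^'n" where e: "\<And>j k. sesquilinear_of H (e j) (e k) = (if j = k then 1 else 0)"
    by (rule orthonormal_basis_exists) (rule that)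
  define P :: "complex^'n^'n" where "P = (\<chi> k j. e j $ k)"
  have "(transpose P ** H ** map_matrix cnj P) $ i $ j = sesquilinear_of H (e i) (e j)" for i j
    unfolding sesquilinear_of_def
    by (subst sum.swap)
       (simp add: matrix_matrix_mult_def transpose_def P_def sum_distrib_left mult_ac)
  then have "transpose P ** H ** map_matrix cnj P = mat 1"
    by (simp add: vec_eq_iff e mat_def)
  then show ?thesis by (rule that)
qed

lemma positive_hermitian_invertible:
  fixes H :: "complex^'n^'n"
  assumes "positive_hermitian H"
  shows "invertible H"
proof -
  obtain P :: "complex^'n^'n" where "transpose P ** H ** map_matrix cnj P = mat 1"
    using positive_hermitian_unitary_frame[OF assms] .
  then have "det (transpose P ** H ** map_matrix cnj P) = 1"
    by simp
  then show ?thesis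
    by (auto simp: det_mul invertible_det_nz)
qed

text \<open>The hypothesis says that \<open>N\<close> is the adjoint of \<open>M\<close> for
  \<open>H\<close>. In a unitary frame it becomes the conjugate transpose of \<open>M'\<close>, and
  the trace, unchanged by conjugation, is the squared Frobenius norm of \<open>M'\<close>.\<close>

lemma trace_mult_adjoint:
  fixes H M N :: "complex^'n^'n"
  assumes H: "positive_hermitian H" and MN: "transpose M ** H = H ** map_matrix cnj N"
  obtains x :: real where "0 \<le> x" "trace (M ** N) = of_real x" "x = 0 \<Longrightarrow> M = 0"
proof -
  obtain P :: "complex^'n^'n" where P: "transpose P ** H ** map_matrix cnj P = mat 1"
    using positive_hermitian_unitary_frame[OF H] .
  then have "det (transpose P ** H ** map_matrix cnj P) = 1" by simp
  then have "invertible P" by (auto simp: det_mul invertible_det_nz)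
  then obtain Q where Q: "P ** Q = mat 1" "Q ** P = mat 1"
    by (auto simp: invertible_def)
  have tQ: "transpose P ** transpose Q = mat 1" "transpose Q ** transpose P = mat 1"
    using Q by (simp_all flip: matrix_transpose_mul)
  define M' where "M' = Q ** M ** P"
  define N' where "N' = Q ** N ** P"
  have PM: "P ** M' = M ** P" and PN: "P ** N' = N ** P"
    by (simp_all add: M'_def N'_def matrix_mul_assoc Q)
  have "transpose M' = transpose M' ** (transpose P ** H ** map_matrix cnj P)"
    by (simp add: P)
  also have "\<dots> = transpose (P ** M') ** H ** map_matrix cnj P"
    by (simp add: matrix_transpose_mul matrix_mul_assoc)
  also have "\<dots> = transpose P ** (transpose M ** H) ** map_matrix cnj P"
    by (simp add: PM matrix_transpose_mul matrix_mul_assoc)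
  also have "\<dots> = transpose P ** H ** map_matrix cnj (N ** P)"
    by (simp add: MN map_matrix_cnj_mult matrix_mul_assoc)
  also have "\<dots> = (transpose P ** H ** map_matrix cnj P) ** map_matrix cnj N'"
    by (simp add: map_matrix_cnj_mult matrix_mul_assoc flip: PN)
  finally have adj: "transpose M' = map_matrix cnj N'"
    by (simp add: P)
  have N': "N' $ j $ i = cnj (M' $ i $ j)" for i j
    using adj by (simp add: vec_eq_iff transpose_def)
  have M_eq: "M = P ** M' ** Q"
    unfolding PM by (simp add: Q flip: matrix_mul_assoc)
  have N_eq: "N = P ** N' ** Q"
    unfolding PN by (simp add: Q flip: matrix_mul_assoc)
  have "trace (M ** N) = trace (P ** (M' ** N' ** Q))"
    unfolding M_eq N_eq by (metis Q(2) matrix_mul_assoc matrix_mul_rid)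
  also have "\<dots> = trace (M' ** N')"
    by (subst trace_mul_sym) (simp add: Q flip: matrix_mul_assoc)
  also have "\<dots> = of_real (\<Sum>i\<in>UNIV. \<Sum>j\<in>UNIV. (cmod (M' $ i $ j))\<^sup>2)"
    by (simp add: trace_def matrix_matrix_mult_def N' flip: complex_norm_square)
  finally have tr: "trace (M ** N) = of_real (\<Sum>i\<in>UNIV. \<Sum>j\<in>UNIV. (cmod (M' $ i $ j))\<^sup>2)" .
  have "M = 0" if "(\<Sum>i\<in>UNIV. \<Sum>j\<in>UNIV. (cmod (M' $ i $ j))\<^sup>2) = 0"
  proof -
    from that have "M' = 0"
      by (simp add: sum_nonneg_eq_0_iff sum_nonneg vec_eq_iff)
    then show ?thesis by (simp add: M_eq)
  qed
  with tr show ?thesis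
    by (intro that[of "\<Sum>i\<in>UNIV. \<Sum>j\<in>UNIV. (cmod (M' $ i $ j))\<^sup>2"]) (auto intro!: sum_nonneg)
qed

text \<open>Multiplication by the inverse of \<open>H\<close> shows that the conjugate of
  \<open>N\<close> is similar to the transpose of \<open>M\<close>.\<close>

lemma trace_adjoint:
  fixes H M N :: "complex^'n^'n"
  assumes H: "positive_hermitian H" and MN: "transpose M ** H = H ** map_matrix cnj N"
  shows "trace N = cnj (trace M)"
proof -
  obtain K where K: "H ** K = mat 1" "K ** H = mat 1"
    using positive_hermitian_invertible[OF H] by (auto simp: invertible_def)
  have "map_matrix cnj N = K ** (transpose M ** H)"
    by (simp add: MN matrix_mul_assoc K)
  then have "trace (map_matrix cnj N) = trace (transpose M)"
    by (metis K(1) matrix_mul_assoc matrix_mul_rid trace_mul_sym)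
  moreover have "trace (map_matrix cnj N) = cnj (trace N)" "trace (transpose M) = trace M"
    by (simp_all add: trace_def transpose_def)
  ultimately show ?thesis by (metis complex_cnj_cnj)
qed

section \<open>Matrix identities and entries of the inverse\<close>

lemma matrix_add_rdistrib: "(A + B) ** C = A ** C + B ** C"
  by (simp add: matrix_matrix_mult_def vec_eq_iff distrib_right sum.distrib)

lemma matrix_diff_ldistrib: "A ** (B - C) = A ** B - A ** C" for A :: "'a::ring_1^'n^'m"
  by (simp add: matrix_matrix_mult_def vec_eq_iff right_diff_distrib sum_subtractf)

lemma matrix_diff_rdistrib: "(A - B) ** C = A ** C - B ** C" for A :: "'a::ring_1^'n^'m"
  by (simp add: matrix_matrix_mult_def vec_eq_iff left_diff_distrib sum_subtractf)

lemma mat_matrix_mult: "mat c ** A = map_matrix ((*) c) A" "A ** mat c = map_matrix ((*) c) A"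
  for A :: "'a::comm_ring_1^'n^'n"
  by (simp_all add: matrix_matrix_mult_def mat_def vec_eq_iff if_distrib[of "\<lambda>x. x * _"]
      if_distrib[of "\<lambda>x. _ * x"] mult.commute cong: if_cong)

lemma trace_mat: "trace (mat c :: 'a::comm_ring_1^'n^'n) = of_nat CARD('n) * c"
  by (simp add: trace_def mat_def)

lemma trace_square_add_mat:
  fixes G :: "'a::comm_ring_1^'n^'n"
  shows "trace ((G + mat c) ** (G + mat c)) =
    trace (G ** G) + 2 * (c * trace G) + of_nat CARD('n) * (c * c)"
proof -
  have "trace (map_matrix ((*) c) A) = c * trace A" for A :: "'a^'n^'n"
    by (simp add: trace_def sum_distrib_left)
  then show ?thesis
    by (simp add: matrix_add_ldistrib matrix_add_rdistrib trace_add mat_matrix_mult trace_mat algebra_simps)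
qed

lemma transpose_diff: "transpose (A - B) = transpose A - transpose B"
  by (simp add: transpose_def vec_eq_iff)

lemma transpose_add: "transpose (A + B) = transpose A + transpose B"
  by (simp add: transpose_def vec_eq_iff)

lemma map_matrix_cnj_diff: "map_matrix cnj (A - B) = map_matrix cnj A - map_matrix cnj B"
  by (simp add: vec_eq_iff)

lemma map_matrix_cnj_add: "map_matrix cnj (A + B) = map_matrix cnj A + map_matrix cnj B"
  by (simp add: vec_eq_iff)

lemma invertible_matrix_inv: "invertible A \<Longrightarrow> A ** matrix_inv A = mat 1 \<and> matrix_inv A ** A = mat 1"
  unfolding matrix_inv_def invertible_def by (rule someI_ex)

text \<open>Cramer's rule, in the form that makes the entries of an inverse rational in the entries
  of \<open>A\<close> and hence differentiable.\<close>

lemma matrix_inv_entry: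
  fixes A :: "'a::field^'n^'n"
  assumes "invertible A"
  shows "matrix_inv A $ k $ l = det (\<chi> i j. if j = k then (if i = l then 1 else 0) else A $ i $ j) / det A"
proof -
  have "A *v (matrix_inv A *v axis l 1) = axis l 1"
    using invertible_matrix_inv[OF assms] by (simp add: matrix_vector_mul_assoc)
  moreover have "det A \<noteq> 0" using assms by (simp add: invertible_det_nz)
  ultimately have "matrix_inv A *v axis l 1 = (\<chi> k. det (\<chi> i j. if j = k then axis l 1 $ i else A $ i $ j) / det A)"
    by (simp add: cramer)
  then have "(matrix_inv A *v axis l 1) $ k = det (\<chi> i j. if j = k then axis l 1 $ i else A $ i $ j) / det A"
    by (simp only: vec_lambda_beta)
  moreover have "(matrix_inv A *v axis l 1) $ k = matrix_inv A $ k $ l"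
    by (simp add: matrix_vector_mult_def axis_def if_distrib[of "\<lambda>x. _ * x"] cong: if_cong)
  moreover have "axis l 1 $ i = (if i = l then 1 else (0 :: 'a))" for i :: 'n
    by (simp add: axis_def)
  ultimately show ?thesis
    by (simp only:)
qed

section \<open>The algebra of even forms\<close>

interpretation scale_form: vector_space "scale_form :: complex \<Rightarrow> 'v::real_vector even_form \<Rightarrow> 'v even_form"
  by unfold_locales (transfer; simp add: algebra_simps)+

lemma scale_form_mult_left [simp]: "(c *\<^sub>C x) * y = c *\<^sub>C (x * y)"
  by transfer (auto simp: wedge_scale_left)

lemma scale_form_mult_right [simp]: "x * (c *\<^sub>C y) = c *\<^sub>C (x * y)"
  by transfer (auto simp: wedge_scale_right)

lemma of_nat_mult_form: "of_nat m * x = of_nat m *\<^sub>C (x :: 'v::real_vector even_form)"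
  by (induction m) (simp_all add: algebra_simps scale_form.scale_left_distrib)

lemma alternating2_add:
  "alternating2 B \<Longrightarrow> alternating2 C \<Longrightarrow> alternating2 (\<lambda>u v. B u v + C u v)"
  by (auto simp: alternating2_def bilinear_def linear_complex_iff algebra_simps)

lemma alternating2_scale: "alternating2 B \<Longrightarrow> alternating2 (\<lambda>u v. c * B u v)"
  by (auto simp: alternating2_def bilinear_def linear_complex_iff algebra_simps)

lemma alternating2_zero: "alternating2 (\<lambda>u v. 0)"
  by (auto simp: alternating2_def bilinear_def linear_complex_iff)

lemma alternating2_sum:
  "(\<And>i. i \<in> I \<Longrightarrow> alternating2 (B i)) \<Longrightarrow> alternating2 (\<lambda>u v. \<Sum>i\<in>I. B i u v)"
  by (induction I rule: infinite_finite_induct) (simp_all add: alternating2_zero alternating2_add)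

lemma alternating2_anticommute: "alternating2 B \<Longrightarrow> B v u = - B u v"
proof -
  assume B: "alternating2 B"
  then have add: "B (x + y) z = B x z + B y z" "B x (y + z) = B x y + B x z" and self: "B x x = 0" for x y z
    by (auto simp: alternating2_def bilinear_def linear_complex_iff)
  have "B (u + v) (u + v) = B u u + B u v + (B v u + B v v)"
    unfolding add by simp
  then show "B v u = - B u v"
    by (simp add: self add_eq_0_iff)
qed

lemma alternating2_minus_right: "alternating2 B \<Longrightarrow> B u (- v) = - B u v"
  by (auto simp: alternating2_def bilinear_def linear_neg)

lemma form2_add:
  "alternating2 B \<Longrightarrow> alternating2 C \<Longrightarrow> form2 (\<lambda>u v. B u v + C u v) = form2 B + form2 C"
  using alternating2_add[of B C] by transfer auto

lemma form2_scale: "alternating2 B \<Longrightarrow> form2 (\<lambda>u v. c * B u v) = c *\<^sub>C form2 B"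
  using alternating2_scale[of B c] by transfer auto

lemma form2_zero: "form2 (\<lambda>u v. 0) = 0"
  by transfer auto

lemma form2_sum:
  "(\<And>i. i \<in> I \<Longrightarrow> alternating2 (B i)) \<Longrightarrow> form2 (\<lambda>u v. \<Sum>i\<in>I. B i u v) = (\<Sum>i\<in>I. form2 (B i))"
  by (induction I rule: infinite_finite_induct)
     (simp_all add: form2_zero form2_add alternating2_sum)

section \<open>Products of one-forms\<close>

definition one_form :: "('v \<Rightarrow> complex) \<Rightarrow> 'v list \<Rightarrow> complex" where
  "one_form a vs = (if length vs = 1 then a (vs ! 0) else 0)"

lemma one_form_Cons: "(\<lambda>xs. one_form a (v # xs)) = const_form (a v)"
  by (auto simp: one_form_def const_form_def)

lemma grade_sign_one_form: "grade_sign (one_form a) = (\<lambda>xs. - one_form a xs)"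
  by (auto simp: one_form_def grade_sign_def)

lemma wedge_const_form_right: "wedge f (const_form c) vs = c * f vs"
proof (induction vs arbitrary: f)
  case (Cons v vs)
  have "(\<lambda>xs. const_form c (v # xs)) = (\<lambda>_. 0)" by (auto simp: const_form_def)
  then show ?case by (simp add: Cons.IH)
qed (simp add: const_form_def)

lemma wedge_one_form_one_form:
  "wedge (one_form a) (one_form b) vs =
     (if length vs = 2 then a (vs ! 0) * b (vs ! 1) - a (vs ! 1) * b (vs ! 0) else 0)"
proof (cases vs)
  case (Cons v ws)
  show ?thesis
    by (simp add: Cons one_form_Cons grade_sign_one_form wedge_minus_left wedge_const_form
        wedge_const_form_right) (auto simp: one_form_def)
qed (simp add: one_form_def)

text \<open>Passing from b, c, d to d, c, b takes three exchanges of neighbours, each of which costs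
  a sign.\<close>

lemma wedge_one_form_reorder:
  "wedge (wedge (one_form a) (one_form b)) (wedge (one_form c) (one_form d)) vs =
   - wedge (wedge (one_form a) (one_form d)) (wedge (one_form c) (one_form b)) vs"
proof -
  have assoc: "wedge (wedge f g) k = wedge f (wedge g k)" for f g k :: "'a list \<Rightarrow> complex"
    by (rule ext) (rule wedge_assoc)
  have minus: "wedge (\<lambda>xs. - f xs) g = (\<lambda>xs. - wedge f g xs)"
    "wedge f (\<lambda>xs. - g xs) = (\<lambda>xs. - wedge f g xs)" for f g :: "'a list \<Rightarrow> complex"
    by (simp_all add: fun_eq_iff wedge_minus_left wedge_minus_right)
  have anti: "wedge (one_form a) (one_form b) = (\<lambda>xs. - wedge (one_form b) (one_form a) xs)"
    for a b :: "'a \<Rightarrow> complex"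
    by (auto simp: fun_eq_iff wedge_one_form_one_form mult_ac)
  have "wedge (one_form b) (wedge (one_form c) (one_form d)) =
      (\<lambda>xs. - wedge (wedge (one_form b) (one_form d)) (one_form c) xs)"
    by (subst anti) (simp add: minus assoc)
  also have "\<dots> = wedge (one_form d) (wedge (one_form b) (one_form c))"
    by (subst anti) (simp add: minus assoc)
  also have "\<dots> = (\<lambda>xs. - wedge (one_form d) (wedge (one_form c) (one_form b)) xs)"
    by (subst anti[of b c]) (simp add: minus)
  finally show ?thesis
    by (simp add: assoc minus)
qed

text \<open>One-forms have odd degree and lie outside the commutative ring \<open>even_form\<close>;
  they enter it only in pairs.\<close>

definition wedge2 :: "('v::real_vector \<Rightarrow> complex) \<Rightarrow> ('v \<Rightarrow> complex) \<Rightarrow> 'v even_form" where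
  "wedge2 a b = form2 (\<lambda>u v. a u * b v - a v * b u)"

lemma alternating2_wedge2:
  "linear a \<Longrightarrow> linear b \<Longrightarrow> alternating2 (\<lambda>u v. a u * b v - a v * b u)"
  by (auto simp: alternating2_def bilinear_def linear_complex_iff algebra_simps)

lemma Rep_wedge2:
  "linear a \<Longrightarrow> linear b \<Longrightarrow> Rep_even_form (wedge2 a b) = wedge (one_form a) (one_form b)"
  by (simp add: wedge2_def form2.rep_eq alternating2_wedge2 fun_eq_iff wedge_one_form_one_form mult_ac)

lemma wedge2_reorder:
  "linear a \<Longrightarrow> linear b \<Longrightarrow> linear c \<Longrightarrow> linear d \<Longrightarrow>
     wedge2 a b * wedge2 c d = - (wedge2 a d * wedge2 c b)"
  unfolding Rep_even_form_inject[symmetric] times_even_form.rep_eq uminus_even_form.rep_eq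
  by (simp only: Rep_wedge2) (rule ext, rule wedge_one_form_reorder)

section \<open>Powers of the Kaehler form\<close>

lemma square_zero_binomial:
  fixes x s :: "'a::comm_ring_1"
  assumes "x * x = 0"
  shows "(x + s) ^ Suc m = s ^ Suc m + of_nat (Suc m) * (x * s ^ m)"
proof (induction m)
  case (Suc m)
  have "(x + s) ^ Suc (Suc m) = (x + s) * (s ^ Suc m + of_nat (Suc m) * (x * s ^ m))"
    by (simp only: power_Suc[of _ "Suc m"] Suc.IH)
  also have "\<dots> = x * s ^ Suc m + s * s ^ Suc m + of_nat (Suc m) * ((x * x) * s ^ m)
      + of_nat (Suc m) * (x * (s * s ^ m))"
    by (simp only: distrib_left distrib_right mult_ac add_ac)
  finally show ?case
    by (simp add: assms algebra_simps)
qed simp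

text \<open>Only squarefree monomials survive in a power of the sum. With \<open>card T\<close>
  factors there is one such monomial, reached in \<open>fact (card T)\<close> orders; with one
  factor more there is none.\<close>

lemma square_zero_sum_power:
  fixes w :: "'i \<Rightarrow> 'a::comm_ring_1"
  assumes "finite T" "\<And>j. w j * w j = 0"
  shows "sum w T ^ card T = of_nat (fact (card T)) * prod w T" "sum w T ^ Suc (card T) = 0"
proof -
  \<comment> \<open>The two claims share one induction, since the step of the first uses the second
    for \<open>T\<close>.\<close>
  have "sum w T ^ card T = of_nat (fact (card T)) * prod w T \<and> sum w T ^ Suc (card T) = 0"
    using assms(1)
  proof (induction T rule: finite_induct)
    case (insert x T)
    then have IH: "sum w T ^ card T = of_nat (fact (card T)) * prod w T" "sum w T ^ Suc (card T) = 0"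
      and s: "sum w (insert x T) = w x + sum w T"
      by auto
    have "sum w (insert x T) ^ Suc (card T) =
        sum w T ^ Suc (card T) + of_nat (Suc (card T)) * (w x * sum w T ^ card T)"
      unfolding s by (rule square_zero_binomial[OF assms(2)])
    also have "\<dots> = of_nat (Suc (card T)) * (w x * (of_nat (fact (card T)) * prod w T))"
      by (simp only: IH add_0_left)
    also have "\<dots> = of_nat (fact (Suc (card T))) * (w x * prod w T)"
      by (simp only: fact_Suc of_nat_mult of_nat_id mult_ac)
    finally have 1: "sum w (insert x T) ^ Suc (card T) = of_nat (fact (Suc (card T))) * (w x * prod w T)" .
    have "sum w (insert x T) ^ Suc (Suc (card T)) =
        sum w T ^ Suc (Suc (card T)) + of_nat (Suc (Suc (card T))) * (w x * sum w T ^ Suc (card T))"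
      unfolding s by (rule square_zero_binomial[OF assms(2)])
    also have "\<dots> = 0"
      by (simp only: IH power_Suc[of _ "Suc _"] mult_zero_right add_0_left)
    finally have 2: "sum w (insert x T) ^ Suc (Suc (card T)) = 0" .
    from 1 2 insert.hyps show ?case
      by (simp only: card_insert_disjoint prod.insert simp_thms)
  qed simp
  then show "sum w T ^ card T = of_nat (fact (card T)) * prod w T" "sum w T ^ Suc (card T) = 0" by auto
qed

text \<open>A factor \<open>y\<close> that annihilates some summands of the Kaehler form removes
  them from every power of it at once.\<close>

lemma mult_power_cong:
  fixes y :: "'a::comm_monoid_mult"
  assumes "y * s = y * t"
  shows "y * s ^ m = y * t ^ m"
proof (induction m)
  case (Suc m)
  have "y * s ^ Suc m = (y * s) * s ^ m" by (simp only: power_Suc mult.assoc)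
  also have "\<dots> = (y * t) * s ^ m" by (simp only: assms)
  also have "\<dots> = t * (y * s ^ m)" by (simp only: mult_ac)
  also have "\<dots> = t * (y * t ^ m)" by (simp only: Suc.IH)
  finally show ?case by (simp only: power_Suc mult_ac)
qed simp

text \<open>The relations between the products \<open>i/2 dz\<^sub>j \<and> dz\<^sub>k\<close>-bar.\<close>

locale hermitian_products =
  fixes E :: "'n::finite \<Rightarrow> 'n \<Rightarrow> 'a::comm_ring_1"
  assumes swap: "E j k * E l m = - (E j m * E l k)"
    and zero_left: "E j k * E j m = 0"
    and zero_right: "E j k * E l k = 0"
begin

abbreviation "kaehler \<equiv> \<Sum>j\<in>UNIV. E j j"
abbreviation "vol \<equiv> \<Prod>j\<in>UNIV. E j j"

text \<open>Next to \<open>y\<close>, the Kaehler form reduces to its summands with index in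
  \<open>T\<close>, to which the powers of sums of square-zero elements apply.\<close>

lemma mult_kaehler_power:
  assumes "\<And>j. j \<notin> T \<Longrightarrow> y * E j j = 0"
  shows "card T < m \<Longrightarrow> y * kaehler ^ m = 0"
    and "card T = m \<Longrightarrow> y * kaehler ^ m = of_nat (fact m) * (y * (\<Prod>j\<in>T. E j j))"
proof -
  have "y * kaehler = y * (\<Sum>j\<in>T. E j j)"
    unfolding sum_distrib_left by (rule sum.mono_neutral_right) (use assms in auto)
  then have eq: "y * kaehler ^ m = y * (\<Sum>j\<in>T. E j j) ^ m" for m
    by (rule mult_power_cong)
  show "y * kaehler ^ m = of_nat (fact m) * (y * (\<Prod>j\<in>T. E j j))" if "card T = m"
    unfolding eq that[symmetric] by (subst square_zero_sum_power) (auto simp: zero_left mult_ac)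
  show "y * kaehler ^ m = 0" if "card T < m"
  proof -
    have "m = Suc (card T) + (m - Suc (card T))" using that by simp
    then have "(\<Sum>j\<in>T. E j j) ^ m = (\<Sum>j\<in>T. E j j) ^ Suc (card T) * (\<Sum>j\<in>T. E j j) ^ (m - Suc (card T))"
      by (metis power_add)
    also have "(\<Sum>j\<in>T. E j j) ^ Suc (card T) = 0"
      by (rule square_zero_sum_power(2)) (auto simp: zero_left)
    finally show ?thesis by (simp add: eq)
  qed
qed

lemma kaehler_power_card: "kaehler ^ CARD('n) = of_nat (fact CARD('n)) * vol"
  using mult_kaehler_power(2)[of UNIV 1 "CARD('n)"] by simp

lemma vol_remove: "vol = (\<Prod>j\<in>A. E j j) * (\<Prod>j\<in>-A. E j j)"
  using prod.union_disjoint[of A "-A" "\<lambda>j. E j j"] by (simp add: Compl_partition)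

lemma card_compl: "card (- A) = CARD('n) - card A"
  for A :: "'n set"
  by (simp add: Compl_eq_Diff_UNIV card_Diff_subset)

text \<open>\<open>E j k\<close> leaves alive exactly the summands \<open>E l l\<close> with
  \<open>l\<close> outside {j, k}. There are n-1 of them if j = k, just enough, and n-2 otherwise,
  one too few.\<close>

lemma mult_kaehler_power1:
  "E j k * kaehler ^ (CARD('n) - 1) = (if j = k then of_nat (fact (CARD('n) - 1)) * vol else 0)"
proof -
  have z: "E j k * E l l = 0" if "l \<notin> - {j, k}" for l
    using that zero_left zero_right by auto
  have c: "card (- {j, k}) = CARD('n) - card {j, k}"
    by (rule card_compl)
  have le: "card {j, k} \<le> CARD('n)"
    by (rule card_mono) auto
  show ?thesis
  proof (cases "j = k")
    case True
    have "E j k * kaehler ^ (CARD('n) - 1) =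
        of_nat (fact (CARD('n) - 1)) * (E j k * (\<Prod>l\<in>- {j, k}. E l l))"
      by (rule mult_kaehler_power(2)[OF z], assumption, unfold c, simp add: True)
    also have "E j k * (\<Prod>l\<in>- {j, k}. E l l) = vol"
      by (subst vol_remove[of "{j}"]) (simp add: True)
    finally show ?thesis using True by simp
  next
    case False
    have "E j k * kaehler ^ (CARD('n) - 1) = 0"
      by (rule mult_kaehler_power(1)[OF z], assumption, unfold c) (use False le in simp)
    then show ?thesis using False by simp
  qed
qed

text \<open>The exponent n-2 requires n-2 surviving summands, so at most two distinct indices may
  occur. What is left are the products \<open>E a a * E b b\<close> and, by \<open>swap\<close>,
  their negatives \<open>E a b * E b a\<close>; they produce trace a trace b and - trace (a b)
  below.\<close>

lemma mult_kaehler_power2: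
  "E j k * E l m * kaehler ^ (CARD('n) - 2) =
     ((if j = k \<and> l = m then 1 else 0) - (if j = m \<and> l = k then 1 else 0)) *
       (of_nat (fact (CARD('n) - 2)) * vol)"
proof -
  let ?A = "{j, k, l, m}"
  have z: "E j k * E l m * E i i = 0" if "i \<notin> - ?A" for i
  proof -
    from that have "E j k * E i i = 0 \<or> E l m * E i i = 0"
      using zero_left zero_right by auto
    moreover have "E j k * E l m * E i i = (E j k * E i i) * E l m" by (simp only: mult_ac)
    moreover have "E j k * E l m * E i i = E j k * (E l m * E i i)" by (simp only: mult_ac)
    ultimately show ?thesis by (metis mult_zero_left mult_zero_right)
  qed
  have c: "card (- ?A) = CARD('n) - card ?A"
    by (rule card_compl)
  have le: "card ?A \<le> CARD('n)"
    by (rule card_mono) auto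
  have diag: "E a a * E b b * kaehler ^ (CARD('n) - 2) = of_nat (fact (CARD('n) - 2)) * vol"
    if "a \<noteq> b" "?A = {a, b}" for a b
  proof -
    have "E a a * E b b * E i i = 0" if "i \<notin> - {a, b}" for i
    proof -
      have "E a a * E i i = 0 \<or> E b b * E i i = 0"
        using that zero_left by auto
      moreover have "E a a * E b b * E i i = (E a a * E i i) * E b b" by (simp only: mult_ac)
      moreover have "E a a * E b b * E i i = E a a * (E b b * E i i)" by (simp only: mult_ac)
      ultimately show ?thesis by (metis mult_zero_left mult_zero_right)
    qed
    then have "E a a * E b b * kaehler ^ (CARD('n) - 2) =
        of_nat (fact (CARD('n) - 2)) * (E a a * E b b * (\<Prod>l\<in>- {a, b}. E l l))"
      by (rule mult_kaehler_power(2)) (simp_all add: card_compl that(1))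
    also have "E a a * E b b * (\<Prod>l\<in>- {a, b}. E l l) = vol"
      by (subst vol_remove[of "{a, b}"]) (simp add: that(1))
    finally show ?thesis .
  qed
  show ?thesis
  proof (cases "j = l \<or> k = m")
    case True
    \<comment> \<open>A repeated holomorphic or antiholomorphic index kills the product; the two
      Kronecker terms then coincide, so the right-hand side vanishes as well.\<close>
    then have "E j k * E l m = 0" using zero_left[of j k m] zero_right[of j k l] by metis
    moreover have "(j = k \<and> l = m) = (j = m \<and> l = k)"
      using True by metis
    ultimately show ?thesis by (simp only: mult_zero_left diff_self)
  next
    case ne: False
    show ?thesis
    proof (cases "(j = k \<and> l = m) \<or> (j = m \<and> l = k)")
      case True
      then have "?A = {j, l}" by auto
      with True ne show ?thesis
        using diag[of j l] swap[of j k l m] by auto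
    next
      case large: False
      \<comment> \<open>At least three distinct indices leave at most n-3 summands for the exponent
        n-2.\<close>
      with ne have big: "2 < card ?A"
        by (auto simp: card_insert_if)
      have "E j k * E l m * kaehler ^ (CARD('n) - 2) = 0"
        by (rule mult_kaehler_power(1)[OF z], assumption, unfold c) (use le big in linarith)
      moreover have "(j = k \<and> l = m) = False" "(j = m \<and> l = k) = False"
        using large by simp_all
      ultimately show ?thesis by (simp only: if_False diff_self mult_zero_left)
    qed
  qed
qed

end

section \<open>Coframes and the coefficients of (1,1)-forms\<close>

lemma Rep_prod_annihilated:
  assumes "\<And>j xs. j \<in> T \<Longrightarrow> Rep_even_form (w j) (v # xs) = 0"
  shows "Rep_even_form (\<Prod>j\<in>T. w j) (v # xs) = 0"
  using assms
proof (induction T arbitrary: xs rule: infinite_finite_induct)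
  case (insert j T)
  have "(\<lambda>xs. Rep_even_form (w j) (v # xs)) = (\<lambda>_. 0)"
    "(\<lambda>xs. Rep_even_form (\<Prod>j\<in>T. w j) (v # xs)) = (\<lambda>_. 0)"
    using insert.prems insert.IH by auto
  then show ?case
    using insert.hyps by (simp add: times_even_form.rep_eq)
qed (simp_all add: one_even_form.rep_eq const_form_def)

lemma linear_cnj: "linear a \<Longrightarrow> linear (\<lambda>u. cnj (a u))"
  by (simp add: linear_complex_iff)

text \<open>\<open>z\<close> is the dual coframe. In the application \<open>e\<close> is orthonormal
  and \<open>z j u\<close> is the Hermitian product of \<open>u\<close> with
  \<open>e j\<close>.\<close>

locale complex_coframe =
  fixes e :: "'n::finite \<Rightarrow> complex^'n" and z :: "'n \<Rightarrow> complex^'n \<Rightarrow> complex"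
  assumes z_add: "z j (u + v) = z j u + z j v"
    and z_scale: "z j (c *s u) = c * z j u"
    and z_e: "z j (e k) = (if j = k then 1 else 0)"
    and expand: "u = (\<Sum>j\<in>UNIV. z j u *s e j)"
begin

lemma linear_z: "linear (z j)"
proof -
  have "z j (r *\<^sub>R v) = of_real r * z j v" for r v
    using z_scale[of j "of_real r" v] by (simp add: vector_scalar_mult_def scaleR_vec_def scaleR_conv_of_real)
  then show ?thesis by (simp add: linear_complex_iff z_add)
qed

text \<open>The factor \<open>\<i> / 2\<close> gives \<open>E j j\<close> the value 1 on the pair
  \<open>e j\<close>, \<open>\<i> *s e j\<close>; for an orthonormal \<open>e\<close> the sum of the
  \<open>E j j\<close> is then \<omega> itself.\<close>

definition E :: "'n \<Rightarrow> 'n \<Rightarrow> (complex^'n) even_form" where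
  "E j k = (\<i> / 2) *\<^sub>C wedge2 (z j) (\<lambda>u. cnj (z k u))"

lemma Rep_E:
  "Rep_even_form (E j k) vs = (if length vs = 2
     then \<i> / 2 * (z j (vs ! 0) * cnj (z k (vs ! 1)) - z j (vs ! 1) * cnj (z k (vs ! 0))) else 0)"
  by (simp add: E_def scale_form.rep_eq Rep_wedge2 linear_z linear_cnj wedge_one_form_one_form)

lemma E_swap: "E j k * E l m = - (E j m * E l k)"
  using wedge2_reorder[OF linear_z[of j] linear_cnj[OF linear_z[of k]] linear_z[of l] linear_cnj[OF linear_z[of m]]]
  by (simp add: E_def scale_form.scale_minus_right)

text \<open>Derives the two vanishing relations from \<open>E_swap\<close>: with two equal indices a
  product equals its own negative.\<close>

lemma double_eq_0: "x = - x \<Longrightarrow> x = 0" for x :: "(complex^'n) even_form"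
proof -
  assume "x = - x"
  then have "2 *\<^sub>C x = 0"
    using scale_form.scale_left_distrib[of 1 1 x] by (simp add: eq_neg_iff_add_eq_0)
  then show ?thesis by (simp add: scale_form.scale_eq_0_iff)
qed

sublocale hermitian_products E
proof
  show "E j k * E l m = - (E j m * E l k)" for j k l m by (rule E_swap)
  show "E j k * E j m = 0" for j k m
    by (rule double_eq_0) (subst E_swap, simp only: mult.commute)
  show "E j k * E l k = 0" for j k l
    by (rule double_eq_0) (rule E_swap)
qed

text \<open>Evaluating on \<open>e x\<close> and \<open>\<i> *s e x\<close> in front splits off the
  factor \<open>E x x\<close> with value 1, because contraction with these vectors kills the
  remaining factors.\<close>

lemma prod_E_nonzero: "finite T \<Longrightarrow> (\<Prod>j\<in>T. E j j) \<noteq> 0"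
proof (induction T rule: finite_induct)
  case (insert x T)
  let ?P = "Rep_even_form (\<Prod>j\<in>T. E j j)"
  obtain vs where vs: "?P vs \<noteq> 0"
    using insert.IH by (auto simp: Rep_even_form_inject[symmetric] zero_even_form.rep_eq fun_eq_iff)
  \<comment> \<open>Contraction is an antiderivation, so it kills a product when it kills each
    factor.\<close>
  have ann: "?P (v # xs) = 0" if "\<And>j. j \<in> T \<Longrightarrow> z j v = 0" for v xs
    by (rule Rep_prod_annihilated) (simp add: Rep_E that)
  have P: "(\<lambda>xs. ?P (e x # xs)) = (\<lambda>_. 0)" "(\<lambda>xs. ?P ((\<i> *s e x) # xs)) = (\<lambda>_. 0)"
    by (rule ext, rule ann, use insert.hyps in \<open>auto simp: z_scale z_e\<close>)+
  have E: "(\<lambda>xs. Rep_even_form (E x x) (e x # (\<i> *s e x) # xs)) = const_form 1"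
    by (auto simp: Rep_E const_form_def z_scale z_e fun_eq_iff algebra_simps)
  have "Rep_even_form (\<Prod>j\<in>insert x T. E j j) (e x # (\<i> *s e x) # vs) = ?P vs"
    using insert.hyps by (simp add: times_even_form.rep_eq P E wedge_const_form)
  with vs show ?case by (auto simp: zero_even_form.rep_eq)
qed simp

lemma vol_nonzero: "vol \<noteq> 0"
  by (rule prod_E_nonzero) simp

lemma scale_kaehler_power_eq_0_iff: "c *\<^sub>C kaehler ^ CARD('n) = 0 \<longleftrightarrow> c = 0"
  by (simp add: kaehler_power_card of_nat_mult_form scale_form.scale_eq_0_iff vol_nonzero)

text \<open>Type (1,1) makes \<open>S u v = B u (\<i> *s v) - \<i> * B u v\<close> complex linear in
  \<open>u\<close> and conjugate-linear in \<open>v\<close>, so it is determined by its values on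
  the basis. As \<open>B\<close> is complex-valued, \<open>S\<close> need not be Hermitian, and
  \<open>B\<close> is recovered by antisymmetrizing \<open>S\<close> instead of taking an imaginary
  part.\<close>

lemma form2_expand:
  fixes B :: "complex^'n \<Rightarrow> complex^'n \<Rightarrow> complex"
  assumes B: "alternating2 B" and type11: "\<And>u v. B (\<i> *s u) (\<i> *s v) = B u v"
  shows "form2 B = (\<Sum>j\<in>UNIV. \<Sum>k\<in>UNIV. (B (e j) (\<i> *s e k) - \<i> * B (e j) (e k)) *\<^sub>C E j k)"
proof -
  define S where "S u v = B u (\<i> *s v) - \<i> * B u v" for u v
  have add: "B (u + v) w = B u w + B v w" "B u (v + w) = B u v + B u w"
    and scaleR: "B (r *\<^sub>R u) v = of_real r * B u v" "B u (r *\<^sub>R v) = of_real r * B u v"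
    and self: "B u u = 0" for u v w r
    using B by (auto simp: alternating2_def bilinear_def linear_complex_iff)
  note anti = alternating2_anticommute[OF B]
  have minus: "B (- u) v = - B u v" "B u (- v) = - B u v" for u v
    using scaleR(1)[of "-1" u v] scaleR(2)[of u "-1" v] by simp_all
  note ii = imaginary_scale_twice
  have i1: "B (\<i> *s u) v = - B u (\<i> *s v)" for u v
    using type11[of u "\<i> *s v"] by (simp add: ii minus) (metis minus_minus)
  note split = complex_scale_split
  have S_add: "S (u + v) w = S u w + S v w" "S u (v + w) = S u v + S u w" for u v w
    by (simp_all add: S_def add vector_add_ldistrib algebra_simps)
  have S_i: "S (\<i> *s u) v = \<i> * S u v" "S u (\<i> *s v) = - \<i> * S u v" for u v
    by (simp_all add: S_def i1 ii minus algebra_simps)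
  have S_R: "S (r *\<^sub>R u) v = of_real r * S u v" "S u (r *\<^sub>R v) = of_real r * S u v" for r u v
  proof -
    have "\<i> *s (r *\<^sub>R v) = r *\<^sub>R (\<i> *s v)" by (simp add: vec_eq_iff complex_eq_iff)
    then show "S (r *\<^sub>R u) v = of_real r * S u v" "S u (r *\<^sub>R v) = of_real r * S u v"
      by (simp_all add: S_def scaleR algebra_simps)
  qed
  have S_scale: "S (c *s u) v = c * S u v" "S u (c *s v) = cnj c * S u v" for c u v
  proof -
    have "S (c *s u) v = of_real (Re c) * S u v + of_real (Im c) * (\<i> * S u v)"
      by (subst split) (simp add: S_add S_R S_i)
    also have "\<dots> = c * S u v"
      by (subst (3) complex_eq) (simp add: algebra_simps)
    finally show "S (c *s u) v = c * S u v" .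
    have "S u (c *s v) = of_real (Re c) * S u v - of_real (Im c) * (\<i> * S u v)"
      by (subst split) (simp add: S_add S_R S_i)
    also have "\<dots> = cnj c * S u v"
      by (simp add: complex_eq_iff algebra_simps)
    finally show "S u (c *s v) = cnj c * S u v" .
  qed
  have S_0: "S 0 v = 0" "S u 0 = 0" for u v
    using S_scale(1)[of 0 0 v] S_scale(2)[of u 0 0] by simp_all
  have S_sum: "S (\<Sum>i\<in>A. f i) v = (\<Sum>i\<in>A. S (f i) v)" "S u (\<Sum>i\<in>A. f i) = (\<Sum>i\<in>A. S u (f i))"
    for A :: "'n set" and f u v
    by (induction A rule: infinite_finite_induct) (simp_all add: S_0 S_add)
  have S_expand: "S u v = (\<Sum>j\<in>UNIV. \<Sum>k\<in>UNIV. S (e j) (e k) * (z j u * cnj (z k v)))" for u v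
    by (subst expand[of u], subst expand[of v])
       (simp add: S_sum S_scale mult_ac sum_distrib_left, rule sum.swap)
  have half: "B u v = (\<i> / 2) * (S u v - S v u)" for u v
    using anti[of v "\<i> *s u"] anti[of v u] i1[of u v]
    by (simp add: S_def algebra_simps)
  have "B u v = (\<Sum>j\<in>UNIV. \<Sum>k\<in>UNIV. S (e j) (e k) * (\<i> / 2) *
      (z j u * cnj (z k v) - z j v * cnj (z k u)))" for u v
    unfolding half[of u v] S_expand[of u v] S_expand[of v u]
    by (simp only: sum_distrib_left sum_subtractf[symmetric])
       (intro sum.cong refl, simp add: algebra_simps)
  then have B_eq: "B = (\<lambda>u v. \<Sum>j\<in>UNIV. \<Sum>k\<in>UNIV. S (e j) (e k) * (\<i> / 2) *
      (z j u * cnj (z k v) - z j v * cnj (z k u)))"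
    by (intro ext)
  have "form2 B = (\<Sum>j\<in>UNIV. \<Sum>k\<in>UNIV. S (e j) (e k) *\<^sub>C E j k)"
    by (subst B_eq) (simp only: form2_sum alternating2_sum alternating2_scale alternating2_wedge2
        form2_scale linear_z linear_cnj E_def wedge2_def scale_form.scale_scale)
  then show ?thesis by (simp only: S_def)
qed

lemma sum_mult_kaehler_power1:
  "(\<Sum>j\<in>UNIV. \<Sum>k\<in>UNIV. a $ j $ k *\<^sub>C E j k) * kaehler ^ (CARD('n) - 1) =
   (trace a * fact (CARD('n) - 1)) *\<^sub>C vol"
proof -
  have "(\<Sum>j\<in>UNIV. \<Sum>k\<in>UNIV. a $ j $ k *\<^sub>C E j k) * kaehler ^ (CARD('n) - 1) =
      (\<Sum>j\<in>UNIV. \<Sum>k\<in>UNIV. if j = k then (a $ j $ k * fact (CARD('n) - 1)) *\<^sub>C vol else 0)"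
    unfolding sum_distrib_right
    by (intro sum.cong refl)
       (simp only: scale_form_mult_left mult_kaehler_power1 of_nat_mult_form, simp)
  also have "\<dots> = (trace a * fact (CARD('n) - 1)) *\<^sub>C vol"
    by (simp add: trace_def sum_distrib_right scale_form.scale_sum_left)
  finally show ?thesis .
qed

lemma sum_mult_kaehler_power2:
  "(\<Sum>j\<in>UNIV. \<Sum>k\<in>UNIV. a $ j $ k *\<^sub>C E j k) * (\<Sum>l\<in>UNIV. \<Sum>m\<in>UNIV. b $ l $ m *\<^sub>C E l m)
     * kaehler ^ (CARD('n) - 2) =
   ((trace a * trace b - trace (a ** b)) * fact (CARD('n) - 2)) *\<^sub>C vol"
proof -
  define K where "K = fact (CARD('n) - 2) *\<^sub>C vol"
  have coeff: "((if P then 1 else 0) - (if Q then 1 else 0)) * K =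
      ((if P then 1 else 0) - (if Q then 1 else 0)) *\<^sub>C K" for P Q
    by (cases P; cases Q) simp_all
  have K: "of_nat (fact (CARD('n) - 2)) * vol = K"
    by (simp only: K_def of_nat_mult_form of_nat_fact)
  have EEK: "E j k * E l m * kaehler ^ (CARD('n) - 2) =
      ((if j = k \<and> l = m then 1 else 0) - (if j = m \<and> l = k then 1 else 0)) *\<^sub>C K" for j k l m
    by (simp only: mult_kaehler_power2 K coeff)
  have "(\<Sum>j\<in>UNIV. \<Sum>k\<in>UNIV. a $ j $ k *\<^sub>C E j k) * (\<Sum>l\<in>UNIV. \<Sum>m\<in>UNIV. b $ l $ m *\<^sub>C E l m)
     * kaehler ^ (CARD('n) - 2) =
    (\<Sum>j\<in>UNIV. \<Sum>k\<in>UNIV. \<Sum>l\<in>UNIV. \<Sum>m\<in>UNIV.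
       (a $ j $ k * b $ l $ m) *\<^sub>C (E j k * E l m * kaehler ^ (CARD('n) - 2)))"
    by (simp only: sum_distrib_right, simp only: sum_distrib_left sum_distrib_right)
       (intro sum.cong refl, simp add: mult_ac)
  also have "\<dots> = (\<Sum>j\<in>UNIV. \<Sum>k\<in>UNIV. \<Sum>l\<in>UNIV. \<Sum>m\<in>UNIV. a $ j $ k * b $ l $ m *
      ((if j = k \<and> l = m then 1 else 0) - (if j = m \<and> l = k then 1 else 0))) *\<^sub>C K"
    by (simp only: EEK scale_form.scale_scale scale_form.scale_sum_left)
  also have "(\<Sum>j\<in>UNIV. \<Sum>k\<in>UNIV. \<Sum>l\<in>UNIV. \<Sum>m\<in>UNIV. a $ j $ k * b $ l $ m *
      ((if j = k \<and> l = m then 1 else 0) - (if j = m \<and> l = k then 1 else 0))) =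
      (\<Sum>j\<in>UNIV. \<Sum>l\<in>UNIV. a $ j $ j * b $ l $ l) - (\<Sum>j\<in>UNIV. \<Sum>k\<in>UNIV. a $ j $ k * b $ k $ j)"
  proof -
    have "(\<Sum>k\<in>UNIV. \<Sum>l\<in>UNIV. \<Sum>m\<in>UNIV. a $ j $ k * b $ l $ m * (if j = k \<and> l = m then 1 else 0)) =
        (\<Sum>l\<in>UNIV. a $ j $ j * b $ l $ l)" for j
    proof -
      have "(\<Sum>l\<in>UNIV. \<Sum>m\<in>UNIV. a $ j $ k * b $ l $ m * (if j = k \<and> l = m then 1 else 0)) =
          (if j = k then \<Sum>l\<in>UNIV. a $ j $ k * b $ l $ l else 0)" for k
        by (simp add: if_distrib[of "(*) _"] cong: if_cong)
      then show ?thesis by simp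
    qed
    moreover have "(\<Sum>l\<in>UNIV. \<Sum>m\<in>UNIV. a $ j $ k * b $ l $ m * (if j = m \<and> l = k then 1 else 0)) =
        a $ j $ k * b $ k $ j" for j k
    proof -
      have "(\<Sum>m\<in>UNIV. a $ j $ k * b $ l $ m * (if j = m \<and> l = k then 1 else 0)) =
          (if l = k then a $ j $ k * b $ l $ j else 0)" for l
        by (simp add: if_distrib[of "(*) _"] cong: if_cong)
      then show ?thesis by simp
    qed
    ultimately show ?thesis
      by (simp only: right_diff_distrib sum_subtractf)
  qed
  also have "\<dots> = trace a * trace b - trace (a ** b)"
    by (simp add: trace_def matrix_matrix_mult_def sum_product)
  finally show ?thesis by (simp add: K_def)
qed

end

section \<open>The first two Chern forms as traces\<close>

text \<open>Doubling the quadratic coefficient permits a sum over ordered pairs, which requires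
  neither an order on the indices nor a division by 2 in the ring.\<close>

lemma coeff_prod_linear:
  fixes f g :: "'i \<Rightarrow> 'a::comm_ring_1"
  assumes "finite S"
  shows "coeff (\<Prod>i\<in>S. [:f i, g i:]) 0 = prod f S"
    and "coeff (\<Prod>i\<in>S. [:f i, g i:]) 1 = (\<Sum>i\<in>S. g i * prod f (S - {i}))"
    and "2 * coeff (\<Prod>i\<in>S. [:f i, g i:]) 2 =
           (\<Sum>i\<in>S. \<Sum>j\<in>S - {i}. g i * g j * prod f (S - {i, j}))"
proof -
  let ?p = "\<lambda>S. \<Prod>i\<in>S. [:f i, g i:]"
  have 0: "coeff (?p S) 0 = prod f S" if "finite S" for S
    using that by (induction S rule: finite_induct) (simp_all add: coeff_mult)
  have 1: "coeff (?p S) 1 = (\<Sum>i\<in>S. g i * prod f (S - {i}))" if "finite S" for S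
    using that
  proof (induction S rule: finite_induct)
    case (insert x S)
    have "(\<Sum>i\<in>S. g i * prod f (insert x S - {i})) = f x * (\<Sum>i\<in>S. g i * prod f (S - {i}))"
      unfolding sum_distrib_left
    proof (rule sum.cong)
      fix i assume "i \<in> S"
      with insert.hyps have "insert x S - {i} = insert x (S - {i})" by auto
      with insert.hyps show "g i * prod f (insert x S - {i}) = f x * (g i * prod f (S - {i}))"
        by (simp add: mult_ac)
    qed simp
    then show ?case
      using insert by (simp add: coeff_pCons 0[simplified] algebra_simps)
  qed simp
  have 2: "2 * coeff (?p S) 2 = (\<Sum>i\<in>S. \<Sum>j\<in>S - {i}. g i * g j * prod f (S - {i, j}))"
    if "finite S" for S
    using that
  proof (induction S rule: finite_induct)
    case (insert x S)
    \<comment> \<open>Ordered pairs from \<open>insert x S\<close> are sorted by the position of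
      \<open>x\<close>: first here, second or absent in \<open>B\<close>.\<close>
    have A: "(\<Sum>j\<in>insert x S - {x}. g x * g j * prod f (insert x S - {x, j})) =
        g x * (\<Sum>i\<in>S. g i * prod f (S - {i}))"
    proof -
      have "insert x S - {x, j} = S - {j}" for j
        using insert.hyps by auto
      moreover have "insert x S - {x} = S" using insert.hyps by auto
      ultimately show ?thesis by (simp add: sum_distrib_left mult_ac)
    qed
    have B: "(\<Sum>j\<in>insert x S - {i}. g i * g j * prod f (insert x S - {i, j})) =
        g x * (g i * prod f (S - {i})) + f x * (\<Sum>j\<in>S - {i}. g i * g j * prod f (S - {i, j}))"
      if "i \<in> S" for i
    proof -
      have "insert x S - {i} = insert x (S - {i})"
        using insert.hyps that by auto
      then have "(\<Sum>j\<in>insert x S - {i}. g i * g j * prod f (insert x S - {i, j})) =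
          g i * g x * prod f (insert x S - {i, x}) +
          (\<Sum>j\<in>S - {i}. g i * g j * prod f (insert x S - {i, j}))"
        using insert.hyps by simp
      also have "insert x S - {i, x} = S - {i}"
        using insert.hyps by auto
      also have "(\<Sum>j\<in>S - {i}. g i * g j * prod f (insert x S - {i, j})) =
          f x * (\<Sum>j\<in>S - {i}. g i * g j * prod f (S - {i, j}))"
        unfolding sum_distrib_left
      proof (rule sum.cong)
        fix j assume "j \<in> S - {i}"
        with insert.hyps that have "insert x S - {i, j} = insert x (S - {i, j})" by auto
        with insert.hyps show "g i * g j * prod f (insert x S - {i, j}) =
            f x * (g i * g j * prod f (S - {i, j}))"
          by (simp add: mult_ac)
      qed simp
      finally show ?thesis by (simp add: mult_ac)
    qed
    have "(\<Sum>i\<in>insert x S. \<Sum>j\<in>insert x S - {i}. g i * g j * prod f (insert x S - {i, j})) =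
        g x * (\<Sum>i\<in>S. g i * prod f (S - {i})) +
        (g x * (\<Sum>i\<in>S. g i * prod f (S - {i})) +
         f x * (\<Sum>i\<in>S. \<Sum>j\<in>S - {i}. g i * g j * prod f (S - {i, j})))"
    proof -
      have "(\<Sum>i\<in>S. \<Sum>j\<in>insert x S - {i}. g i * g j * prod f (insert x S - {i, j})) =
          (\<Sum>i\<in>S. g x * (g i * prod f (S - {i})) +
             f x * (\<Sum>j\<in>S - {i}. g i * g j * prod f (S - {i, j})))"
        by (rule sum.cong[OF refl B])
      then show ?thesis
        by (simp only: sum.insert[OF insert.hyps] A sum.distrib sum_distrib_left)
    qed
    also have "\<dots> = 2 * (g x * coeff (?p S) 1) + f x * (2 * coeff (?p S) 2)"
      by (simp only: 1[OF insert.hyps(1)] insert.IH) (simp only: mult_2 add.assoc)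
    also have "\<dots> = 2 * coeff ([:f x, g x:] * ?p S) 2"
      by (simp add: coeff_pCons numeral_2_eq_2 algebra_simps)
    finally show ?case
      using insert.hyps by simp
  qed simp
  show "coeff (?p S) 0 = prod f S"
    "coeff (?p S) 1 = (\<Sum>i\<in>S. g i * prod f (S - {i}))"
    "2 * coeff (?p S) 2 = (\<Sum>i\<in>S. \<Sum>j\<in>S - {i}. g i * g j * prod f (S - {i, j}))"
    using 0 1 2 assms by auto
qed

text \<open>The entries of the identity matrix at the positions outside \<open>A\<close> select the
  permutations that move nothing there. For \<open>A\<close> with one or two elements these are the
  identity and, in the second case, one transposition.\<close>

lemma prod_delta_permutes:
  fixes p :: "'n::finite \<Rightarrow> 'n"
  assumes "p permutes UNIV"
  shows "(\<Prod>k\<in>UNIV - A. if k = p k then 1 else 0 :: 'a::comm_semiring_1) = (if p permutes A then 1 else 0)"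
proof (cases "p permutes A")
  case True
  then show ?thesis by (auto simp: permutes_def intro!: prod.neutral)
next
  case False
  have "\<exists>k\<in>UNIV - A. p k \<noteq> k"
  proof (rule ccontr)
    assume "\<not> ?thesis"
    then have "p permutes A"
      using assms by (auto simp: permutes_def)
    with False show False by contradiction
  qed
  then obtain k where "k \<in> UNIV - A" "k \<noteq> p k"
    by metis
  then show ?thesis
    using False by (auto intro!: prod_zero bexI[of _ k])
qed

text \<open>The coefficient of degree m chooses m rows that contribute an entry of \<open>F\<close>,
  the others contributing the identity. For m = 1 only the identity permutation remains; for m = 2
  also the transposition of the two rows, with sign -1.\<close>

lemma coeff_det_one_plus:
  fixes F :: "'a::comm_ring_1^'n^'n"
  defines "D \<equiv> det (\<chi> i j. [:if i = j then 1 else 0, F $ i $ j:])"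
  shows "coeff D 1 = trace F" and "2 * coeff D 2 = trace F * trace F - trace (F ** F)"
proof -
  let ?P = "{p. p permutes (UNIV :: 'n set)}"
  have finP: "finite ?P" by simp
  have D: "coeff D m = (\<Sum>p\<in>?P. of_int (sign p) *
      coeff (\<Prod>i\<in>UNIV. [:if i = p i then 1 else 0, F $ i $ p i:]) m)" for m
    by (simp add: D_def det_def coeff_sum of_int_poly)
  have swap: "(\<Sum>p\<in>?P. \<Sum>i\<in>UNIV. \<Sum>j\<in>UNIV - {i}. G p i j) =
      (\<Sum>i\<in>UNIV. \<Sum>j\<in>UNIV - {i}. \<Sum>p\<in>?P. G p i j)" for G :: "('n \<Rightarrow> 'n) \<Rightarrow> 'n \<Rightarrow> 'n \<Rightarrow> 'a"
    by (subst sum.swap) (rule sum.cong[OF refl], rule sum.swap)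
  have one: "(\<Sum>p\<in>?P. of_int (sign p) * (F $ i $ p i * (\<Prod>k\<in>UNIV - {i}. if k = p k then 1 else 0)))
      = F $ i $ i" for i
  proof -
    have "(\<Sum>p\<in>?P. of_int (sign p) * (F $ i $ p i * (\<Prod>k\<in>UNIV - {i}. if k = p k then 1 else 0))) =
        (\<Sum>p\<in>{id}. of_int (sign p) * (F $ i $ p i * (\<Prod>k\<in>UNIV - {i}. if k = p k then 1 else 0)))"
      by (rule sum.mono_neutral_right[OF finP])
         (auto simp: prod_delta_permutes permutes_sing permutes_id)
    then show ?thesis by simp
  qed
  have two: "(\<Sum>p\<in>?P. of_int (sign p) *
        (F $ i $ p i * F $ j $ p j * (\<Prod>k\<in>UNIV - {i, j}. if k = p k then 1 else 0)))
      = F $ i $ i * F $ j $ j - F $ i $ j * F $ j $ i" if "i \<noteq> j" for i j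
  proof -
    let ?t = "Transposition.transpose i j"
    have t: "?t permutes {i, j}" "?t permutes UNIV" "?t \<noteq> id"
      using that by (simp_all add: permutes_swap_id) (metis id_apply transpose_apply_first)
    have "(\<Sum>p\<in>?P. of_int (sign p) *
        (F $ i $ p i * F $ j $ p j * (\<Prod>k\<in>UNIV - {i, j}. if k = p k then 1 else 0))) =
        (\<Sum>p\<in>{id, ?t}. of_int (sign p) *
        (F $ i $ p i * F $ j $ p j * (\<Prod>k\<in>UNIV - {i, j}. if k = p k then 1 else 0)))"
      by (rule sum.mono_neutral_right[OF finP])
         (auto simp: prod_delta_permutes permutes_doubleton_iff permutes_id t)
    also have "\<dots> = F $ i $ i * F $ j $ j - F $ i $ j * F $ j $ i"
      using t that by (simp add: prod_delta_permutes permutes_id sign_swap_id)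
    finally show ?thesis .
  qed
  show "coeff D 1 = trace F"
    unfolding D coeff_prod_linear(2)[OF finite] sum_distrib_left
    by (subst sum.swap) (simp only: one trace_def)
  have "2 * coeff D 2 = (\<Sum>p\<in>?P. of_int (sign p) *
      (2 * coeff (\<Prod>i\<in>UNIV. [:if i = p i then 1 else 0, F $ i $ p i:]) 2))"
    unfolding D sum_distrib_left by (simp only: mult_ac)
  also have "\<dots> = (\<Sum>i\<in>UNIV. \<Sum>j\<in>UNIV - {i}. F $ i $ i * F $ j $ j - F $ i $ j * F $ j $ i)"
    unfolding coeff_prod_linear(3)[OF finite] sum_distrib_left swap
    by (intro sum.cong refl two) auto
  \<comment> \<open>The added terms with i = j cancel.\<close>
  also have "\<dots> = (\<Sum>i\<in>UNIV. \<Sum>j\<in>UNIV. F $ i $ i * F $ j $ j - F $ i $ j * F $ j $ i)"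
    by (intro sum.cong refl sum.mono_neutral_left) auto
  also have "\<dots> = trace F * trace F - trace (F ** F)"
    by (simp add: trace_def matrix_matrix_mult_def sum_subtractf sum_product)
  finally show "2 * coeff D 2 = trace F * trace F - trace (F ** F)" .
qed

section \<open>The inequality at a point\<close>

context complex_coframe
begin

text \<open>\<open>M k l\<close> collects the coefficients of \<open>E k l\<close> in all entries of
  \<open>G\<close>, and \<open>t\<close> holds those of trace G. Both summands are separately
  nonpositive: they give minus the squared norm of \<open>t\<close> and minus the sum of the squared
  norms of the \<open>M k l\<close> with respect to \<open>H\<close>.\<close>

lemma primitive_trace:
  fixes G :: "(complex^'n) even_form^'r^'r" and M :: "'n \<Rightarrow> 'n \<Rightarrow> complex^'r^'r"
  assumes H: "positive_hermitian H"
    and M: "\<And>k l. transpose (M k l) ** H = H ** map_matrix cnj (M l k)"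
    and G: "\<And>i j. G $ i $ j = (\<Sum>k\<in>UNIV. \<Sum>l\<in>UNIV. M k l $ i $ j *\<^sub>C E k l)"
    and primitive: "\<And>i j. (\<Sum>k\<in>UNIV. M k k $ i $ j) = 0"
  obtains x :: real where "0 \<le> x" "x = 0 \<Longrightarrow> G = 0"
    "(trace G * trace G + trace (G ** G)) * kaehler ^ (CARD('n) - 2) =
       complex_of_real (- x * fact (CARD('n) - 2)) *\<^sub>C vol"
proof -
  define g :: "'r \<Rightarrow> 'r \<Rightarrow> complex^'n^'n" where "g i j = (\<chi> k l. M k l $ i $ j)" for i j
  define t :: "complex^'n^'n" where "t = (\<chi> k l. trace (M k l))"
  have tr_g: "trace (g i j) = 0" for i j
    using primitive[of i j] by (simp add: trace_def g_def)
  have "trace t = (\<Sum>i\<in>UNIV. \<Sum>k\<in>UNIV. M k k $ i $ i)"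
    unfolding t_def trace_def by (simp, rule sum.swap)
  then have tr_t: "trace t = 0"
    by (simp add: primitive)
  have Gg: "G $ i $ j = (\<Sum>k\<in>UNIV. \<Sum>l\<in>UNIV. g i j $ k $ l *\<^sub>C E k l)" for i j
    by (simp add: G g_def)
  have "trace G = (\<Sum>k\<in>UNIV. \<Sum>l\<in>UNIV. \<Sum>i\<in>UNIV. M k l $ i $ i *\<^sub>C E k l)"
    unfolding trace_def G by (subst sum.swap, rule sum.cong[OF refl], rule sum.swap)
  then have trG: "trace G = (\<Sum>k\<in>UNIV. \<Sum>l\<in>UNIV. t $ k $ l *\<^sub>C E k l)"
    by (simp add: t_def trace_def scale_form.scale_sum_left)
  \<comment> \<open>The squared norm of \<open>M k l\<close> for \<open>H\<close>, known only
    through its existence in \<open>trace_mult_adjoint\<close>.\<close>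
  define y where "y k l = (SOME y::real. 0 \<le> y \<and> trace (M k l ** M l k) = of_real y \<and> (y = 0 \<longrightarrow> M k l = 0))" for k l
  have y: "0 \<le> y k l" "trace (M k l ** M l k) = of_real (y k l)" "y k l = 0 \<Longrightarrow> M k l = 0" for k l
  proof -
    have "\<exists>y::real. 0 \<le> y \<and> trace (M k l ** M l k) = of_real y \<and> (y = 0 \<longrightarrow> M k l = 0)"
      using trace_mult_adjoint[OF H M[of k l]] by metis
    from someI_ex[OF this] show "0 \<le> y k l" "trace (M k l ** M l k) = of_real (y k l)" "y k l = 0 \<Longrightarrow> M k l = 0"
      by (simp_all add: y_def)
  qed
  have t_adj: "t $ l $ k = cnj (t $ k $ l)" for k l
    using trace_adjoint[OF H M[of k l]] by (simp add: t_def)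
  define x1 x2 where "x1 = (\<Sum>k\<in>UNIV. \<Sum>l\<in>UNIV. (cmod (t $ k $ l))\<^sup>2)" and "x2 = (\<Sum>k\<in>UNIV. \<Sum>l\<in>UNIV. y k l)"
  have "trace (t ** t) = (\<Sum>k\<in>UNIV. \<Sum>l\<in>UNIV. t $ k $ l * cnj (t $ k $ l))"
    unfolding trace_def matrix_matrix_mult_def
    by (simp, intro sum.cong refl, subst (2) t_adj, rule refl)
  then have tt: "trace (t ** t) = of_real x1"
    by (simp add: x1_def flip: complex_norm_square)
  \<comment> \<open>Exchanging tangent and fibre indices turns products of tangent coefficient
    matrices into products of endomorphisms of the fibre, to which self-adjointness applies.\<close>
  have "(\<Sum>i\<in>UNIV. \<Sum>j\<in>UNIV. trace (g i j ** g j i)) =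
      (\<Sum>i\<in>UNIV. \<Sum>k\<in>UNIV. \<Sum>l\<in>UNIV. \<Sum>j\<in>UNIV. M k l $ i $ j * M l k $ j $ i)"
    unfolding trace_def matrix_matrix_mult_def g_def
    by (rule sum.cong[OF refl], simp, subst sum.swap, rule sum.cong[OF refl], rule sum.swap)
  also have "\<dots> = (\<Sum>k\<in>UNIV. \<Sum>l\<in>UNIV. trace (M k l ** M l k))"
    unfolding trace_def matrix_matrix_mult_def
    by (simp, subst sum.swap, rule sum.cong[OF refl], rule sum.swap)
  finally have gg: "(\<Sum>i\<in>UNIV. \<Sum>j\<in>UNIV. trace (g i j ** g j i)) = of_real x2"
    by (simp add: y x2_def)
  have Q1: "trace G * trace G * kaehler ^ (CARD('n) - 2) = (- of_real x1 * fact (CARD('n) - 2)) *\<^sub>C vol"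
    unfolding trG sum_mult_kaehler_power2 by (simp only: tt tr_t mult_zero_left diff_0)
  have "trace (G ** G) * kaehler ^ (CARD('n) - 2) =
      (\<Sum>i\<in>UNIV. \<Sum>j\<in>UNIV. G $ i $ j * G $ j $ i * kaehler ^ (CARD('n) - 2))"
    by (simp add: trace_def matrix_matrix_mult_def sum_distrib_right)
  also have "\<dots> = (\<Sum>i\<in>UNIV. \<Sum>j\<in>UNIV. (- trace (g i j ** g j i) * fact (CARD('n) - 2)) *\<^sub>C vol)"
    unfolding Gg sum_mult_kaehler_power2 by (simp only: tr_g mult_zero_left diff_0)
  also have "\<dots> = (- of_real x2 * fact (CARD('n) - 2)) *\<^sub>C vol"
    unfolding gg[symmetric] by (simp only: sum_negf[symmetric] sum_distrib_right scale_form.scale_sum_left)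
  finally have Q2: "trace (G ** G) * kaehler ^ (CARD('n) - 2) = (- of_real x2 * fact (CARD('n) - 2)) *\<^sub>C vol" .
  have x_nonneg: "0 \<le> x1" "0 \<le> x2"
    by (simp_all add: x1_def x2_def sum_nonneg y)
  show ?thesis
  proof (rule that[of "x1 + x2"])
    show "0 \<le> x1 + x2" using x_nonneg by simp
    show "G = 0" if "x1 + x2 = 0"
    proof -
      \<comment> \<open>The norms in \<open>x2\<close> see every coefficient of \<open>G\<close>,
        whereas \<open>x1\<close> sees only its trace.\<close>
      have "x2 = 0" using that x_nonneg by simp
      then have "M k l = 0" for k l
        by (simp add: x2_def sum_nonneg_eq_0_iff sum_nonneg y)
      then show ?thesis by (simp add: vec_eq_iff G)
    qed
    show "(trace G * trace G + trace (G ** G)) * kaehler ^ (CARD('n) - 2) =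
        complex_of_real (- (x1 + x2) * fact (CARD('n) - 2)) *\<^sub>C vol"
      unfolding distrib_right Q1 Q2 scale_form.scale_left_distrib[symmetric]
      by (simp add: algebra_simps)
  qed
qed

end

text \<open>\<open>\<omega> u (\<i> *s v)\<close> is the Riemannian metric belonging to \<omega>; it
  is the real part of a Hermitian metric with imaginary part -\<omega>.\<close>

lemma hermitian_form_of_kaehler:
  fixes \<omega> :: "complex^'n \<Rightarrow> complex^'n \<Rightarrow> real"
  assumes bil: "bilinear \<omega>" and self: "\<And>u. \<omega> u u = 0"
    and type11: "\<And>u v. \<omega> (\<i> *s u) (\<i> *s v) = \<omega> u v"
    and pos: "\<And>u. u \<noteq> 0 \<Longrightarrow> 0 < \<omega> u (\<i> *s u)"
  shows "hermitian_form (\<lambda>u v. complex_of_real (\<omega> u (\<i> *s v)) - \<i> * complex_of_real (\<omega> u v))"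
proof
  have add: "\<omega> (u + v) w = \<omega> u w + \<omega> v w" "\<omega> u (v + w) = \<omega> u v + \<omega> u w"
    and scaleR: "\<omega> (r *\<^sub>R u) v = r * \<omega> u v" "\<omega> u (r *\<^sub>R v) = r * \<omega> u v" for u v w r
    using bil by (auto simp: bilinear_def linear_iff)
  have anti: "\<omega> v u = - \<omega> u v" for u v
  proof -
    have "\<omega> (u + v) (u + v) = \<omega> u u + \<omega> u v + (\<omega> v u + \<omega> v v)"
      unfolding add by simp
    then show ?thesis by (simp add: self)
  qed
  have minus: "\<omega> (- u) v = - \<omega> u v" "\<omega> u (- v) = - \<omega> u v" for u v
    using scaleR(1)[of "-1" u v] scaleR(2)[of u "-1" v] by simp_all
  note ii = imaginary_scale_twice
  have i1: "\<omega> (\<i> *s u) v = - \<omega> u (\<i> *s v)" for u v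
    using type11[of u "\<i> *s v"] by (simp add: ii minus)
  note split = complex_scale_split
  fix x y z :: "complex^'n" and c :: complex
  let ?S = "\<lambda>u v. complex_of_real (\<omega> u (\<i> *s v)) - \<i> * complex_of_real (\<omega> u v)"
  show "?S (x + y) z = ?S x z + ?S y z"
    by (simp add: add algebra_simps)
  show "?S (c *s x) z = c * ?S x z"
    by (simp add: split[of c x] add scaleR i1 ii minus complex_eq_iff algebra_simps)
  show "?S y x = cnj (?S x y)"
    using anti[of y "\<i> *s x"] anti[of y x] i1[of x y] by simp
  show "0 < Re (?S x x)" if "x \<noteq> 0"
    using pos[OF that] by simp
qed

text \<open>The theorem as linear algebra at one point: \<open>B\<close> holds the values of
  i/(2\<pi>) \<Theta> on tangent vectors, and \<open>H\<close> is the Gram matrix of the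
  frame.\<close>

lemma hermite_einstein_pointwise:
  fixes \<omega> :: "complex^'n \<Rightarrow> complex^'n \<Rightarrow> real"
    and B :: "complex^'n \<Rightarrow> complex^'n \<Rightarrow> complex^'r^'r"
    and lam :: real
  defines "K \<equiv> form2 (\<lambda>u v. complex_of_real (\<omega> u v))"
  assumes n: "2 \<le> CARD('n)"
    and \<omega>: "bilinear \<omega>" "\<And>u. \<omega> u u = 0" "\<And>u v. \<omega> (\<i> *s u) (\<i> *s v) = \<omega> u v"
      "\<And>u. u \<noteq> 0 \<Longrightarrow> 0 < \<omega> u (\<i> *s u)"
    and H: "positive_hermitian H"
    and B_alt: "\<And>i j. alternating2 (\<lambda>u v. B u v $ i $ j)"
    and B_type11: "\<And>u v. B (\<i> *s u) (\<i> *s v) = B u v"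
    and B_herm: "\<And>u v. transpose (B u v) ** H = H ** map_matrix cnj (B u v)"
    and F: "F = (\<chi> i j. form2 (\<lambda>u v. B u v $ i $ j))"
    and HE: "\<And>i j. F $ i $ j * ((1 / fact (CARD('n) - 1)) *\<^sub>C K ^ (CARD('n) - 1)) =
      (if i = j then complex_of_real lam *\<^sub>C (1 / fact CARD('n)) *\<^sub>C K ^ CARD('n) else 0)"
    and s: "2 * s = trace F * trace F + trace (F ** F)"
  obtains x :: real where "0 \<le> x"
    "complex_of_real (lam * ((real CARD('r) + 1) / (2 * real CARD('n)))) *\<^sub>C (trace F * K ^ (CARD('n) - 1))
       - s * K ^ (CARD('n) - 2) = complex_of_real x *\<^sub>C K ^ CARD('n)"
    "complex_of_real x *\<^sub>C K ^ CARD('n) = 0 \<longleftrightarrow> F = mat (complex_of_real (lam / real CARD('n)) *\<^sub>C K)"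
proof -
  interpret hermitian_form "\<lambda>u v. complex_of_real (\<omega> u (\<i> *s v)) - \<i> * complex_of_real (\<omega> u v)"
    by (rule hermitian_form_of_kaehler[OF \<omega>])
  obtain e :: "'n \<Rightarrow> complex^'n" where
    e: "\<And>j k. complex_of_real (\<omega> (e j) (\<i> *s e k)) - \<i> * complex_of_real (\<omega> (e j) (e k)) = (if j = k then 1 else 0)"
    and expand: "\<And>u. u = (\<Sum>j\<in>UNIV. (complex_of_real (\<omega> u (\<i> *s e j)) - \<i> * complex_of_real (\<omega> u (e j))) *s e j)"
    by (rule orthonormal_basis_exists) (rule that)
  interpret C: complex_coframe e "\<lambda>j u. complex_of_real (\<omega> u (\<i> *s e j)) - \<i> * complex_of_real (\<omega> u (e j))"
  proof
    fix j k u v c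
    show "complex_of_real (\<omega> (u + v) (\<i> *s e j)) - \<i> * complex_of_real (\<omega> (u + v) (e j)) =
      (complex_of_real (\<omega> u (\<i> *s e j)) - \<i> * complex_of_real (\<omega> u (e j))) +
      (complex_of_real (\<omega> v (\<i> *s e j)) - \<i> * complex_of_real (\<omega> v (e j)))"
      by (rule add_left)
    show "complex_of_real (\<omega> (c *s u) (\<i> *s e j)) - \<i> * complex_of_real (\<omega> (c *s u) (e j)) =
      c * (complex_of_real (\<omega> u (\<i> *s e j)) - \<i> * complex_of_real (\<omega> u (e j)))"
      by (rule scale_left)
    show "complex_of_real (\<omega> (e k) (\<i> *s e j)) - \<i> * complex_of_real (\<omega> (e k) (e j)) = (if j = k then 1 else 0)"
      unfolding e by auto
    show "u = (\<Sum>j\<in>UNIV. (complex_of_real (\<omega> u (\<i> *s e j)) - \<i> * complex_of_real (\<omega> u (e j))) *s e j)"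
      by (rule expand)
  qed
  let ?n = "CARD('n)"
  have alt_\<omega>: "alternating2 (\<lambda>u v. complex_of_real (\<omega> u v))"
    using \<omega>(1,2) by (simp add: alternating2_def bilinear_def linear_complex_iff) (simp add: linear_iff)
  have "K = (\<Sum>j\<in>UNIV. \<Sum>k\<in>UNIV. (if j = k then 1 else 0) *\<^sub>C C.E j k)"
    unfolding K_def by (subst C.form2_expand[OF alt_\<omega>]) (simp_all only: \<omega>(3) e)
  also have "\<dots> = (\<Sum>j\<in>UNIV. \<Sum>k\<in>UNIV. if j = k then C.E j k else 0)"
    by (intro sum.cong refl) simp
  also have "\<dots> = C.kaehler"
    by simp
  finally have K: "K = C.kaehler" .
  define f where "f k l = B (e k) (\<i> *s e l) - map_matrix ((*) \<i>) (B (e k) (e l))" for k l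
  have F_expand: "F $ i $ j = (\<Sum>k\<in>UNIV. \<Sum>l\<in>UNIV. f k l $ i $ j *\<^sub>C C.E k l)" for i j
    using C.form2_expand[OF B_alt[of i j]] by (simp add: F f_def B_type11)
  have B_anti: "B v u $ i $ j = - B u v $ i $ j" for u v i j
    by (rule alternating2_anticommute[OF B_alt])
  \<comment> \<open>\<open>B (e k) (\<i> *s e l)\<close> is symmetric in k and l while
    \<open>B (e k) (e l)\<close> is antisymmetric. Exchanging k and l therefore only changes the
    sign of \<i>, just as conjugation does in \<open>f_herm\<close>.\<close>
  have f_swap: "f l k = B (e k) (\<i> *s e l) + map_matrix ((*) \<i>) (B (e k) (e l))" for k l
  proof -
    have "B (e l) (\<i> *s e k) $ i $ j = B (e k) (\<i> *s e l) $ i $ j" for i j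
    proof -
      have "B (e l) (\<i> *s e k) $ i $ j = - B (\<i> *s e k) (e l) $ i $ j"
        by (rule B_anti)
      also have "\<dots> = B (\<i> *s e k) (\<i> *s (\<i> *s e l)) $ i $ j"
        unfolding imaginary_scale_twice by (rule alternating2_minus_right[OF B_alt, symmetric])
      finally show ?thesis by (simp only: B_type11)
    qed
    then show ?thesis
      using B_anti[of "e l" "e k"] by (simp add: f_def vec_eq_iff)
  qed
  have f_herm: "transpose (f k l) ** H = H ** map_matrix cnj (f l k)" for k l
  proof -
    have 1: "(transpose (f k l) ** H) $ a $ b = (transpose (B (e k) (\<i> *s e l)) ** H) $ a $ b
        - \<i> * (transpose (B (e k) (e l)) ** H) $ a $ b" for a b
      by (simp add: f_def matrix_matrix_mult_def transpose_def algebra_simps sum_subtractf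
          sum_distrib_left)
    have 2: "(H ** map_matrix cnj (f l k)) $ a $ b = (H ** map_matrix cnj (B (e k) (\<i> *s e l))) $ a $ b
        - \<i> * (H ** map_matrix cnj (B (e k) (e l))) $ a $ b" for a b
      unfolding f_swap
      by (simp add: matrix_matrix_mult_def algebra_simps sum_subtractf sum_distrib_left)
    show ?thesis
      by (simp only: vec_eq_iff 1 2 B_herm) simp
  qed
  \<comment> \<open>The Hermite-Einstein equation read off against the volume form: wedging with
    \<omega>^(n-1)/(n-1)! takes the trace over the tangent indices, and \<omega>^n/n! is the volume
    form.\<close>
  have f_trace: "(\<Sum>k\<in>UNIV. f k k $ i $ j) = (if i = j then of_real lam else 0)" for i j
  proof -
    have tr: "trace (\<chi> k l. f k l $ i $ j) = (\<Sum>k\<in>UNIV. f k k $ i $ j)"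
      by (simp add: trace_def)
    have "F $ i $ j * K ^ (?n - 1) = ((\<Sum>k\<in>UNIV. f k k $ i $ j) * fact (?n - 1)) *\<^sub>C C.vol"
      using C.sum_mult_kaehler_power1[of "\<chi> k l. f k l $ i $ j"] unfolding tr
      by (simp only: vec_lambda_beta F_expand K)
    then have 1: "F $ i $ j * ((1 / fact (?n - 1)) *\<^sub>C K ^ (?n - 1)) = (\<Sum>k\<in>UNIV. f k k $ i $ j) *\<^sub>C C.vol"
      by (simp only: scale_form_mult_right scale_form.scale_scale) simp
    have 2: "complex_of_real lam *\<^sub>C (1 / fact ?n) *\<^sub>C K ^ ?n = of_real lam *\<^sub>C C.vol"
      unfolding K by (simp add: C.kaehler_power_card of_nat_mult_form)
    have "(\<Sum>k\<in>UNIV. f k k $ i $ j) *\<^sub>C C.vol = (if i = j then of_real lam else 0) *\<^sub>C C.vol"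
      unfolding 1[symmetric] HE 2 by simp
    then show ?thesis
      by (simp only: scale_form.scale_cancel_right C.vol_nonzero simp_thms)
  qed
  \<comment> \<open>Subtracting \<lambda>/n from each of the n diagonal coefficients removes the
    trace \<lambda>.\<close>
  define L where "L = complex_of_real (lam / real ?n)"
  define M where "M k l = f k l - (if k = l then mat L else 0)" for k l
  define G where "G = F - mat (L *\<^sub>C K)"
  have matL: "transpose (mat L) ** H = H ** map_matrix cnj (mat L)"
  proof -
    have "transpose (mat L :: complex^'r^'r) = mat L" "map_matrix cnj (mat L :: complex^'r^'r) = mat L"
      by (simp_all add: mat_def transpose_def vec_eq_iff L_def)
    then show ?thesis by (simp add: mat_matrix_mult)
  qed
  have M_herm: "transpose (M k l) ** H = H ** map_matrix cnj (M l k)" for k l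
  proof -
    have "transpose (M k l) = transpose (f k l) - transpose (if k = l then mat L else 0)"
      "map_matrix cnj (M l k) = map_matrix cnj (f l k) - map_matrix cnj (if k = l then mat L else 0)"
      by (simp_all add: M_def vec_eq_iff transpose_def)
    moreover have "transpose (if k = l then mat L else 0) ** H = H ** map_matrix cnj (if k = l then mat L else 0)"
      using matL by (cases "k = l") (simp_all add: transpose_def vec_eq_iff matrix_matrix_mult_def)
    ultimately show ?thesis
      by (simp add: matrix_diff_ldistrib matrix_diff_rdistrib f_herm)
  qed
  have M_trace: "(\<Sum>k\<in>UNIV. M k k $ i $ j) = 0" for i j
    by (simp add: M_def sum_subtractf f_trace) (simp add: mat_def L_def)
  have G_expand: "G $ i $ j = (\<Sum>k\<in>UNIV. \<Sum>l\<in>UNIV. M k l $ i $ j *\<^sub>C C.E k l)" for i j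
  proof -
    have "(\<Sum>k\<in>UNIV. \<Sum>l\<in>UNIV. M k l $ i $ j *\<^sub>C C.E k l) =
        F $ i $ j - (\<Sum>k\<in>UNIV. \<Sum>l\<in>UNIV. if k = l then (mat L :: complex^'r^'r) $ i $ j *\<^sub>C C.E k l else 0)"
      unfolding F_expand sum_subtractf[symmetric]
      by (intro sum.cong refl) (simp add: M_def scale_form.scale_left_diff_distrib)
    also have "\<dots> = F $ i $ j - (mat L :: complex^'r^'r) $ i $ j *\<^sub>C K"
      by (simp add: K scale_form.scale_sum_right)
    finally show ?thesis
      by (simp add: G_def mat_def)
  qed
  obtain x where x: "0 \<le> x" "x = 0 \<Longrightarrow> G = 0"
    "(trace G * trace G + trace (G ** G)) * C.kaehler ^ (?n - 2) =
       complex_of_real (- x * fact (?n - 2)) *\<^sub>C C.vol"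
    by (rule C.primitive_trace[OF H M_herm G_expand M_trace]) (rule that)
  have GK: "G $ i $ j * K ^ (?n - 1) = 0" for i j
    using C.sum_mult_kaehler_power1[of "\<chi> k l. M k l $ i $ j"] M_trace[of i j]
    by (simp add: G_expand K trace_def)
  define P where "P = K ^ (?n - 2)"
  \<comment> \<open>Here n \<ge> 2 keeps the subtraction of natural numbers from being
    truncated.\<close>
  have "?n - 1 = Suc (?n - 2)" "?n = Suc (Suc (?n - 2))"
    using n by simp_all
  then have KP: "K ^ (?n - 1) = K * P" "K ^ ?n = K * (K * P)"
    unfolding P_def by (metis power_Suc)+
  \<comment> \<open>Half of the excess x (n-2)! vol in 2 s, expressed through \<omega>^n = n!
    vol.\<close>
  define y where "y = x * fact (?n - 2) / (2 * fact ?n)"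
  define c where "c = L *\<^sub>C K"
  let ?r = "CARD('r)"
  have vol: "C.vol = (1 / fact ?n) *\<^sub>C K ^ ?n"
    unfolding K by (simp add: C.kaehler_power_card of_nat_mult_form)
  have FG: "F = G + mat c" by (simp add: G_def c_def)
  have trGKP: "trace G * (K * P) = 0"
    unfolding trace_def sum_distrib_right GK[unfolded KP(1)] by simp
  have trF: "trace F = trace G + of_nat ?r * c"
    by (simp add: FG trace_add trace_mat)
  have cc: "c * c * P = (L * L) *\<^sub>C K ^ ?n"
    by (simp add: c_def KP mult_ac)
  have cG: "c * trace G * P = 0"
  proof -
    have "c * trace G * P = L *\<^sub>C (trace G * (K * P))"
      by (simp add: c_def mult_ac)
    then show ?thesis by (simp only: trGKP scale_form.scale_zero_right)
  qed
  \<comment> \<open>The square of the trace contributes 2r and r^2, the trace of the square 2 and r,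
    to the coefficients of c trace G and c^2.\<close>
  have "2 * s * P = (trace G * trace G + trace (G ** G)) * P + of_nat (2 * ?r + 2) * (c * trace G * P) +
      of_nat (?r * ?r + ?r) * (c * c * P)"
    unfolding s trF unfolding FG trace_square_add_mat by (simp add: algebra_simps)
  also have "\<dots> = (of_real (- 2 * y) + (of_nat ?r * of_nat ?r + of_nat ?r) * (L * L)) *\<^sub>C K ^ ?n"
    unfolding cG cc x(3)[folded K, folded P_def] vol
    by (simp only: of_nat_mult_form scale_form.scale_zero_right add_0_right scale_form.scale_scale
        scale_form.scale_left_distrib[symmetric]) (simp add: y_def algebra_simps)
  finally have sP2: "2 * s * P = (of_real (- 2 * y) + (of_nat ?r * of_nat ?r + of_nat ?r) * (L * L)) *\<^sub>C K ^ ?n" .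
  have "s * P = (1 / 2) *\<^sub>C (2 * s * P)"
    using of_nat_mult_form[of 2 "s * P"] by (simp add: mult.assoc)
  then have sP: "s * P = (of_real (- y) + (of_nat ?r * of_nat ?r + of_nat ?r) * (L * L) / 2) *\<^sub>C K ^ ?n"
    unfolding sP2 by (simp add: add_divide_distrib)
  have "trace F * K ^ (?n - 1) = of_nat ?r * (c * (K * P))"
    unfolding trF KP distrib_right trGKP by (simp add: mult.assoc)
  also have "\<dots> = (of_nat ?r * L) *\<^sub>C K ^ ?n"
    by (simp add: of_nat_mult_form c_def KP)
  finally have trFK: "trace F * K ^ (?n - 1) = (of_nat ?r * L) *\<^sub>C K ^ ?n" .
  \<comment> \<open>With L = \<lambda>/n the constant of the theorem is L (r+1)/2. Times r L it
    equals (r^2 + r) L^2 / 2, so only \<open>y\<close> is left.\<close>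
  have "complex_of_real (lam * ((real ?r + 1) / (2 * real ?n))) * (of_nat ?r * L) -
      (of_real (- y) + (of_nat ?r * of_nat ?r + of_nat ?r) * (L * L) / 2) = of_real y"
    by (simp add: L_def divide_simps) (simp add: algebra_simps)
  then have 1: "complex_of_real (lam * ((real ?r + 1) / (2 * real ?n))) *\<^sub>C (trace F * K ^ (?n - 1)) -
      s * K ^ (?n - 2) = of_real y *\<^sub>C K ^ ?n"
    unfolding trFK P_def[symmetric] sP scale_form.scale_scale scale_form.scale_left_diff_distrib[symmetric]
    by simp
  have 2: "of_real y *\<^sub>C K ^ ?n = 0 \<longleftrightarrow> F = mat (L *\<^sub>C K)"
  proof
    assume "of_real y *\<^sub>C K ^ ?n = 0"
    then have "y = 0" by (simp only: K C.scale_kaehler_power_eq_0_iff of_real_eq_0_iff)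
    then have "x = 0" by (simp add: y_def)
    then show "F = mat (L *\<^sub>C K)" using x(2) by (simp add: G_def)
  next
    assume "F = mat (L *\<^sub>C K)"
    then have "G = 0" by (simp add: G_def)
    then have "trace G * trace G + trace (G ** G) = 0" by (simp add: trace_def matrix_matrix_mult_def)
    then have "complex_of_real (- x * fact (?n - 2)) *\<^sub>C C.vol = 0" using x(3) by simp
    then have "x = 0" using C.vol_nonzero by (simp add: scale_form.scale_eq_0_iff)
    then show "of_real y *\<^sub>C K ^ ?n = 0" by (simp add: y_def)
  qed
  show ?thesis
    using that[OF _ 1] 2 x(1) by (simp add: y_def L_def)
qed

section \<open>Second derivatives and derivatives of matrices\<close>

text \<open>The mean value theorem is used twice: in direction \<open>u\<close> for the difference
  of \<open>f\<close> along \<open>v\<close>, then in direction \<open>v\<close> for the derivative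
  \<open>D x u\<close>.\<close>

lemma second_difference_mean_value:
  fixes f :: "'a::real_normed_vector \<Rightarrow> real"
  assumes h: "0 < h"
    and U: "\<And>s t. 0 \<le> s \<Longrightarrow> s \<le> h \<Longrightarrow> 0 \<le> t \<Longrightarrow> t \<le> h \<Longrightarrow> z + s *\<^sub>R u + t *\<^sub>R v \<in> U"
    and D: "\<And>x. x \<in> U \<Longrightarrow> (f has_derivative D x) (at x)"
    and D2: "\<And>x. x \<in> U \<Longrightarrow> ((\<lambda>x. D x u) has_derivative D' x) (at x)"
  obtains s t where "0 < s" "s < h" "0 < t" "t < h"
    "f (z + h *\<^sub>R u + h *\<^sub>R v) - f (z + h *\<^sub>R u) - f (z + h *\<^sub>R v) + f z =
       h * h * D' (z + s *\<^sub>R u + t *\<^sub>R v) v"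
proof -
  have d1: "((\<lambda>s. f (z + s *\<^sub>R u + t *\<^sub>R v)) has_derivative (\<lambda>r. D (z + s *\<^sub>R u + t *\<^sub>R v) (r *\<^sub>R u))) (at s)"
    if "0 \<le> s" "s \<le> h" "0 \<le> t" "t \<le> h" for s t
    by (rule has_derivative_compose[where f="\<lambda>s. z + s *\<^sub>R u + t *\<^sub>R v", OF _ D[OF U[OF that]]])
       (auto intro!: derivative_eq_intros)
  have d2: "((\<lambda>t. D (z + s *\<^sub>R u + t *\<^sub>R v) u) has_derivative (\<lambda>r. D' (z + s *\<^sub>R u + t *\<^sub>R v) (r *\<^sub>R v))) (at t)"
    if "0 \<le> s" "s \<le> h" "0 \<le> t" "t \<le> h" for s t
    by (rule has_derivative_compose[where f="\<lambda>t. z + s *\<^sub>R u + t *\<^sub>R v", OF _ D2[OF U[OF that]]])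
       (auto intro!: derivative_eq_intros)
  define \<phi> where "\<phi> s = f (z + s *\<^sub>R u + h *\<^sub>R v) - f (z + s *\<^sub>R u + 0 *\<^sub>R v)" for s
  have d\<phi>: "(\<phi> has_derivative (\<lambda>r. D (z + s *\<^sub>R u + h *\<^sub>R v) (r *\<^sub>R u) - D (z + s *\<^sub>R u + 0 *\<^sub>R v) (r *\<^sub>R u))) (at s)"
    if "0 \<le> s" "s \<le> h" for s
    unfolding \<phi>_def by (intro has_derivative_diff d1) (use that h in auto)
  have "continuous_on {0..h} \<phi>"
    by (intro has_derivative_continuous_on[of _ _ "\<lambda>s r. D (z + s *\<^sub>R u + h *\<^sub>R v) (r *\<^sub>R u) - D (z + s *\<^sub>R u + 0 *\<^sub>R v) (r *\<^sub>R u)"]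
        has_derivative_at_withinI[OF d\<phi>]) auto
  with h obtain s where s: "0 < s" "s < h"
    "\<phi> h - \<phi> 0 = D (z + s *\<^sub>R u + h *\<^sub>R v) ((h - 0) *\<^sub>R u) - D (z + s *\<^sub>R u + 0 *\<^sub>R v) ((h - 0) *\<^sub>R u)"
    by (rule mvt[where f=\<phi>, OF _ _ d\<phi>]) auto
  have sc: "D x (h *\<^sub>R u) = h * D x u" if "x \<in> U" for x
    using linear_scale[OF has_derivative_linear[OF D[OF that]], of h u] by simp
  have \<phi>1: "\<phi> h - \<phi> 0 = h * (D (z + s *\<^sub>R u + h *\<^sub>R v) u - D (z + s *\<^sub>R u + 0 *\<^sub>R v) u)"
    using s h U[of s h] U[of s 0] by (simp add: sc algebra_simps)
  have c: "continuous_on {0..h} (\<lambda>t. D (z + s *\<^sub>R u + t *\<^sub>R v) u)"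
    by (rule has_derivative_continuous_on[where f'="\<lambda>t r. D' (z + s *\<^sub>R u + t *\<^sub>R v) (r *\<^sub>R v)"])
       (rule has_derivative_at_withinI, rule d2, use s in simp_all)
  have d2s: "((\<lambda>t. D (z + s *\<^sub>R u + t *\<^sub>R v) u) has_derivative (\<lambda>r. D' (z + s *\<^sub>R u + t *\<^sub>R v) (r *\<^sub>R v))) (at t)"
    if "0 < t" "t < h" for t
    by (rule d2) (use s that in auto)
  obtain t where t: "0 < t" "t < h"
    "D (z + s *\<^sub>R u + h *\<^sub>R v) u - D (z + s *\<^sub>R u + 0 *\<^sub>R v) u = D' (z + s *\<^sub>R u + t *\<^sub>R v) ((h - 0) *\<^sub>R v)"
    by (rule mvt[OF h c d2s])
  have "D' (z + s *\<^sub>R u + t *\<^sub>R v) (h *\<^sub>R v) = h * D' (z + s *\<^sub>R u + t *\<^sub>R v) v"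
    using linear_scale[OF has_derivative_linear[OF D2[OF U[of s t]]], of h v] s t by simp
  with t \<phi>1 have "\<phi> h - \<phi> 0 = h * h * D' (z + s *\<^sub>R u + t *\<^sub>R v) v"
    by simp
  with s t show ?thesis
    by (intro that[of s t]) (simp_all add: \<phi>_def algebra_simps)
qed

text \<open>The second difference is symmetric in \<open>u\<close> and \<open>v\<close>. Computed in
  both orders it equals h^2 times each mixed derivative at points near \<open>z\<close>, and
  continuity brings both to \<open>z\<close>.\<close>

lemma mixed_derivatives_symmetric_real:
  fixes f :: "'a::real_normed_vector \<Rightarrow> real"
  assumes U: "open U" "z \<in> U"
    and D: "\<And>x. x \<in> U \<Longrightarrow> (f has_derivative D x) (at x)"
    and Du: "\<And>x. x \<in> U \<Longrightarrow> ((\<lambda>x. D x u) has_derivative Du x) (at x)"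
    and Dv: "\<And>x. x \<in> U \<Longrightarrow> ((\<lambda>x. D x v) has_derivative Dv x) (at x)"
    and cont: "continuous_on U (\<lambda>x. Du x v)" "continuous_on U (\<lambda>x. Dv x u)"
  shows "Du z v = Dv z u"
proof -
  have "dist (Du z v) (Dv z u) \<le> e" if e: "0 < e" for e
  proof -
    obtain r where r: "0 < r" "ball z r \<subseteq> U"
      using U openE by blast
    obtain d1 where d1: "0 < d1" "\<And>x. x \<in> U \<Longrightarrow> dist x z < d1 \<Longrightarrow> dist (Du x v) (Du z v) < e / 2"
      using cont(1) U(2) e unfolding continuous_on_iff by (meson half_gt_zero)
    obtain d2 where d2: "0 < d2" "\<And>x. x \<in> U \<Longrightarrow> dist x z < d2 \<Longrightarrow> dist (Dv x u) (Dv z u) < e / 2"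
      using cont(2) U(2) e unfolding continuous_on_iff by (meson half_gt_zero)
    define d where "d = min r (min d1 d2)"
    have d: "0 < d" "d \<le> r" "d \<le> d1" "d \<le> d2"
      using r d1 d2 by (auto simp: d_def)
    \<comment> \<open>Small enough for the whole parallelogram to stay within distance
      \<open>d\<close> of \<open>z\<close>; the summand 1 gives strictness and covers u = v =
      0.\<close>
    define h where "h = d / (norm u + norm v + 1)"
    have pos: "0 < norm u + norm v + 1"
      using norm_ge_zero[of u] norm_ge_zero[of v] by linarith
    have h: "0 < h" using d pos by (simp add: h_def)
    have near: "dist (z + s *\<^sub>R u + t *\<^sub>R v) z < d" if "0 \<le> s" "s \<le> h" "0 \<le> t" "t \<le> h" for s t
    proof -
      have "dist (z + s *\<^sub>R u + t *\<^sub>R v) z = norm (s *\<^sub>R u + t *\<^sub>R v)"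
        by (simp add: dist_norm add.assoc)
      also have "\<dots> \<le> s * norm u + t * norm v"
        using norm_triangle_ineq[of "s *\<^sub>R u" "t *\<^sub>R v"] that by simp
      also have "\<dots> \<le> h * norm u + h * norm v"
        using that by (intro add_mono mult_right_mono) auto
      also have "\<dots> < h * (norm u + norm v + 1)"
        using h by (simp add: algebra_simps)
      also have "\<dots> = d" using pos by (simp add: h_def)
      finally show ?thesis .
    qed
    have inU: "z + s *\<^sub>R u + t *\<^sub>R v \<in> U" if "0 \<le> s" "s \<le> h" "0 \<le> t" "t \<le> h" for s t
      using near[OF that] d(2) r(2) by (auto simp: dist_commute subset_eq)
    have inU': "z + t *\<^sub>R v + s *\<^sub>R u \<in> U" if "0 \<le> t" "t \<le> h" "0 \<le> s" "s \<le> h" for s t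
      using inU[of s t] that by (simp add: add_ac)
    obtain s t where st: "0 < s" "s < h" "0 < t" "t < h"
      "f (z + h *\<^sub>R u + h *\<^sub>R v) - f (z + h *\<^sub>R u) - f (z + h *\<^sub>R v) + f z = h * h * Du (z + s *\<^sub>R u + t *\<^sub>R v) v"
      by (rule second_difference_mean_value[OF h inU D Du])
    obtain t' s' where st': "0 < t'" "t' < h" "0 < s'" "s' < h"
      "f (z + h *\<^sub>R v + h *\<^sub>R u) - f (z + h *\<^sub>R v) - f (z + h *\<^sub>R u) + f z = h * h * Dv (z + t' *\<^sub>R v + s' *\<^sub>R u) u"
      by (rule second_difference_mean_value[OF h inU' D Dv])
    have "h * h * Du (z + s *\<^sub>R u + t *\<^sub>R v) v = h * h * Dv (z + s' *\<^sub>R u + t' *\<^sub>R v) u"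
    proof -
      have comm: "z + a *\<^sub>R v + b *\<^sub>R u = z + b *\<^sub>R u + a *\<^sub>R v" for a b
        by (simp add: add_ac)
      show ?thesis
        using st(5) st'(5) unfolding comm by linarith
    qed
    then have eq: "Du (z + s *\<^sub>R u + t *\<^sub>R v) v = Dv (z + s' *\<^sub>R u + t' *\<^sub>R v) u"
      using h by simp
    have "dist (Du (z + s *\<^sub>R u + t *\<^sub>R v) v) (Du z v) < e / 2"
    proof (rule d1(2))
      show "z + s *\<^sub>R u + t *\<^sub>R v \<in> U" by (rule inU) (use st in simp_all)
      have "dist (z + s *\<^sub>R u + t *\<^sub>R v) z < d" by (rule near) (use st in simp_all)
      with d show "dist (z + s *\<^sub>R u + t *\<^sub>R v) z < d1" by linarith
    qed
    moreover have "dist (Du (z + s *\<^sub>R u + t *\<^sub>R v) v) (Dv z u) < e / 2"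
      unfolding eq
    proof (rule d2(2))
      show "z + s' *\<^sub>R u + t' *\<^sub>R v \<in> U" by (rule inU) (use st' in simp_all)
      have "dist (z + s' *\<^sub>R u + t' *\<^sub>R v) z < d" by (rule near) (use st' in simp_all)
      with d show "dist (z + s' *\<^sub>R u + t' *\<^sub>R v) z < d2" by linarith
    qed
    ultimately show ?thesis
      using dist_triangle3[of "Du z v" "Dv z u" "Du (z + s *\<^sub>R u + t *\<^sub>R v) v"] by linarith
  qed
  then have "dist (Du z v) (Dv z u) \<le> 0"
    by (rule dense_ge)
  then show ?thesis by simp
qed

lemma Ck_on_2D:
  assumes "Ck_on 2 f U"
  shows "x \<in> U \<Longrightarrow> f differentiable (at x)"
    and "x \<in> U \<Longrightarrow> (\<lambda>x. frechet_derivative f (at x) v) differentiable (at x)"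
    and "continuous_on U (\<lambda>x. frechet_derivative (\<lambda>x. frechet_derivative f (at x) v) (at x) w)"
  using assms by (auto simp: numeral_2_eq_2)

lemma frechet_derivative_eq: "(f has_derivative f') (at x) \<Longrightarrow> frechet_derivative f (at x) = f'"
  using frechet_derivative_at by metis

text \<open>The mean value theorem needs real values, hence the passage through real and imaginary
  parts.\<close>

lemma mixed_derivatives_symmetric:
  fixes f :: "'a::real_normed_vector \<Rightarrow> complex"
  assumes U: "open U" "z \<in> U" and f: "Ck_on 2 f U"
  shows "frechet_derivative (\<lambda>x. frechet_derivative f (at x) v) (at z) u =
    frechet_derivative (\<lambda>x. frechet_derivative f (at x) u) (at z) v"
proof -
  let ?D = "\<lambda>x v. frechet_derivative f (at x) v"
  let ?D2 = "\<lambda>w x. frechet_derivative (\<lambda>x. ?D x w) (at x)"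
  have D: "(f has_derivative ?D x) (at x)" if "x \<in> U" for x
    using Ck_on_2D(1)[OF f that] by (simp add: frechet_derivative_works)
  have D2: "((\<lambda>x. ?D x w) has_derivative ?D2 w x) (at x)" if "x \<in> U" for x w
    using Ck_on_2D(2)[OF f that] by (simp add: frechet_derivative_works)
  have "Re (?D2 u z v) = Re (?D2 v z u)"
    by (rule mixed_derivatives_symmetric_real[OF U, where f="\<lambda>x. Re (f x)" and D="\<lambda>x v. Re (?D x v)"
          and Du="\<lambda>x v. Re (?D2 u x v)" and Dv="\<lambda>x w. Re (?D2 v x w)"])
       (intro bounded_linear.has_derivative[OF bounded_linear_Re] D D2 continuous_intros Ck_on_2D(3)[OF f]; assumption)+
  moreover have "Im (?D2 u z v) = Im (?D2 v z u)"
    by (rule mixed_derivatives_symmetric_real[OF U, where f="\<lambda>x. Im (f x)" and D="\<lambda>x v. Im (?D x v)"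
          and Du="\<lambda>x v. Im (?D2 u x v)" and Dv="\<lambda>x w. Im (?D2 v x w)"])
       (intro bounded_linear.has_derivative[OF bounded_linear_Im] D D2 continuous_intros Ck_on_2D(3)[OF f]; assumption)+
  ultimately show ?thesis by (simp add: complex_eq_iff)
qed

section \<open>Derivatives of vector- and matrix-valued functions\<close>

lemma bounded_linear_axis: "bounded_linear (axis i :: 'b::real_normed_vector \<Rightarrow> 'b^'n)"
proof (rule bounded_linear_intro[where K=1])
  fix x :: 'b
  have "norm (axis i x :: 'b^'n) \<le> (\<Sum>j\<in>UNIV. norm ((axis i x :: 'b^'n) $ j))"
    unfolding norm_vec_def by (rule L2_set_le_sum) simp
  also have "\<dots> = norm x"
    by (simp add: axis_def if_distrib[of norm] cong: if_cong)
  finally show "norm (axis i x :: 'b^'n) \<le> norm x * 1" by simp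
qed (simp_all add: axis_def vec_eq_iff)

lemma has_derivative_vec_iff:
  fixes f :: "'a::real_normed_vector \<Rightarrow> 'b::real_normed_vector^'n"
  shows "(f has_derivative f') F \<longleftrightarrow> (\<forall>i. ((\<lambda>x. f x $ i) has_derivative (\<lambda>h. f' h $ i)) F)"
proof
  assume "(f has_derivative f') F"
  then show "\<forall>i. ((\<lambda>x. f x $ i) has_derivative (\<lambda>h. f' h $ i)) F"
    using bounded_linear.has_derivative[OF bounded_linear_vec_nth] by blast
next
  assume *: "\<forall>i. ((\<lambda>x. f x $ i) has_derivative (\<lambda>h. f' h $ i)) F"
  have "((\<lambda>x. \<Sum>i\<in>UNIV. axis i (f x $ i)) has_derivative (\<lambda>h. \<Sum>i\<in>UNIV. axis i (f' h $ i))) F"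
    by (intro has_derivative_sum bounded_linear.has_derivative[OF bounded_linear_axis]) (use * in auto)
  moreover have "(\<Sum>i\<in>UNIV. axis i (x $ i)) = x" for x :: "'b^'n"
    by (simp add: vec_eq_iff axis_def)
  ultimately show "(f has_derivative f') F" by simp
qed

lemma has_derivative_matrix_iff:
  fixes f :: "'a::real_normed_vector \<Rightarrow> 'b::real_normed_vector^'n^'m"
  shows "(f has_derivative f') F \<longleftrightarrow> (\<forall>i j. ((\<lambda>x. f x $ i $ j) has_derivative (\<lambda>h. f' h $ i $ j)) F)"
  unfolding has_derivative_vec_iff[of f] has_derivative_vec_iff[where 'n='n] ..

lemma frechet_derivative_matrix:
  fixes f :: "'a::real_normed_vector \<Rightarrow> 'b::real_normed_vector^'n^'m"
  assumes "\<And>i j. (\<lambda>x. f x $ i $ j) differentiable (at x)"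
  shows "(f has_derivative frechet_derivative f (at x)) (at x)"
    and "frechet_derivative f (at x) v $ i $ j = frechet_derivative (\<lambda>x. f x $ i $ j) (at x) v"
proof -
  have "(f has_derivative (\<lambda>v. \<chi> i j. frechet_derivative (\<lambda>x. f x $ i $ j) (at x) v)) (at x)"
    using assms by (simp add: has_derivative_matrix_iff frechet_derivative_works)
  from frechet_derivative_eq[OF this] this
  show "(f has_derivative frechet_derivative f (at x)) (at x)"
    "frechet_derivative f (at x) v $ i $ j = frechet_derivative (\<lambda>x. f x $ i $ j) (at x) v"
    by simp_all
qed

lemma differentiable_prod:
  fixes f :: "'i \<Rightarrow> 'a::real_normed_vector \<Rightarrow> 'b::{real_normed_algebra,comm_ring_1}"
  assumes "\<And>i. i \<in> I \<Longrightarrow> f i differentiable (at x)"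
  shows "(\<lambda>x. \<Prod>i\<in>I. f i x) differentiable (at x)"
  using assms by (induction I rule: infinite_finite_induct) (auto intro!: differentiable_mult)

lemma differentiable_det:
  fixes f :: "'a::real_normed_vector \<Rightarrow> 'b::real_normed_field^'n^'n"
  assumes "\<And>i j. (\<lambda>x. f x $ i $ j) differentiable (at x)"
  shows "(\<lambda>x. det (f x)) differentiable (at x)"
  unfolding det_def
  by (rule differentiable_sum, simp, intro ballI, rule differentiable_mult, rule differentiable_const,
      rule differentiable_prod, rule assms)

text \<open>Cramer's quotient of determinants equals the inverse only where the matrix is
  invertible, so invertibility is required on a whole neighbourhood.\<close>

lemma differentiable_matrix_inv_entry:
  fixes f :: "'a::real_normed_vector \<Rightarrow> complex^'n^'n"
  assumes "\<And>i j. (\<lambda>x. f x $ i $ j) differentiable (at x)"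
    and "open U" "x \<in> U" "\<And>y. y \<in> U \<Longrightarrow> invertible (f y)"
  shows "(\<lambda>x. matrix_inv (f x) $ k $ l) differentiable (at x)"
proof -
  have entry: "(\<lambda>x. if j = k then (if i = l then 1 else 0) else f x $ i $ j) differentiable (at x)" for i j
    using assms(1) by (cases "j = k") auto
  have "(\<lambda>x. det (\<chi> i j. if j = k then (if i = l then 1 else 0) else f x $ i $ j) / det (f x)) differentiable (at x)"
    by (intro differentiable_divide differentiable_det assms(1))
       (use entry assms(3,4) in \<open>simp_all add: invertible_det_nz\<close>)
  then obtain D where "((\<lambda>x. det (\<chi> i j. if j = k then (if i = l then 1 else 0) else f x $ i $ j) / det (f x)) has_derivative D) (at x)"
    by (auto simp: differentiable_def)
  then have "((\<lambda>x. matrix_inv (f x) $ k $ l) has_derivative D) (at x)"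
    by (rule has_derivative_transform_within_open[OF _ assms(2,3)]) (simp add: matrix_inv_entry assms(4))
  then show ?thesis by (auto simp: differentiable_def)
qed

section \<open>The curvature of the Chern connection\<close>

lemma linear_matrix_scale:
  fixes d :: "complex^'n \<Rightarrow> complex^'r^'r"
  assumes "linear d"
  shows "d (c *s v) $ i $ j = of_real (Re c) * d v $ i $ j + of_real (Im c) * d (\<i> *s v) $ i $ j"
proof -
  have "d (c *s v) = Re c *\<^sub>R d v + Im c *\<^sub>R d (\<i> *s v)"
    by (simp only: complex_scale_split[of c v] linear_add[OF assms] linear_scale[OF assms])
  then show ?thesis by (simp add: scaleR_conv_of_real[where 'a=complex])
qed

text \<open>
  Compatibility with the metric at \<open>v\<close> and at \<open>i v\<close> determines \<open>A(v)\<^sup>T H = (dH(v) - i dH(i v)) / 2\<close>,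
  i.e. \<open>A\<^sup>T = \<partial>H H\<^sup>-\<^sup>1\<close>.
\<close>

lemma chern_connection_works:
  fixes H :: "complex^'n \<Rightarrow> complex^'r^'r"
  assumes D: "(H has_derivative d) (at z)" and pos: "positive_hermitian (H z)"
    and d_herm: "\<And>v i j. d v $ j $ i = cnj (d v $ i $ j)"
  defines "A \<equiv> chern_connection H z"
  shows "A v = transpose ((\<chi> i j. (d v $ i $ j - \<i> * d (\<i> *s v) $ i $ j) / 2) ** matrix_inv (H z))"
    and "A (u + v) = A u + A v" and "A (c *s v) = map_matrix ((*) c) (A v)"
    and "d v = transpose (A v) ** H z + H z ** map_matrix cnj (A v)"
proof -
  define P where "P v = (\<chi> i j. (d v $ i $ j - \<i> * d (\<i> *s v) $ i $ j) / 2)" for v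
  let ?K = "matrix_inv (H z)"
  have K: "H z ** ?K = mat 1" "?K ** H z = mat 1"
    using invertible_matrix_inv[OF positive_hermitian_invertible[OF pos]] by auto
  have lin: "linear d" using D by (rule has_derivative_linear)
  have fd: "frechet_derivative H (at z) = d" by (rule frechet_derivative_eq[OF D])
  have P_add: "P (u + v) = P u + P v" for u v
    by (simp add: P_def vec_eq_iff linear_add[OF lin] vector_add_ldistrib field_simps)
  have P_scale: "P (c *s v) = map_matrix ((*) c) (P v)" for c v
  proof -
    have "\<i> *s (c *s v) = (\<i> * c) *s v" by (simp add: vec_eq_iff)
    then show ?thesis
      by (simp add: P_def vec_eq_iff linear_matrix_scale[OF lin, of c] linear_matrix_scale[OF lin, of "\<i> * c"])
         (simp add: complex_eq_iff field_simps)
  qed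
  \<comment> \<open>\<open>P\<close> is the (1,0)-part of \<open>d\<close>. Since \<open>d v\<close>
    is Hermitian, the (0,1)-part is its conjugate transpose.\<close>
  have P_sum: "d v = P v + transpose (map_matrix cnj (P v))" for v
  proof -
    have "d v $ i $ j = P v $ i $ j + cnj (P v $ j $ i)" for i j
      using d_herm[of v i j] d_herm[of "\<i> *s v" i j]
      by (simp add: P_def) (simp add: complex_eq_iff field_simps)
    then show ?thesis by (simp add: vec_eq_iff transpose_def)
  qed
  let ?A = "\<lambda>v. transpose (P v ** ?K)"
  have compat: "d v = transpose (?A v) ** H z + H z ** map_matrix cnj (?A v)" for v
  proof -
    have "map_matrix cnj (transpose M) = transpose (map_matrix cnj M)" for M :: "complex^'r^'r"
      by (simp add: transpose_def vec_eq_iff)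
    then have "transpose (H z ** map_matrix cnj (?A v)) = map_matrix cnj (P v ** ?K) ** transpose (H z)"
      by (simp only: matrix_transpose_mul[of "H z"] transpose_transpose)
    also have "\<dots> = map_matrix cnj (P v ** ?K ** H z)"
      using pos by (simp add: positive_hermitian_def map_matrix_cnj_mult)
    also have "\<dots> = map_matrix cnj (P v)"
      by (simp add: K flip: matrix_mul_assoc)
    finally have "H z ** map_matrix cnj (?A v) = transpose (map_matrix cnj (P v))"
      by (metis transpose_transpose)
    moreover have "transpose (?A v) ** H z = P v"
      by (simp add: K flip: matrix_mul_assoc)
    ultimately show ?thesis using P_sum by simp
  qed
  have A_add: "?A (u + v) = ?A u + ?A v" for u v
    by (simp add: P_add matrix_add_rdistrib transpose_def vec_eq_iff)
  have A_scale: "?A (c *s v) = map_matrix ((*) c) (?A v)" for c v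
    by (simp add: P_scale matrix_matrix_mult_def transpose_def vec_eq_iff sum_distrib_left mult_ac)
  have "A = ?A"
    unfolding A_def chern_connection_def fd
  proof (rule the_equality)
    fix A'
    assume A': "(\<forall>u v. A' (u + v) = A' u + A' v) \<and> (\<forall>c v. A' (c *s v) = map_matrix ((*) c) (A' v)) \<and>
      (\<forall>v. d v = transpose (A' v) ** H z + H z ** map_matrix cnj (A' v))"
    show "A' = ?A"
    proof
      fix v
      have 1: "d v = transpose (A' v) ** H z + H z ** map_matrix cnj (A' v)"
        using A' by blast
      have "d (\<i> *s v) = transpose (map_matrix ((*) \<i>) (A' v)) ** H z + H z ** map_matrix cnj (map_matrix ((*) \<i>) (A' v))"
        using A' by metis
      \<comment> \<open>Conjugation turns \<i> into -\<i>, so the conjugate terms cancel in the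
        combination that defines \<open>P\<close>.\<close>
      then have 2: "d (\<i> *s v) $ i $ j = \<i> * (transpose (A' v) ** H z) $ i $ j - \<i> * (H z ** map_matrix cnj (A' v)) $ i $ j" for i j
        by (simp add: matrix_matrix_mult_def transpose_def sum_distrib_left mult_ac sum_negf)
      have "P v $ i $ j = (transpose (A' v) ** H z) $ i $ j" for i j
        unfolding P_def by (simp add: 2) (simp add: 1 algebra_simps)
      then have "P v = transpose (A' v) ** H z" by (simp add: vec_eq_iff)
      then have "P v ** ?K = transpose (A' v)" by (simp add: K flip: matrix_mul_assoc)
      then show "A' v = ?A v" by simp
    qed
  qed (use A_add A_scale compat in blast)
  then have eq: "A v = ?A v" for v by simp
  show "A v = transpose ((\<chi> i j. (d v $ i $ j - \<i> * d (\<i> *s v) $ i $ j) / 2) ** matrix_inv (H z))"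
    unfolding eq P_def ..
  show "A (u + v) = A u + A v" "A (c *s v) = map_matrix ((*) c) (A v)"
    "d v = transpose (A v) ** H z + H z ** map_matrix cnj (A v)"
    unfolding eq by (rule A_add A_scale compat)+
qed

text \<open>\<open>DA v u\<close> stands for the derivative of \<open>A(v)\<close> in the direction \<open>u\<close>.\<close>

lemma curvature_properties:
  fixes A dH :: "complex^'n \<Rightarrow> complex^'r^'r" and DA :: "complex^'n \<Rightarrow> complex^'n \<Rightarrow> complex^'r^'r"
  assumes A_add: "\<And>u v. A (u + v) = A u + A v"
    and A_scale: "\<And>c v. A (c *s v) = map_matrix ((*) c) (A v)"
    and DA_add: "\<And>v w u. DA (v + w) u = DA v u + DA w u"
    and DA_scale: "\<And>c v u. DA (c *s v) u = map_matrix ((*) c) (DA v u)"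
    and DA_linear: "\<And>v. linear (DA v)"
    and inv: "invertible H"
    and compat: "\<And>v. dH v = transpose (A v) ** H + H ** map_matrix cnj (A v)"
    and sym: "\<And>u v. transpose (DA v u) ** H + transpose (A v) ** dH u + dH u ** map_matrix cnj (A v) + H ** map_matrix cnj (DA v u)
      = transpose (DA u v) ** H + transpose (A u) ** dH v + dH v ** map_matrix cnj (A u) + H ** map_matrix cnj (DA u v)"
  defines "B \<equiv> \<lambda>u v. DA v u - DA u v + (A u ** A v - A v ** A u)"
  shows "alternating2 (\<lambda>u v. B u v $ i $ j)"
    and "B (\<i> *s u) (\<i> *s v) = B u v"
    and "transpose (B u v) ** H + H ** map_matrix cnj (B u v) = 0"
proof -
  have scaleR: "r *\<^sub>R w = complex_of_real r *s w" for r and w :: "complex^'n"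
    by (simp add: vec_eq_iff scaleR_conv_of_real[where 'a=complex])
  have mm: "map_matrix ((*) c) M ** N = map_matrix ((*) c) (M ** N)" "M ** map_matrix ((*) c) N = map_matrix ((*) c) (M ** N)"
    for c and M N :: "complex^'r^'r"
    by (simp_all add: matrix_matrix_mult_def vec_eq_iff sum_distrib_left mult_ac)
  have DA_scaleR: "DA v (r *\<^sub>R u) $ i $ j = of_real r * DA v u $ i $ j" for r u v i j
    by (simp add: linear_scale[OF DA_linear] scaleR_conv_of_real[where 'a=complex])
  show "alternating2 (\<lambda>u v. B u v $ i $ j)"
    unfolding alternating2_def bilinear_def linear_complex_iff
  proof (intro conjI allI)
    fix x y u v w r
    show "B x (u + v) $ i $ j = B x u $ i $ j + B x v $ i $ j"
      "B (u + v) y $ i $ j = B u y $ i $ j + B v y $ i $ j"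
      by (simp_all add: B_def DA_add A_add linear_add[OF DA_linear] matrix_add_ldistrib matrix_add_rdistrib)
    show "B x (r *\<^sub>R v) $ i $ j = complex_of_real r * B x v $ i $ j"
      unfolding B_def vector_add_component vector_minus_component DA_scaleR
      by (simp add: scaleR DA_scale A_scale mm algebra_simps)
    show "B (r *\<^sub>R v) y $ i $ j = complex_of_real r * B v y $ i $ j"
      unfolding B_def vector_add_component vector_minus_component DA_scaleR
      by (simp add: scaleR DA_scale A_scale mm algebra_simps)
    show "B v v $ i $ j = 0" by (simp add: B_def)
  qed
  \<comment> \<open>With \<open>compat\<close> inserted for \<open>dH\<close> in \<open>sym\<close>,
    the terms containing both \<open>A\<close> and its conjugate form an expression symmetric in u
    and v and drop out.\<close>
  show herm: "transpose (B u v) ** H + H ** map_matrix cnj (B u v) = 0" for u v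
    using sym[of v u]
    by (simp add: B_def compat transpose_diff transpose_add map_matrix_cnj_diff map_matrix_cnj_add
        map_matrix_cnj_mult matrix_transpose_mul matrix_add_ldistrib matrix_add_rdistrib
        matrix_diff_ldistrib matrix_diff_rdistrib matrix_mul_assoc algebra_simps)
  \<comment> \<open>\<open>T\<close> and \<open>T'\<close> are 4 times the (0,2)- and the (2,0)-part of \<open>B\<close>. The first vanishes because \<open>A\<close> is
    complex linear, and skew-adjointness exchanges the two.\<close>
  define T where "T u v = B u v + map_matrix ((*) \<i>) (B (\<i> *s u) v) + map_matrix ((*) \<i>) (B u (\<i> *s v)) - B (\<i> *s u) (\<i> *s v)" for u v
  define T' where "T' u v = B u v - map_matrix ((*) \<i>) (B (\<i> *s u) v) - map_matrix ((*) \<i>) (B u (\<i> *s v)) - B (\<i> *s u) (\<i> *s v)" for u v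
  have T: "T u v = 0" for u v
    by (simp add: T_def B_def vec_eq_iff DA_scale A_scale mm algebra_simps)
  have T': "T' u v = 0" for u v
  proof -
    have h: "(transpose (B u v) ** H) $ a $ b = - (H ** map_matrix cnj (B u v)) $ a $ b" for u v a b
      using herm[of u v] by (simp add: vec_eq_iff eq_neg_iff_add_eq_0)
    have "(transpose (T' u v) ** H) $ a $ b = (transpose (B u v) ** H) $ a $ b - \<i> * (transpose (B (\<i> *s u) v) ** H) $ a $ b
        - \<i> * (transpose (B u (\<i> *s v)) ** H) $ a $ b - (transpose (B (\<i> *s u) (\<i> *s v)) ** H) $ a $ b" for a b
      by (simp add: T'_def matrix_matrix_mult_def transpose_def algebra_simps sum_subtractf sum.distrib sum_distrib_left)
    moreover have "(H ** map_matrix cnj (T u v)) $ a $ b = (H ** map_matrix cnj (B u v)) $ a $ b - \<i> * (H ** map_matrix cnj (B (\<i> *s u) v)) $ a $ b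
        - \<i> * (H ** map_matrix cnj (B u (\<i> *s v))) $ a $ b - (H ** map_matrix cnj (B (\<i> *s u) (\<i> *s v))) $ a $ b" for a b
      by (simp add: T_def matrix_matrix_mult_def algebra_simps sum_subtractf sum.distrib sum_negf sum_distrib_left)
    ultimately have "(transpose (T' u v) ** H) $ a $ b = - (H ** map_matrix cnj (T u v)) $ a $ b" for a b
      by (simp add: h)
    then have "transpose (T' u v) ** H = 0"
      by (simp add: vec_eq_iff T matrix_matrix_mult_def)
    then have "transpose (T' u v) ** H ** matrix_inv H = 0"
      by (simp add: matrix_matrix_mult_def vec_eq_iff)
    then have "transpose (T' u v) = 0"
      using invertible_matrix_inv[OF inv] by (simp flip: matrix_mul_assoc)
    then show ?thesis by (simp add: vec_eq_iff transpose_def)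
  qed
  have "B u v $ a $ b - B (\<i> *s u) (\<i> *s v) $ a $ b = (T u v $ a $ b + T' u v $ a $ b) / 2" for a b
    by (simp add: T_def T'_def)
  then show "B (\<i> *s u) (\<i> *s v) = B u v"
    by (simp add: T T' vec_eq_iff)
qed

text \<open>The connection is given pointwise by a description, so its differentiability must come
  from the explicit formula in the first derivatives of \<open>H\<close> and the inverse of
  \<open>H\<close>; two derivatives of \<open>H\<close> suffice.\<close>

lemma chern_curvature:
  fixes H :: "complex^'n \<Rightarrow> complex^'r^'r"
  assumes U: "open U" "z \<in> U"
    and Ck: "\<And>i j. Ck_on 2 (\<lambda>y. H y $ i $ j) U"
    and pos: "\<And>y. y \<in> U \<Longrightarrow> positive_hermitian (H y)"
  obtains B :: "complex^'n \<Rightarrow> complex^'n \<Rightarrow> complex^'r^'r"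
  where "connection_curvature (chern_connection H) z = (\<chi> i j. form2 (\<lambda>u v. B u v $ i $ j))"
    "\<And>i j. alternating2 (\<lambda>u v. B u v $ i $ j)"
    "\<And>u v. B (\<i> *s u) (\<i> *s v) = B u v"
    "\<And>u v. transpose (B u v) ** H z + H z ** map_matrix cnj (B u v) = 0"
proof -
  define d where "d y v = (\<chi> i j. frechet_derivative (\<lambda>x. H x $ i $ j) (at y) v)" for y v
  have H_diff: "(\<lambda>x. H x $ i $ j) differentiable (at y)" if "y \<in> U" for i j y
    by (rule Ck_on_2D(1)[OF Ck that])
  have Hij: "((\<lambda>x. H x $ i $ j) has_derivative (\<lambda>v. d y v $ i $ j)) (at y)" if "y \<in> U" for y i j
    using H_diff[OF that, of i j] by (simp add: d_def frechet_derivative_works)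
  have D: "(H has_derivative d y) (at y)" if "y \<in> U" for y
    using Hij[OF that] by (simp add: has_derivative_matrix_iff)
  have d_herm: "d y v $ j $ i = cnj (d y v $ i $ j)" if "y \<in> U" for y v i j
  proof -
    have "((\<lambda>x. cnj (H x $ i $ j)) has_derivative (\<lambda>v. cnj (d y v $ i $ j))) (at y)"
      by (rule bounded_linear.has_derivative[OF bounded_linear_cnj Hij[OF that]])
    then have "((\<lambda>x. H x $ j $ i) has_derivative (\<lambda>v. cnj (d y v $ i $ j))) (at y)"
    proof (rule has_derivative_transform_within_open[OF _ U(1) that])
      fix x assume "x \<in> U"
      then have "transpose (H x) $ i $ j = map_matrix cnj (H x) $ i $ j"
        using pos by (simp only: positive_hermitian_def)
      then show "cnj (H x $ i $ j) = H x $ j $ i"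
        by (simp only: transpose_def vec_lambda_beta nth_map_matrix)
    qed
    from has_derivative_unique[OF this Hij[OF that]] show ?thesis by (auto simp: fun_eq_iff)
  qed
  let ?C = "chern_connection H"
  note C = chern_connection_works[OF D pos d_herm]
  define A where "A y v = transpose ((\<chi> i j. (d y v $ i $ j - \<i> * d y (\<i> *s v) $ i $ j) / 2) ** matrix_inv (H y))" for y v
  have CA: "?C y v = A y v" if "y \<in> U" for y v
    unfolding A_def by (rule C(1)) (use that in auto)
  have A_diff: "(\<lambda>y. A y v $ i $ j) differentiable (at z)" for v i j
    unfolding A_def
    by (simp add: transpose_def matrix_matrix_mult_def d_def)
       (intro differentiable_sum ballI differentiable_mult differentiable_divide differentiable_diff differentiable_const
          Ck_on_2D(2)[OF Ck U(2)] differentiable_matrix_inv_entry[OF _ U] H_diff[OF U(2)] positive_hermitian_invertible[OF pos]; simp)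
  define DA where "DA v = frechet_derivative (\<lambda>y. ?C y v) (at z)" for v
  have C_deriv: "((\<lambda>y. ?C y v) has_derivative DA v) (at z)" for v
  proof -
    have "((\<lambda>y. A y v) has_derivative frechet_derivative (\<lambda>y. A y v) (at z)) (at z)"
      by (rule frechet_derivative_matrix(1)) (rule A_diff)
    then have "((\<lambda>y. ?C y v) has_derivative frechet_derivative (\<lambda>y. A y v) (at z)) (at z)"
      by (rule has_derivative_transform_within_open[OF _ U]) (rule CA[symmetric])
    from frechet_derivative_eq[OF this] this show ?thesis
      by (simp only: DA_def)
  qed
  then have C_deriv_entry: "((\<lambda>y. ?C y v $ i $ j) has_derivative (\<lambda>u. DA v u $ i $ j)) (at z)" for v i j
    by (simp add: has_derivative_matrix_iff)
  \<comment> \<open>Identities for the connection on the open set \<open>U\<close> pass to its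
    derivative at \<open>z\<close>, because derivatives are unique.\<close>
  have DA_unique: "DA v = D'" if "((\<lambda>y. G y) has_derivative D') (at z)" "\<And>y. y \<in> U \<Longrightarrow> G y = ?C y v" for v D' G
    using has_derivative_unique[OF C_deriv has_derivative_transform_within_open[OF that(1) U that(2)]] .
  have DA_add: "DA (v + w) u = DA v u + DA w u" for v w u
    using DA_unique[OF has_derivative_add[OF C_deriv[of v] C_deriv[of w]], of "v + w"] C(2) by simp
  have DA_scale: "DA (c *s v) u = map_matrix ((*) c) (DA v u)" for c v u
  proof -
    have "((\<lambda>y. map_matrix ((*) c) (?C y v)) has_derivative (\<lambda>u. map_matrix ((*) c) (DA v u))) (at z)"
      unfolding has_derivative_matrix_iff using has_derivative_mult_right[OF C_deriv_entry] by simp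
    from DA_unique[OF this, of "c *s v"] show ?thesis using C(3) by simp
  qed
  \<comment> \<open>The product rule applied to the compatibility equation expresses the second
    derivatives of \<open>H\<close> by the connection and its derivative.\<close>
  have second: "frechet_derivative (\<lambda>y. d y v $ i $ j) (at z) u =
      (transpose (DA v u) ** H z + transpose (?C z v) ** d z u + d z u ** map_matrix cnj (?C z v) + H z ** map_matrix cnj (DA v u)) $ i $ j"
    for u v i j
  proof -
    have "((\<lambda>y. (\<Sum>k\<in>UNIV. ?C y v $ k $ i * H y $ k $ j) + (\<Sum>k\<in>UNIV. H y $ i $ k * cnj (?C y v $ k $ j))) has_derivative
        (\<lambda>u. (\<Sum>k\<in>UNIV. ?C z v $ k $ i * d z u $ k $ j + DA v u $ k $ i * H z $ k $ j) +
             (\<Sum>k\<in>UNIV. H z $ i $ k * cnj (DA v u $ k $ j) + d z u $ i $ k * cnj (?C z v $ k $ j)))) (at z)"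
      by (intro has_derivative_add has_derivative_sum has_derivative_mult C_deriv_entry Hij[OF U(2)]
          bounded_linear.has_derivative[OF bounded_linear_cnj])
    then have "((\<lambda>y. d y v $ i $ j) has_derivative
        (\<lambda>u. (\<Sum>k\<in>UNIV. ?C z v $ k $ i * d z u $ k $ j + DA v u $ k $ i * H z $ k $ j) +
             (\<Sum>k\<in>UNIV. H z $ i $ k * cnj (DA v u $ k $ j) + d z u $ i $ k * cnj (?C z v $ k $ j)))) (at z)"
    proof (rule has_derivative_transform_within_open[OF _ U])
      fix y assume y: "y \<in> U"
      have "d y v = transpose (?C y v) ** H y + H y ** map_matrix cnj (?C y v)"
        by (rule C(4)[OF y y y])
      then show "(\<Sum>k\<in>UNIV. ?C y v $ k $ i * H y $ k $ j) + (\<Sum>k\<in>UNIV. H y $ i $ k * cnj (?C y v $ k $ j)) = d y v $ i $ j"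
        by (simp add: matrix_matrix_mult_def transpose_def)
    qed
    from frechet_derivative_eq[OF this] show ?thesis
      by (simp add: matrix_matrix_mult_def transpose_def sum.distrib algebra_simps)
  qed
  have sym: "transpose (DA v u) ** H z + transpose (?C z v) ** d z u + d z u ** map_matrix cnj (?C z v) + H z ** map_matrix cnj (DA v u)
      = transpose (DA u v) ** H z + transpose (?C z u) ** d z v + d z v ** map_matrix cnj (?C z u) + H z ** map_matrix cnj (DA u v)" for u v
  proof -
    have "frechet_derivative (\<lambda>y. d y v $ i $ j) (at z) u = frechet_derivative (\<lambda>y. d y u $ i $ j) (at z) v" for i j
      unfolding d_def vec_lambda_beta by (rule mixed_derivatives_symmetric[OF U Ck])
    then show ?thesis
      unfolding second vec_eq_iff by blast
  qed
  define B where "B u v = DA v u - DA u v + (?C z u ** ?C z v - ?C z v ** ?C z u)" for u v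
  note props = curvature_properties[where A="?C z" and DA=DA and dH="d z" and H="H z",
      OF C(2)[OF U(2) U(2) U(2)] C(3)[OF U(2) U(2) U(2)] DA_add DA_scale has_derivative_linear[OF C_deriv]
        positive_hermitian_invertible[OF pos[OF U(2)]] C(4)[OF U(2) U(2) U(2)] sym, folded B_def]
  show ?thesis
  proof (rule that[of B])
    show "connection_curvature ?C z = (\<chi> i j. form2 (\<lambda>u v. B u v $ i $ j))"
      by (simp add: connection_curvature_def Let_def B_def DA_def)
  qed (use props in blast)+
qed

section \<open>Bundles over manifolds\<close>

text \<open>Justifies the description in \<open>frame_vector\<close>: a trivialization is bijective
  over its domain.\<close>

lemma trivialization_unique_vector:
  assumes "holomorphic_vector_bundle X \<A> E" "a \<in> trivs E" "p \<in> fst a"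
  shows "\<exists>!e. e \<in> topspace (total E) \<and> proj E e = p \<and> snd a e = x"
proof -
  have "openin X (fst a)" and hom: "homeomorphic_map (subtopology (total E) (part_over E (fst a)))
      (prod_topology (subtopology X (fst a)) euclidean) (\<lambda>e. (proj E e, snd a e))"
    using assms unfolding holomorphic_vector_bundle_def by blast+
  then have "topspace (subtopology X (fst a)) = fst a"
    using openin_subset by fastforce
  moreover have "topspace (subtopology (total E) (part_over E (fst a))) = part_over E (fst a)"
    by (auto simp: part_over_def)
  ultimately have inj: "inj_on (\<lambda>e. (proj E e, snd a e)) (part_over E (fst a))"
    and surj: "(\<lambda>e. (proj E e, snd a e)) ` part_over E (fst a) = fst a \<times> UNIV"
    using homeomorphic_imp_injective_map[OF hom] homeomorphic_imp_surjective_map[OF hom] by simp_all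
  have "(p, x) \<in> (\<lambda>e. (proj E e, snd a e)) ` part_over E (fst a)"
    using surj assms(3) by simp
  then obtain e where "e \<in> part_over E (fst a)" "proj E e = p" "snd a e = x"
    by auto
  then show ?thesis
    using inj assms(3) by (intro ex1I[of _ e]) (auto simp: part_over_def inj_on_def)
qed

text \<open>Every coordinate vector belongs to some vector of the fibre, so positivity of
  \<open>h\<close> passes to the matrix.\<close>

lemma positive_hermitian_gram_matrix:
  fixes E :: "('e, 'm, 'r::finite) vbundle"
  assumes E: "holomorphic_vector_bundle X \<A> E" and h: "hermitian_metric \<A> E h"
    and a: "a \<in> trivs E" "p \<in> fst a"
  shows "positive_hermitian (gram_matrix E h a p)"
proof -
  have frame: "frame_vector E a j p \<in> topspace (total E)" "proj E (frame_vector E a j p) = p" for j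
    using theI'[OF trivialization_unique_vector[OF E a]] by (auto simp: frame_vector_def)
  have "\<forall>e\<in>topspace (total E). \<forall>e'\<in>topspace (total E). proj E e = proj E e' \<longrightarrow> h e' e = cnj (h e e')"
    using h unfolding hermitian_metric_def by blast
  then have h_sym: "h (frame_vector E a k p) (frame_vector E a j p) = cnj (h (frame_vector E a j p) (frame_vector E a k p))" for j k
    using frame by metis
  have "transpose (gram_matrix E h a p) $ k $ j = map_matrix cnj (gram_matrix E h a p) $ k $ j" for j k
    by (simp only: transpose_def gram_matrix_def vec_lambda_beta nth_map_matrix) (rule h_sym)
  then have "transpose (gram_matrix E h a p) = map_matrix cnj (gram_matrix E h a p)"
    by (simp add: vec_eq_iff)
  moreover have "0 < Re (sesquilinear_of (gram_matrix E h a p) x x)" if "x \<noteq> 0" for x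
  proof -
    obtain e where e: "e \<in> topspace (total E)" "proj E e = p" "snd a e = x"
      using trivialization_unique_vector[OF E a] by blast
    then have part: "e \<in> part_over E (fst a)"
      using a by (simp add: part_over_def)
    have "\<forall>e\<in>part_over E (fst a). \<forall>e'\<in>part_over E (fst a). proj E e = proj E e' \<longrightarrow>
        h e e' = (\<Sum>j\<in>UNIV. \<Sum>k\<in>UNIV. gram_matrix E h a (proj E e) $ j $ k * snd a e $ j * cnj (snd a e' $ k))"
      using h a(1) unfolding hermitian_metric_def by blast
    then have "h e e = (\<Sum>j\<in>UNIV. \<Sum>k\<in>UNIV. gram_matrix E h a (proj E e) $ j $ k * snd a e $ j * cnj (snd a e $ k))"
      using part by blast
    then have "h e e = sesquilinear_of (gram_matrix E h a p) x x"
      by (simp only: e sesquilinear_of_def)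
    moreover have "\<forall>e\<in>part_over E (fst a). snd a e \<noteq> 0 \<longrightarrow> 0 < Re (h e e)"
      using h a(1) unfolding hermitian_metric_def by blast
    ultimately show ?thesis
      using part e that by metis
  qed
  ultimately show ?thesis
    by (simp add: positive_hermitian_def)
qed

text \<open>The two facts needed for calculus with \<open>in_chart\<close>: the chart can be
  inverted, and overlaps with trivializing sets have open images.\<close>

lemma chart_homeomorphism:
  assumes "compact_complex_manifold X \<A>" "c \<in> \<A>"
  shows "inj_on (snd c) (fst c)" and "openin X V \<Longrightarrow> open (snd c ` (fst c \<inter> V))"
proof -
  have c: "openin X (fst c)" "open (snd c ` fst c)"
    and hom: "homeomorphic_map (subtopology X (fst c)) (top_of_set (snd c ` fst c)) (snd c)"
    using assms unfolding compact_complex_manifold_def by blast+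
  have "topspace (subtopology X (fst c)) = fst c"
    using openin_subset[OF c(1)] by auto
  then show "inj_on (snd c) (fst c)"
    using homeomorphic_imp_injective_map[OF hom] by simp
  show "open (snd c ` (fst c \<inter> V))" if "openin X V"
  proof -
    have "openin (subtopology X (fst c)) (fst c \<inter> V)"
      using that by (simp add: openin_subtopology_Int2)
    then have "openin (top_of_set (snd c ` fst c)) (snd c ` (fst c \<inter> V))"
      using homeomorphic_imp_open_map[OF hom] by (simp add: open_map_def)
    then show ?thesis
      using c(2) openin_open_trans by blast
  qed
qed

lemma curvature_in_frame:
  fixes E :: "('e, 'm, 'r::finite) vbundle" and \<A> :: "('m, 'n::finite) chart set"
  assumes X: "compact_complex_manifold X \<A>" and E: "holomorphic_vector_bundle X \<A> E"
    and h: "hermitian_metric \<A> E h" and c: "c \<in> \<A>" and a: "a \<in> trivs E" and p: "p \<in> fst c \<inter> fst a"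
  obtains B :: "complex^'n \<Rightarrow> complex^'n \<Rightarrow> complex^'r^'r"
  where "curvature E h c a p = (\<chi> i j. form2 (\<lambda>u v. B u v $ i $ j))"
    "\<And>i j. alternating2 (\<lambda>u v. B u v $ i $ j)"
    "\<And>u v. B (\<i> *s u) (\<i> *s v) = B u v"
    "\<And>u v. transpose (B u v) ** gram_matrix E h a p + gram_matrix E h a p ** map_matrix cnj (B u v) = 0"
proof -
  let ?H = "in_chart c (gram_matrix E h a)"
  let ?U = "snd c ` (fst c \<inter> fst a)"
  have inv: "the_inv_into (fst c) (snd c) (snd c q) = q" if "q \<in> fst c" for q
    using the_inv_into_f_f[OF chart_homeomorphism(1)[OF X c] that] .
  have "openin X (fst a)"
    using E a unfolding holomorphic_vector_bundle_def by blast
  then have U: "open ?U" "snd c p \<in> ?U"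
    using chart_homeomorphism(2)[OF X c] p by auto
  have Hp: "?H (snd c p) = gram_matrix E h a p"
    using p by (simp add: in_chart_def inv)
  have Ck: "Ck_on 2 (\<lambda>y. ?H y $ i $ j) ?U" for i j
  proof -
    have "smooth_fun_on (in_chart c (\<lambda>p. gram_matrix E h a p $ i $ j)) ?U"
      using h a c unfolding hermitian_metric_def by blast
    moreover have "in_chart c (\<lambda>p. gram_matrix E h a p $ i $ j) = (\<lambda>y. ?H y $ i $ j)"
      by (simp add: in_chart_def fun_eq_iff)
    ultimately show ?thesis by (simp only: smooth_fun_on_def)
  qed
  have pos: "positive_hermitian (?H y)" if "y \<in> ?U" for y
    using that positive_hermitian_gram_matrix[OF E h a] by (auto simp: in_chart_def inv)
  show ?thesis
    by (rule chern_curvature[OF U Ck pos, unfolded Hp], assumption)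
       (rule that, unfold curvature_def, assumption+)
qed

lemma chern_forms_trace:
  fixes E :: "('e, 'm, 'r::finite) vbundle" and c :: "('m, 'n::finite) chart"
    and h :: "'e \<Rightarrow> 'e \<Rightarrow> complex" and a :: "'m set \<times> ('e \<Rightarrow> complex^'r)" and p :: 'm
  defines "F \<equiv> map_matrix (\<lambda>\<theta>. (\<i> / (2 * pi)) *\<^sub>C \<theta>) (curvature E h c a p)"
  shows "chern_form E h c a 1 p = trace F"
    and "2 * segre_form2 E h c a p = trace F * trace F + trace (F ** F)"
proof -
  have "mat 1 + map_matrix (\<lambda>\<theta>. monom ((\<i> / (2 * pi)) *\<^sub>C \<theta>) 1) (curvature E h c a p) =
      (\<chi> i j. [:if i = j then 1 else 0, F $ i $ j:])"
    by (simp add: vec_eq_iff mat_def F_def monom_altdef monom_Suc one_pCons)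
  then have c: "chern_form E h c a k p = coeff (det (\<chi> i j. [:if i = j then 1 else 0, F $ i $ j:])) k" for k
    by (simp only: chern_form_def)
  show 1: "chern_form E h c a 1 p = trace F"
    unfolding c by (rule coeff_det_one_plus)
  have 2: "2 * chern_form E h c a 2 p = trace F * trace F - trace (F ** F)"
    unfolding c by (rule coeff_det_one_plus)
  show "2 * segre_form2 E h c a p = trace F * trace F + trace (F ** F)"
    unfolding segre_form2_def 1 right_diff_distrib 2 by (simp add: algebra_simps)
qed

text \<open>One number \<open>x\<close> measures the gap in the inequality and decides equality, so
  both halves of the theorem can be read off from it.\<close>

lemma segre_inequality_at_point:
  fixes \<A> :: "('m, 'n::finite) chart set" and E :: "('e, 'm, 'r::finite) vbundle" and lam :: real
  assumes X: "compact_complex_manifold X \<A>" and n: "2 \<le> CARD('n)" and \<omega>: "kaehler_metric \<A> \<omega>"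
    and E: "holomorphic_vector_bundle X \<A> E" and h: "hermitian_metric \<A> E h"
    and HE: "hermite_einstein \<A> \<omega> E h lam"
    and c: "c \<in> \<A>" and a: "a \<in> trivs E" and p: "p \<in> fst c \<inter> fst a"
  obtains x :: real where "0 \<le> x"
    "complex_of_real (lam * ((real CARD('r) + 1) / (2 * real CARD('n)))) *\<^sub>C
       (chern_form E h c a 1 p * kaehler_form \<omega> c p ^ (CARD('n) - 1)) -
     segre_form2 E h c a p * kaehler_form \<omega> c p ^ (CARD('n) - 2) =
       complex_of_real x *\<^sub>C kaehler_form \<omega> c p ^ CARD('n)"
    "complex_of_real x *\<^sub>C kaehler_form \<omega> c p ^ CARD('n) = 0 \<longleftrightarrow>
       map_matrix (\<lambda>\<theta>. (\<i> / (2 * pi)) *\<^sub>C \<theta>) (curvature E h c a p) =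
         mat (complex_of_real (lam / real CARD('n)) *\<^sub>C kaehler_form \<omega> c p)"
proof -
  let ?c = "\<i> / (2 * pi)" and ?H = "gram_matrix E h a p"
  let ?F = "map_matrix (\<lambda>\<theta>. ?c *\<^sub>C \<theta>) (curvature E h c a p)"
  obtain B :: "complex^'n \<Rightarrow> complex^'n \<Rightarrow> complex^'r^'r" where
    B: "curvature E h c a p = (\<chi> i j. form2 (\<lambda>u v. B u v $ i $ j))"
      "\<And>i j. alternating2 (\<lambda>u v. B u v $ i $ j)"
      "\<And>u v. B (\<i> *s u) (\<i> *s v) = B u v"
      "\<And>u v. transpose (B u v) ** ?H + ?H ** map_matrix cnj (B u v) = 0"
    by (rule curvature_in_frame[OF X E h c a p]) (rule that)
  define B' where "B' u v = map_matrix ((*) ?c) (B u v)" for u v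
  have F: "?F = (\<chi> i j. form2 (\<lambda>u v. B' u v $ i $ j))"
    by (simp only: vec_eq_iff B(1) B'_def nth_map_matrix vec_lambda_beta form2_scale[OF B(2)] simp_thms)
  have B'_alt: "alternating2 (\<lambda>u v. B' u v $ i $ j)" for i j
    by (simp only: B'_def nth_map_matrix) (rule alternating2_scale[OF B(2)])
  have B'_type11: "B' (\<i> *s u) (\<i> *s v) = B' u v" for u v
    by (simp only: B'_def B(3))
  \<comment> \<open>The factor i/(2\<pi>) is purely imaginary and so turns skew-adjointness into
    self-adjointness.\<close>
  have B'_herm: "transpose (B' u v) ** ?H = ?H ** map_matrix cnj (B' u v)" for u v
  proof -
    have h: "(transpose (B u v) ** ?H) $ i $ j = - (?H ** map_matrix cnj (B u v)) $ i $ j" for i j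
      using B(4)[of u v] by (simp add: vec_eq_iff eq_neg_iff_add_eq_0)
    have "(transpose (B' u v) ** ?H) $ i $ j = ?c * (transpose (B u v) ** ?H) $ i $ j"
      "(?H ** map_matrix cnj (B' u v)) $ i $ j = - ?c * (?H ** map_matrix cnj (B u v)) $ i $ j" for i j
      unfolding matrix_matrix_mult_def
      by (simp_all add: B'_def transpose_def sum_distrib_left mult_ac sum_negf)
    then show ?thesis by (simp add: vec_eq_iff h)
  qed
  have HE': "?F $ i $ j * ((1 / fact (CARD('n) - 1)) *\<^sub>C kaehler_form \<omega> c p ^ (CARD('n) - 1)) =
      (if i = j then complex_of_real lam *\<^sub>C (1 / fact CARD('n)) *\<^sub>C kaehler_form \<omega> c p ^ CARD('n) else 0)" for i j
  proof -
    have "map_matrix (\<lambda>\<theta>. (?c *\<^sub>C \<theta>) * ((1 / fact (CARD('n) - 1)) *\<^sub>C kaehler_form \<omega> c p ^ (CARD('n) - 1))) (curvature E h c a p) $ i $ j =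
      mat (complex_of_real lam *\<^sub>C (1 / fact CARD('n)) *\<^sub>C kaehler_form \<omega> c p ^ CARD('n)) $ i $ j"
      using HE c a p unfolding hermite_einstein_def by metis
    then show ?thesis by (simp only: nth_map_matrix mat_def vec_lambda_beta)
  qed
  have p': "p \<in> fst c" using p by simp
  note k = \<omega>[unfolded kaehler_metric_def]
  note w = conjunct1[OF k, rule_format, OF c p'] conjunct1[OF conjunct2[OF k], rule_format, OF c p']
    conjunct1[OF conjunct2[OF conjunct2[OF k]], rule_format, OF c p']
  have H: "positive_hermitian ?H"
    by (rule positive_hermitian_gram_matrix[OF E h a]) (use p in simp)
  show ?thesis
    by (rule hermite_einstein_pointwise[OF n conjunct1[OF w(1)] spec[OF conjunct2[OF w(1)]] w(2,3) H B'_alt B'_type11 B'_herm F HE'[unfolded kaehler_form_def]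
          chern_forms_trace(2), folded kaehler_form_def chern_forms_trace(1)],
        assumption) (rule that)
qed

theorem theorem1p2:
  fixes X :: "'m topology"
    and \<A> :: "('m, 'n::finite) chart set"
    and \<omega> :: "('m, 'n) chart \<Rightarrow> 'm \<Rightarrow> complex^'n \<Rightarrow> complex^'n \<Rightarrow> real"
    and E :: "('e, 'm, 'r::finite) vbundle"
    and h :: "'e \<Rightarrow> 'e \<Rightarrow> complex"
    and lam :: real
  assumes "compact_complex_manifold X \<A>"
    and "2 \<le> CARD('n)"
    and "kaehler_metric \<A> \<omega>"
    and "holomorphic_vector_bundle X \<A> E"
    and "hermitian_metric \<A> E h"
    and "hermite_einstein \<A> \<omega> E h lam"
  shows
    "(\<forall>c\<in>\<A>. \<forall>a\<in>trivs E. \<forall>p\<in>fst c \<inter> fst a.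
        form_le (kaehler_form \<omega> c p ^ CARD('n))
          (segre_form2 E h c a p * kaehler_form \<omega> c p ^ (CARD('n) - 2))
          (complex_of_real (lam * ((real CARD('r) + 1) / (2 * real CARD('n)))) *\<^sub>C
             (chern_form E h c a 1 p * kaehler_form \<omega> c p ^ (CARD('n) - 1))))
     \<and>
     ((\<forall>c\<in>\<A>. \<forall>a\<in>trivs E. \<forall>p\<in>fst c \<inter> fst a.
        segre_form2 E h c a p * kaehler_form \<omega> c p ^ (CARD('n) - 2) =
        complex_of_real (lam * ((real CARD('r) + 1) / (2 * real CARD('n)))) *\<^sub>C
          (chern_form E h c a 1 p * kaehler_form \<omega> c p ^ (CARD('n) - 1)))
      \<longleftrightarrow>
      (\<forall>c\<in>\<A>. \<forall>a\<in>trivs E. \<forall>p\<in>fst c \<inter> fst a.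
        map_matrix (\<lambda>\<theta>. (\<i> / (2 * pi)) *\<^sub>C \<theta>) (curvature E h c a p) =
        mat (complex_of_real (lam / real CARD('n)) *\<^sub>C kaehler_form \<omega> c p)))
     \<and>
     ((\<forall>c\<in>\<A>. \<forall>a\<in>trivs E. \<forall>p\<in>fst c \<inter> fst a.
        segre_form2 E h c a p * kaehler_form \<omega> c p ^ (CARD('n) - 2) =
        complex_of_real (lam * ((real CARD('r) + 1) / (2 * real CARD('n)))) *\<^sub>C
          (chern_form E h c a 1 p * kaehler_form \<omega> c p ^ (CARD('n) - 1)))
      \<longrightarrow>
      (\<forall>c\<in>\<A>. \<forall>a\<in>trivs E. \<forall>p\<in>fst c \<inter> fst a.
        map_matrix (\<lambda>\<theta>. (\<i> / (2 * pi)) *\<^sub>C \<theta>) (curvature E h c a p) =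
          mat (complex_of_real (1 / real CARD('r)) *\<^sub>C chern_form E h c a 1 p) \<and>
        chern_form E h c a 1 p = complex_of_real (lam * (real CARD('r) / real CARD('n))) *\<^sub>C kaehler_form \<omega> c p))"
proof -
  let ?coef = "complex_of_real (lam * ((real CARD('r) + 1) / (2 * real CARD('n))))"
  let ?lhs = "\<lambda>c a p. segre_form2 E h c a p * kaehler_form \<omega> c p ^ (CARD('n) - 2)"
  let ?rhs = "\<lambda>c a p. ?coef *\<^sub>C (chern_form E h c a 1 p * kaehler_form \<omega> c p ^ (CARD('n) - 1))"
  let ?F = "\<lambda>c a p. map_matrix (\<lambda>\<theta>. (\<i> / (2 * pi)) *\<^sub>C \<theta>) (curvature E h c a p)"
  let ?einstein = "\<lambda>c a p. ?F c a p = mat (complex_of_real (lam / real CARD('n)) *\<^sub>C kaehler_form \<omega> c p)"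
  \<comment> \<open>The equality criterion holds at each point separately, which is more than the
    equivalence of the two global identities.\<close>
  have point: "form_le (kaehler_form \<omega> c p ^ CARD('n)) (?lhs c a p) (?rhs c a p)"
    "?lhs c a p = ?rhs c a p \<longleftrightarrow> ?einstein c a p"
    if at: "c \<in> \<A>" "a \<in> trivs E" "p \<in> fst c \<inter> fst a" for c a p
  proof -
    obtain x :: real where x: "0 \<le> x"
      "?rhs c a p - ?lhs c a p = complex_of_real x *\<^sub>C kaehler_form \<omega> c p ^ CARD('n)"
      "complex_of_real x *\<^sub>C kaehler_form \<omega> c p ^ CARD('n) = 0 \<longleftrightarrow> ?einstein c a p"
      by (rule segre_inequality_at_point[OF assms at]) (rule that)
    show "form_le (kaehler_form \<omega> c p ^ CARD('n)) (?lhs c a p) (?rhs c a p)"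
      unfolding form_le_def by (intro exI[of _ x] conjI x(1,2))
    show "?lhs c a p = ?rhs c a p \<longleftrightarrow> ?einstein c a p"
      unfolding x(3)[symmetric] x(2)[symmetric] right_minus_eq by (rule eq_commute)
  qed
  \<comment> \<open>The trace of the identity gives c_1 = \<lambda> r/n \<omega>; dividing by r and
    inserting this back yields projective flatness.\<close>
  have flat: "?F c a p = mat (complex_of_real (1 / real CARD('r)) *\<^sub>C chern_form E h c a 1 p) \<and>
      chern_form E h c a 1 p = complex_of_real (lam * (real CARD('r) / real CARD('n))) *\<^sub>C kaehler_form \<omega> c p"
    if "?einstein c a p" for c a p
  proof -
    have "chern_form E h c a 1 p = trace (?F c a p)"
      by (rule chern_forms_trace(1))
    also have "\<dots> = trace (mat (complex_of_real (lam / real CARD('n)) *\<^sub>C kaehler_form \<omega> c p) ::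
        (complex^'n) even_form^'r^'r)"
      by (rule arg_cong[OF that])
    also have "\<dots> = complex_of_real (lam * (real CARD('r) / real CARD('n))) *\<^sub>C kaehler_form \<omega> c p"
      by (simp add: trace_mat of_nat_mult_form mult.commute)
    finally have c1: "chern_form E h c a 1 p =
        complex_of_real (lam * (real CARD('r) / real CARD('n))) *\<^sub>C kaehler_form \<omega> c p" .
    show ?thesis
    proof
      show "?F c a p = mat (complex_of_real (1 / real CARD('r)) *\<^sub>C chern_form E h c a 1 p)"
        unfolding c1 by (rule trans[OF that]) simp
    qed (rule c1)
  qed
  have eq: "(\<forall>c\<in>\<A>. \<forall>a\<in>trivs E. \<forall>p\<in>fst c \<inter> fst a. ?lhs c a p = ?rhs c a p) \<longleftrightarrow>
      (\<forall>c\<in>\<A>. \<forall>a\<in>trivs E. \<forall>p\<in>fst c \<inter> fst a. ?einstein c a p)"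
    by (intro ball_cong refl point(2))
  show ?thesis
  proof (intro conjI)
    show "\<forall>c\<in>\<A>. \<forall>a\<in>trivs E. \<forall>p\<in>fst c \<inter> fst a.
        form_le (kaehler_form \<omega> c p ^ CARD('n)) (?lhs c a p) (?rhs c a p)"
      by (intro ballI point(1))
    show "(\<forall>c\<in>\<A>. \<forall>a\<in>trivs E. \<forall>p\<in>fst c \<inter> fst a. ?lhs c a p = ?rhs c a p) \<longleftrightarrow>
      (\<forall>c\<in>\<A>. \<forall>a\<in>trivs E. \<forall>p\<in>fst c \<inter> fst a. ?einstein c a p)"
      by (rule eq)
    show "(\<forall>c\<in>\<A>. \<forall>a\<in>trivs E. \<forall>p\<in>fst c \<inter> fst a. ?lhs c a p = ?rhs c a p) \<longrightarrow>
      (\<forall>c\<in>\<A>. \<forall>a\<in>trivs E. \<forall>p\<in>fst c \<inter> fst a.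
        ?F c a p = mat (complex_of_real (1 / real CARD('r)) *\<^sub>C chern_form E h c a 1 p) \<and>
        chern_form E h c a 1 p = complex_of_real (lam * (real CARD('r) / real CARD('n))) *\<^sub>C kaehler_form \<omega> c p)"
      unfolding eq
    proof (intro impI ballI)
      fix c a p
      assume all: "\<forall>c\<in>\<A>. \<forall>a\<in>trivs E. \<forall>p\<in>fst c \<inter> fst a. ?einstein c a p"
        and "c \<in> \<A>" "a \<in> trivs E" "p \<in> fst c \<inter> fst a"
      then have "?einstein c a p" by (intro all[rule_format])
      then show "?F c a p = mat (complex_of_real (1 / real CARD('r)) *\<^sub>C chern_form E h c a 1 p) \<and>
        chern_form E h c a 1 p = complex_of_real (lam * (real CARD('r) / real CARD('n))) *\<^sub>C kaehler_form \<omega> c p"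
        by (rule flat)
    qed
  qed
qed

end
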